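(* Let $n\ge 2$, let $p$ be a prime, let $N\ge 0$ be an integer and let $\alpha=(\alpha_1,\dots,\alpha_n)\in\mathcal P(n,N)$. Then $$f_\alpha(p)=\sum_{\substack{0\le r_1\le N\\ \beta\in\mathcal P(n-1,N-r_1)}}\left(f_\beta(p)\cdot\sum_{\delta\in T(r_1,\alpha,\beta)}\tau(\beta,\delta)\right).$$
   Context: Lattices. An $n$-dimensional lattice is the $\mathbb{Z}$-span of $n$ linearly independent vectors in a Euclidean space; a sublattice is a subset which is itself an $n$-dimensional lattice. The invariant factors of a sublattice $\Lambda^*$ of $\Lambda$ are the diagonal entries $d_1\mid\cdots\mid d_n$ (positive integers) of the Smith normal form of the integer matrix expressing a basis of $\Lambda^*$ in a basis of $\Lambda$. Partitions. $\mathcal P(n,k)=\{(\alpha_1,\dots,\alpha_n)\in\mathbb{Z}^n: 0\le\alpha_1\le\cdots\le\alpha_n,\ \sum_{i=1}^n\alpha_i=k\}$. For $\alpha\in\mathcal P(n,k)$, $f_\alpha(p)$ is the number of sublattices of an $n$-dimensional lattice with invariant factors $p^{\alpha_1},\dots,p^{\alpha_n}$ (this does not depend on the lattice). The quantities $\eta_k$ and $k_0$. Let $r_1\ge 0$ be an integer, $\beta=(\beta_1,\dots,\beta_{n-1})\in\mathcal P(n-1,N-r_1)$, and $\delta=(\delta_1,\dots,\delta_{n-1})\in\mathbb{Z}^{n-1}$ with $0\le\delta_i\le\beta_i$ for $1\le i\le n-1$ ($\delta$ need not be nondecreasing). For $1\le k\le n-1$ set $$\eta_k=\eta_k(\beta,\delta)=\min\{\beta_k-\beta_i+\delta_i,\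 \delta_j\ :\ 1\le i<k,\ k\le j\le n-1\},$$ and set $\beta_0=\eta_0=0$. One has $\eta_0\le\eta_1\le\cdots\le\eta_{n-1}$. Let $k_0$ be the smallest $k\in\{1,\dots,n-1\}$ with $r_1<\eta_k$ if such a $k$ exists, and $k_0=n$ otherwise. The set $T$. $T(r_1,\alpha,\beta)$ is the set of all $(n-1)$-tuples of integers $\delta$ with $0\le\delta_i\le\beta_i$ for $1\le i\le n-1$ such that $$\alpha_k=\begin{cases}\beta_{k-1}+\eta_k-\eta_{k-1},&1\le k\le k_0-1,\\ \beta_{k_0-1}+r_1-\eta_{k_0-1},&k=k_0,\\ \beta_{k-1},&k_0+1\le k\le n.\end{cases}$$ The weight $\tau$. $$\tau(\beta,\delta)=\prod_{1\le i\le n-1,\ \delta_i<\beta_i}\left(p^{\beta_i-\delta_i}-p^{\beta_i-\delta_i-1}\right),$$ an empty product being $1$. *)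

theory Defs
  imports
    "HOL-Analysis.Euclidean_Space"
    "HOL-Computational_Algebra.Primes"
    "Jordan_Normal_Form.Matrix"
begin

definition zspan :: "'a::euclidean_space list \<Rightarrow> 'a set" where
  "zspan bs = {x. \<exists>c :: nat \<Rightarrow> int. x = (\<Sum>i<length bs. real_of_int (c i) *\<^sub>R (bs ! i))}"

definition lattice_basis :: "nat \<Rightarrow> 'a::euclidean_space set \<Rightarrow> 'a list \<Rightarrow> bool" where
  "lattice_basis n L bs \<longleftrightarrow>
     length bs = n \<and> distinct bs \<and> \<not> real_vector.dependent (set bs) \<and> L = zspan bs"

text \<open>The ambient space may have dimension larger than \<open>n\<close>.\<close>

definition is_lattice :: "nat \<Rightarrow> 'a::euclidean_space set \<Rightarrow> bool" where
  "is_lattice n L \<longleftrightarrow> (\<exists>bs. lattice_basis n L bs)"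

definition is_sublattice :: "nat \<Rightarrow> 'a::euclidean_space set \<Rightarrow> 'a set \<Rightarrow> bool" where
  "is_sublattice n L M \<longleftrightarrow> M \<subseteq> L \<and> is_lattice n M"

text \<open>Matrices and lists are indexed from 0, whereas all tuples below are functions
  indexed from 1; hence the shift by \<open>Suc\<close>.\<close>

definition smith_form :: "nat \<Rightarrow> int mat \<Rightarrow> (nat \<Rightarrow> int) \<Rightarrow> bool" where
  "smith_form n A d \<longleftrightarrow>
     A \<in> carrier_mat n n \<and>
     (\<exists>U \<in> carrier_mat n n. \<exists>V \<in> carrier_mat n n.
        invertible_mat U \<and> invertible_mat V \<and> U * A * V = mat_diag n (\<lambda>i. d (Suc i))) \<and>
     (\<forall>k \<in> {1..n}. 0 < d k) \<and>
     (\<forall>k \<in> {1..<n}. d k dvd d (Suc k))"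

text \<open>Column \<open>j\<close> of \<open>A\<close> holds the coordinates of the \<open>j\<close>-th basis vector of \<open>M\<close>. Changing either
  basis multiplies \<open>A\<close> by a matrix invertible over the integers, so the diagonal \<open>d\<close>
  does not depend on the bases and an existential quantifier suffices.\<close>

definition invariant_factors ::
    "nat \<Rightarrow> 'a::euclidean_space set \<Rightarrow> 'a set \<Rightarrow> (nat \<Rightarrow> int) \<Rightarrow> bool" where
  "invariant_factors n L M d \<longleftrightarrow>
     (\<exists>bs cs A. lattice_basis n L bs \<and> lattice_basis n M cs \<and>
        A \<in> carrier_mat n n \<and>
        (\<forall>j<n. cs ! j = (\<Sum>i<n. real_of_int (A $$ (i, j)) *\<^sub>R (bs ! i))) \<and>
        smith_form n A d)"

text \<open>An \<open>n\<close>-tuple of integers is a function that vanishes outside \<open>{1..n}\<close>. In particular every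
  tuple has value 0 at index 0, which is the convention \<open>\<beta> 0 = 0\<close>.\<close>

definition tuples :: "nat \<Rightarrow> (nat \<Rightarrow> int) set" where
  "tuples n = {\<alpha>. \<forall>i. i \<notin> {1..n} \<longrightarrow> \<alpha> i = 0}"

definition partitions :: "nat \<Rightarrow> int \<Rightarrow> (nat \<Rightarrow> int) set" where
  "partitions n k = {\<alpha> \<in> tuples n.
     (\<forall>i \<in> {1..n}. 0 \<le> \<alpha> i) \<and> (\<forall>i \<in> {1..<n}. \<alpha> i \<le> \<alpha> (Suc i)) \<and> (\<Sum>i=1..n. \<alpha> i) = k}"

text \<open>The number \<open>f\<^sub>\<alpha>(p)\<close>, computed in the \<open>n\<close>-dimensional lattice \<open>L\<close>. Only finitely many
  sublattices have given invariant factors, so \<open>card\<close> is the true count. Entries of \<open>\<alpha>\<close> are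
  nonnegative wherever this is used, so \<open>nat\<close> does not truncate.\<close>

definition num_sublattices ::
    "nat \<Rightarrow> 'a::euclidean_space set \<Rightarrow> (nat \<Rightarrow> int) \<Rightarrow> nat \<Rightarrow> nat" where
  "num_sublattices n L \<alpha> p =
     card {M. is_sublattice n L M \<and> invariant_factors n L M (\<lambda>i. int p ^ nat (\<alpha> i))}"

text \<open>In the following definitions \<open>\<beta>\<close> and \<open>\<delta>\<close> are \<open>(n - 1)\<close>-tuples.\<close>

definition eta :: "nat \<Rightarrow> (nat \<Rightarrow> int) \<Rightarrow> (nat \<Rightarrow> int) \<Rightarrow> nat \<Rightarrow> int" where
  "eta n \<beta> \<delta> k =
     (if k = 0 then 0
      else Min ({\<beta> k - \<beta> i + \<delta> i | i. 1 \<le> i \<and> i < k} \<union> {\<delta> j | j. k \<le> j \<and> j \<le> n - 1}))"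

definition k0 :: "nat \<Rightarrow> int \<Rightarrow> (nat \<Rightarrow> int) \<Rightarrow> (nat \<Rightarrow> int) \<Rightarrow> nat" where
  "k0 n r1 \<beta> \<delta> =
     (if \<exists>k \<in> {1..n-1}. r1 < eta n \<beta> \<delta> k
      then LEAST k. k \<in> {1..n-1} \<and> r1 < eta n \<beta> \<delta> k
      else n)"

definition T :: "nat \<Rightarrow> int \<Rightarrow> (nat \<Rightarrow> int) \<Rightarrow> (nat \<Rightarrow> int) \<Rightarrow> (nat \<Rightarrow> int) set" where
  "T n r1 \<alpha> \<beta> = {\<delta> \<in> tuples (n - 1).
     (\<forall>i \<in> {1..n-1}. 0 \<le> \<delta> i \<and> \<delta> i \<le> \<beta> i) \<and>
     (\<forall>k \<in> {1..n}. \<alpha> k =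
        (if k < k0 n r1 \<beta> \<delta> then \<beta> (k - 1) + eta n \<beta> \<delta> k - eta n \<beta> \<delta> (k - 1)
         else if k = k0 n r1 \<beta> \<delta> then \<beta> (k - 1) + r1 - eta n \<beta> \<delta> (k - 1)
         else \<beta> (k - 1)))}"

definition tau :: "nat \<Rightarrow> nat \<Rightarrow> (nat \<Rightarrow> int) \<Rightarrow> (nat \<Rightarrow> int) \<Rightarrow> int" where
  "tau n p \<beta> \<delta> =
     (\<Prod>i \<in> {i \<in> {1..n-1}. \<delta> i < \<beta> i}.
        int p ^ nat (\<beta> i - \<delta> i) - int p ^ nat (\<beta> i - \<delta> i - 1))"

end

theory Submission
  imports Defs "Jordan_Normal_Form.Determinant"
begin

text \<open>
  The proof counts sublattices by their intersection with a hyperplane. In coordinates the lattice is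
  \<open>\<int>\<^sup>n\<close> with \<open>n = m + 1\<close>. A subgroup \<open>H\<close> of \<open>p\<close>-power index is determined by three data: the lattice \<open>K\<close>
  of all \<open>y\<close> in \<open>\<int>\<^sup>m\<close> with \<open>(0, y)\<close> in \<open>H\<close>, the power \<open>p ^ r\<close> that generates the ideal of first
  coordinates of \<open>H\<close>, and the class modulo \<open>K\<close> of a vector \<open>v\<close> with \<open>(p ^ r, v)\<close> in \<open>H\<close>. All such data
  occur. Let \<open>\<beta>\<close> be the type of \<open>K\<close>, that is, let its invariant factors be \<open>p\<close> to the powers
  \<open>\<beta>\<^sub>1, \<dots>, \<beta>\<^sub>m\<close>. After a change of basis of \<open>\<int>\<^sup>m\<close> the lattice \<open>K\<close> is diagonal, and the class of \<open>v\<close> is a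
  vector \<open>w\<close> of residues modulo the powers \<open>p ^ \<beta>\<^sub>i\<close>. So \<open>H\<close> is spanned by the columns of a matrix
  with first column \<open>(p ^ r, w)\<close> and diagonal block of type \<open>\<beta>\<close>, and it remains to count, for given \<open>r\<close> and
  \<open>K\<close>, the \<open>w\<close> for which \<open>H\<close> has type \<open>\<alpha>\<close>.

  The type is detected by minors: the largest power of \<open>p\<close> dividing all \<open>k\<close>-minors is unchanged by
  unimodular transformations (\<open>minors_dvd_column_lattice\<close>). For a diagonal matrix of type \<open>\<alpha>\<close> its exponent
  is \<open>\<alpha>\<^sub>1 + \<dots> + \<alpha>\<^sub>k\<close>. For the matrix of an extension it is \<open>\<beta>\<^sub>1 + \<dots> + \<beta>\<^sub>k\<^sub>-\<^sub>1 + min \<eta>\<^sub>k r\<close>, where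
  \<open>\<delta>\<^sub>i\<close> is the valuation of \<open>w\<^sub>i\<close> (\<open>extension_minors_dvd_imp\<close>, \<open>extension_minors_dvd\<close>): a nonzero
  term of a \<open>k\<close>-minor consists of \<open>k - 1\<close> diagonal entries and one entry of the first column in another row,
  or of \<open>k\<close> diagonal entries, and \<open>\<eta>\<^sub>k\<close> is the result of minimising over that row. As \<open>\<eta>\<close> is
  nondecreasing, \<open>k\<^sub>0\<close> is where the minimum changes from \<open>\<eta>\<^sub>k\<close> to \<open>r\<close>, and equality of the two
  exponents for all \<open>k\<close> is, after taking differences, the definition of \<open>T\<close> (\<open>T_iff_partial_sums\<close>).
  Thus \<open>H\<close> has type \<open>\<alpha>\<close> if and only if \<open>\<delta>\<close> belongs to \<open>T\<close>, and \<open>\<tau>\<close> is the number of residue vectors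
  with valuations \<open>\<delta>\<close>. Summation over \<open>r\<close>, \<open>\<beta>\<close>, \<open>K\<close> and \<open>\<delta>\<close> gives the formula
  (\<open>card_typed_sublattices_Suc\<close>).

  Two further facts support this argument. Every subgroup of \<open>p\<close>-power index has a type
  (\<open>exists_typed_sublattice\<close>). And the numbers in the formula do not depend on the ambient lattices, because
  they can be computed in coordinates (\<open>num_sublattices_eq_card_typed\<close>).
\<close>

section \<open>Unimodular matrices and lattices spanned by columns\<close>

definition GL :: "nat \<Rightarrow> int mat set" where
  "GL n = {P \<in> carrier_mat n n. invertible_mat P}"

definition column_lattice :: "int mat \<Rightarrow> int vec set" where
  "column_lattice A = {A *\<^sub>v x | x. x \<in> carrier_vec (dim_col A)}"

definition int_subgroup :: "nat \<Rightarrow> int vec set \<Rightarrow> bool" where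
  "int_subgroup n H \<longleftrightarrow> H \<subseteq> carrier_vec n \<and> 0\<^sub>v n \<in> H \<and> (\<forall>x\<in>H. \<forall>y\<in>H. x - y \<in> H)"

definition power_diag :: "nat \<Rightarrow> nat \<Rightarrow> (nat \<Rightarrow> int) \<Rightarrow> int mat" where
  "power_diag p n \<alpha> = mat_diag n (\<lambda>i. int p ^ nat (\<alpha> (Suc i)))"

text \<open>In a Smith normal form \<open>U A V = D\<close> the factor \<open>V\<close> only changes the basis of the sublattice, so
  a single unimodular factor on the left describes all sublattices of \<open>\<int>\<^sup>n\<close> with invariant
  factors \<open>p\<close> to the powers \<open>\<alpha>\<^sub>1, \<dots>, \<alpha>\<^sub>n\<close>. Below, \<open>\<alpha>\<close> is called the type of such a sublattice.\<close>

definition typed_sublattices :: "nat \<Rightarrow> nat \<Rightarrow> (nat \<Rightarrow> int) \<Rightarrow> int vec set set" where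
  "typed_sublattices p n \<alpha> = {column_lattice (P * power_diag p n \<alpha>) | P. P \<in> GL n}"

lemma GL_carrier: "P \<in> GL n \<Longrightarrow> P \<in> carrier_mat n n"
  by (simp add: GL_def)

lemma GL_I:
  assumes "P \<in> carrier_mat n n" "Q \<in> carrier_mat n n" "P * Q = 1\<^sub>m n" "Q * P = 1\<^sub>m n"
  shows "P \<in> GL n"
  using assms unfolding GL_def invertible_mat_def inverts_mat_def by auto

lemma GL_inverse:
  assumes "P \<in> GL n"
  obtains Q where "Q \<in> GL n" "P * Q = 1\<^sub>m n" "Q * P = 1\<^sub>m n"
proof -
  from assms obtain Q where P: "P \<in> carrier_mat n n" and PQ: "P * Q = 1\<^sub>m n"
    and QP: "Q * P = 1\<^sub>m (dim_row Q)"
    unfolding GL_def invertible_mat_def inverts_mat_def by auto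
  have "dim_col Q = n" using arg_cong[OF PQ, of dim_col] by simp
  moreover have "dim_row Q = n" using arg_cong[OF QP, of dim_col] P by simp
  ultimately have Q: "Q \<in> carrier_mat n n" by auto
  show thesis
    by (rule that[OF GL_I[OF Q P]]) (use PQ QP Q in auto)
qed

lemma GL_one: "1\<^sub>m n \<in> GL n"
  by (rule GL_I[of _ _ "1\<^sub>m n"]) auto

lemma GL_mult:
  assumes "P \<in> GL n" "Q \<in> GL n"
  shows "P * Q \<in> GL n"
proof -
  obtain P' where P': "P' \<in> GL n" "P * P' = 1\<^sub>m n" "P' * P = 1\<^sub>m n" using GL_inverse[OF assms(1)] .
  obtain Q' where Q': "Q' \<in> GL n" "Q * Q' = 1\<^sub>m n" "Q' * Q = 1\<^sub>m n" using GL_inverse[OF assms(2)] .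
  note c = GL_carrier[OF assms(1)] GL_carrier[OF assms(2)] GL_carrier[OF P'(1)] GL_carrier[OF Q'(1)]
  have "P * Q * (Q' * P') = P * (Q * Q') * P'"
    using c by (simp add: assoc_mult_mat[of _ n n _ n _ n])
  then have 1: "P * Q * (Q' * P') = 1\<^sub>m n" using c Q' P' by simp
  have "Q' * P' * (P * Q) = Q' * (P' * P) * Q"
    using c by (simp add: assoc_mult_mat[of _ n n _ n _ n])
  then have 2: "Q' * P' * (P * Q) = 1\<^sub>m n" using c Q' P' by simp
  show ?thesis using c by (intro GL_I[OF _ _ 1 2]) auto
qed

lemma mult_inverse_vec:
  fixes P Q :: "int mat"
  assumes "P \<in> carrier_mat n n" "Q \<in> carrier_mat n n" "P * Q = 1\<^sub>m n" "x \<in> carrier_vec n"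
  shows "P *\<^sub>v (Q *\<^sub>v x) = x"
  using assms by (metis assoc_mult_mat_vec one_mult_mat_vec)

lemma mult_mat_vec_int:
  fixes A :: "int mat"
  assumes "A \<in> carrier_mat m n" "v \<in> carrier_vec n"
  shows "A *\<^sub>v (c \<cdot>\<^sub>v v) = c \<cdot>\<^sub>v (A *\<^sub>v v)"
proof (rule eq_vecI)
  fix i assume "i < dim_vec (c \<cdot>\<^sub>v (A *\<^sub>v v))"
  then show "(A *\<^sub>v (c \<cdot>\<^sub>v v)) $ i = (c \<cdot>\<^sub>v (A *\<^sub>v v)) $ i"
    using assms scalar_prod_smult_distrib[of "row A i" n v c] by simp
qed (use assms in auto)

lemma eq_mat_by_action:
  fixes A B :: "int mat"
  assumes "A \<in> carrier_mat m n" "B \<in> carrier_mat m n"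
    and "\<And>x. x \<in> carrier_vec n \<Longrightarrow> A *\<^sub>v x = B *\<^sub>v x"
  shows "A = B"
proof (rule eq_matI)
  fix i j assume "i < dim_row B" "j < dim_col B"
  then have ij: "i < m" "j < n" using assms by auto
  have "(A *\<^sub>v unit_vec n j) $ i = (B *\<^sub>v unit_vec n j) $ i" using assms(3) by simp
  then show "A $$ (i,j) = B $$ (i,j)" using ij assms(1,2) by simp
qed (use assms in auto)

lemma column_lattice_iff:
  "A \<in> carrier_mat m n \<Longrightarrow> v \<in> column_lattice A \<longleftrightarrow> (\<exists>x\<in>carrier_vec n. v = A *\<^sub>v x)"
  by (auto simp: column_lattice_def)

lemma column_lattice_mult_right:
  assumes A: "A \<in> carrier_mat m n" and P: "P \<in> GL n"
  shows "column_lattice (A * P) = column_lattice A"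
proof -
  obtain Q where Q: "Q \<in> GL n" "P * Q = 1\<^sub>m n" "Q * P = 1\<^sub>m n" using GL_inverse[OF P] .
  note cP = GL_carrier[OF P] and cQ = GL_carrier[OF Q(1)]
  have eq: "A * P *\<^sub>v x = A *\<^sub>v (P *\<^sub>v x)" if "x \<in> carrier_vec n" for x
    using assoc_mult_mat_vec[OF A cP that] .
  have AP: "A * P \<in> carrier_mat m n" using A cP by auto
  show ?thesis
  proof (intro equalityI subsetI)
    fix v assume "v \<in> column_lattice (A * P)"
    then obtain x where x: "x \<in> carrier_vec n" "v = A * P *\<^sub>v x" unfolding column_lattice_iff[OF AP] by blast
    have "P *\<^sub>v x \<in> carrier_vec n" using cP x by auto
    then show "v \<in> column_lattice A" unfolding column_lattice_iff[OF A] using x eq[OF x(1)] by blast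
  next
    fix v assume "v \<in> column_lattice A"
    then obtain x where x: "x \<in> carrier_vec n" "v = A *\<^sub>v x" unfolding column_lattice_iff[OF A] by blast
    have Qx: "Q *\<^sub>v x \<in> carrier_vec n" using cQ x by auto
    have "v = A * P *\<^sub>v (Q *\<^sub>v x)" using eq[OF Qx] mult_inverse_vec[OF cP cQ Q(2) x(1)] x by simp
    then show "v \<in> column_lattice (A * P)" unfolding column_lattice_iff[OF AP] using Qx by blast
  qed
qed

text \<open>Each column of \<open>A'\<close> lies in the lattice, so it is an integer combination of the columns of \<open>A\<close>;
  the coefficients are the columns of \<open>Y\<close>.\<close>

lemma column_lattice_factor:
  assumes A: "A \<in> carrier_mat m n" and A': "A' \<in> carrier_mat m l"
    and sub: "column_lattice A' \<subseteq> column_lattice A"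
  shows "\<exists>Y\<in>carrier_mat n l. A' = A * Y"
proof -
  have "\<exists>y\<in>carrier_vec n. col A' j = A *\<^sub>v y" if "j < l" for j
  proof -
    have "col A' j = A' *\<^sub>v unit_vec l j" using that A' by (intro eq_vecI) auto
    then have "col A' j \<in> column_lattice A'" using A' by (auto simp: column_lattice_def)
    then show ?thesis using sub A by (auto simp: column_lattice_iff)
  qed
  then obtain y where y: "\<And>j. j < l \<Longrightarrow> y j \<in> carrier_vec n \<and> col A' j = A *\<^sub>v y j" by metis
  define Y where "Y = mat n l (\<lambda>(i,j). y j $ i)"
  have Y: "Y \<in> carrier_mat n l" by (simp add: Y_def)
  have colY: "col Y j = y j" if "j < l" for j
    using y[OF that] that by (intro eq_vecI) (auto simp: Y_def)
  have "A' = A * Y"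
  proof (rule eq_matI)
    fix i j assume "i < dim_row (A * Y)" "j < dim_col (A * Y)"
    then have ij: "i < m" "j < l" using A Y by auto
    have "A' $$ (i,j) = col A' j $ i" using ij A' by simp
    also have "\<dots> = (A * Y) $$ (i,j)" using y[OF ij(2)] colY[OF ij(2)] ij A Y by simp
    finally show "A' $$ (i,j) = (A * Y) $$ (i,j)" .
  qed (use A A' Y in auto)
  with Y show ?thesis by blast
qed

lemma int_subgroup_column_lattice:
  assumes A: "A \<in> carrier_mat m n"
  shows "int_subgroup m (column_lattice A)"
  unfolding int_subgroup_def
proof (intro conjI ballI subsetI)
  show "0\<^sub>v m \<in> column_lattice A"
    unfolding column_lattice_iff[OF A] using A by (intro bexI[of _ "0\<^sub>v n"]) auto
  fix x y assume "x \<in> column_lattice A" "y \<in> column_lattice A"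
  then obtain u v where "u \<in> carrier_vec n" "v \<in> carrier_vec n" "x = A *\<^sub>v u" "y = A *\<^sub>v v"
    unfolding column_lattice_iff[OF A] by auto
  then show "x - y \<in> column_lattice A"
    unfolding column_lattice_iff[OF A] using A
    by (intro bexI[of _ "u - v"]) (auto simp: mult_minus_distrib_mat_vec)
qed (use A in \<open>auto simp: column_lattice_def\<close>)

lemma int_subgroup_add:
  assumes H: "int_subgroup n H" and "x \<in> H" "y \<in> H"
  shows "x + y \<in> H"
proof -
  have c: "x \<in> carrier_vec n" "y \<in> carrier_vec n" and d: "x - (0\<^sub>v n - y) \<in> H"
    using assms unfolding int_subgroup_def by auto
  have "x - (0\<^sub>v n - y) = x + y" using c by (intro eq_vecI) auto
  then show ?thesis using d by simp
qed

lemma int_subgroup_smult: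
  assumes H: "int_subgroup n H" and x: "x \<in> H"
  shows "c \<cdot>\<^sub>v x \<in> H"
proof -
  have c: "x \<in> carrier_vec n" and z: "0\<^sub>v n \<in> H" using assms unfolding int_subgroup_def by auto
  have nat: "int k \<cdot>\<^sub>v x \<in> H" for k
  proof (induction k)
    case 0
    have "int 0 \<cdot>\<^sub>v x = 0\<^sub>v n" using c by (intro eq_vecI) auto
    then show ?case using z by simp
  next
    case (Suc k)
    have "int (Suc k) \<cdot>\<^sub>v x = int k \<cdot>\<^sub>v x + x" using c by (intro eq_vecI) (auto simp: algebra_simps)
    then show ?case using int_subgroup_add[OF H Suc x] by simp
  qed
  show ?thesis
  proof (cases c rule: int_cases2)
    case (nonneg k) then show ?thesis using nat by simp
  next
    case (nonpos k)
    have "c \<cdot>\<^sub>v x = 0\<^sub>v n - int k \<cdot>\<^sub>v x" using c nonpos by (intro eq_vecI) auto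
    then show ?thesis using nat[of k] z H unfolding int_subgroup_def by auto
  qed
qed

lemma int_subgroup_image:
  assumes H: "int_subgroup n H" and Q: "Q \<in> carrier_mat n n"
  shows "int_subgroup n ((*\<^sub>v) Q ` H)"
  unfolding int_subgroup_def
proof (intro conjI ballI subsetI)
  show "0\<^sub>v n \<in> (*\<^sub>v) Q ` H"
    using H Q unfolding int_subgroup_def by (intro image_eqI[of _ _ "0\<^sub>v n"]) auto
  fix x y assume "x \<in> (*\<^sub>v) Q ` H" "y \<in> (*\<^sub>v) Q ` H"
  then obtain u v where "u \<in> H" "v \<in> H" "x = Q *\<^sub>v u" "y = Q *\<^sub>v v" by auto
  moreover from this have "u \<in> carrier_vec n" "v \<in> carrier_vec n" "u - v \<in> H"
    using H unfolding int_subgroup_def by auto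
  ultimately show "x - y \<in> (*\<^sub>v) Q ` H" using Q
    by (intro image_eqI[of _ _ "u - v"]) (auto simp: mult_minus_distrib_mat_vec)
qed (use H Q in \<open>auto simp: int_subgroup_def\<close>)

text \<open>The block diagonal matrix with blocks 1 and \<open>P\<close>: a change of basis of the hyperplane \<open>\<int>\<^sup>m\<close>
  extended to \<open>\<int>\<^sup>m\<^sup>+\<^sup>1\<close>. The additional coordinate is always the first one.\<close>

definition bordered :: "int mat \<Rightarrow> int mat" where
  "bordered P = mat (Suc (dim_row P)) (Suc (dim_col P))
     (\<lambda>(i,j). if i = 0 \<or> j = 0 then (if i = j then 1 else 0) else P $$ (i - 1, j - 1))"

lemma bordered_carrier: "P \<in> carrier_mat m n \<Longrightarrow> bordered P \<in> carrier_mat (Suc m) (Suc n)"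
  by (auto simp: bordered_def)

lemma bordered_mult_vCons:
  assumes P: "P \<in> carrier_mat m n" and y: "y \<in> carrier_vec n"
  shows "bordered P *\<^sub>v vCons a y = vCons a (P *\<^sub>v y)"
proof (rule eq_vecI)
  fix i assume "i < dim_vec (vCons a (P *\<^sub>v y))"
  then have i: "i < Suc m" using P by simp
  show "(bordered P *\<^sub>v vCons a y) $ i = vCons a (P *\<^sub>v y) $ i"
  proof (cases i)
    case 0
    have "row (bordered P) 0 = vCons 1 (0\<^sub>v n)"
      using P by (intro eq_vecI) (auto simp: bordered_def vec_index_vCons)
    then show ?thesis using P y 0 by (auto simp: bordered_def)
  next
    case (Suc k)
    have "row (bordered P) (Suc k) = vCons 0 (row P k)"
      using P i Suc by (intro eq_vecI) (auto simp: bordered_def vec_index_vCons)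
    then show ?thesis using P y Suc i by (auto simp: bordered_def)
  qed
qed (use P in \<open>auto simp: bordered_def\<close>)

lemma carrier_vec_Suc_cases:
  assumes "z \<in> carrier_vec (Suc n)"
  obtains t y where "y \<in> carrier_vec n" "z = vCons t y"
proof (cases z rule: vec_cases)
  case (vCons a w)
  then show thesis using that[of w a] assms by simp
qed (use assms in simp)

lemma bordered_GL:
  assumes "P \<in> GL n"
  shows "bordered P \<in> GL (Suc n)"
proof -
  obtain Q where Q: "Q \<in> GL n" "P * Q = 1\<^sub>m n" "Q * P = 1\<^sub>m n" using GL_inverse[OF assms] .
  note c = GL_carrier[OF assms] GL_carrier[OF Q(1)]
  have *: "bordered A * bordered B = 1\<^sub>m (Suc n)"
    if AB: "A \<in> carrier_mat n n" "B \<in> carrier_mat n n" "A * B = 1\<^sub>m n" for A B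
  proof (rule eq_mat_by_action)
    fix x :: "int vec" assume "x \<in> carrier_vec (Suc n)"
    then obtain t y where y: "y \<in> carrier_vec n" "x = vCons t y" by (rule carrier_vec_Suc_cases)
    have "bordered A *\<^sub>v (bordered B *\<^sub>v x) = x"
      using AB y mult_inverse_vec[OF AB] by (simp add: bordered_mult_vCons[of _ n n])
    then show "bordered A * bordered B *\<^sub>v x = 1\<^sub>m (Suc n) *\<^sub>v x"
      using AB y by (simp add: assoc_mult_mat_vec[OF bordered_carrier bordered_carrier])
  qed (use AB in \<open>auto simp: bordered_def\<close>)
  show ?thesis
    by (rule GL_I[of _ _ "bordered Q"]) (use c Q * bordered_carrier in auto)
qed

lemma power_diag_carrier [simp]: "power_diag p n \<alpha> \<in> carrier_mat n n"
  by (simp add: power_diag_def)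

lemma power_diag_mult_vec:
  assumes "z \<in> carrier_vec n" "i < n"
  shows "(power_diag p n \<alpha> *\<^sub>v z) $ i = int p ^ nat (\<alpha> (Suc i)) * z $ i"
proof -
  have "(power_diag p n \<alpha> *\<^sub>v z) $ i =
      (\<Sum>j = 0..<n. (if i = j then int p ^ nat (\<alpha> (Suc j)) else 0) * z $ j)"
    using assms by (auto simp: power_diag_def mat_diag_def scalar_prod_def)
  also have "\<dots> = (\<Sum>j = 0..<n. if j = i then int p ^ nat (\<alpha> (Suc i)) * z $ i else 0)"
    by (rule sum.cong) auto
  finally show ?thesis using assms by simp
qed

section \<open>Smith normal form of subgroups of prime power index\<close>

lemma int_power_dvd_iff:
  assumes "prime p"
  shows "int p ^ a dvd int p ^ b \<longleftrightarrow> a \<le> b"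
proof -
  have "int p ^ a dvd int p ^ b \<longleftrightarrow> p ^ a dvd p ^ b"
    by (simp only: of_nat_power[symmetric] of_nat_dvd_iff)
  also have "\<dots> \<longleftrightarrow> a \<le> b"
    using power_dvd_imp_le[of p a b] prime_gt_1_nat[OF assms] by (auto simp: le_imp_power_dvd)
  finally show ?thesis .
qed

text \<open>Euclid's algorithm on the entries of a vector: while two entries are nonzero, adding the
  smaller one to the larger one, or subtracting it, decreases the sum of the absolute values.\<close>

lemma GL_reduce_to_single_entry:
  assumes "h \<in> carrier_vec (Suc n)"
  shows "\<exists>Q\<in>GL (Suc n). \<exists>c. Q *\<^sub>v h = vCons c (0\<^sub>v n)"
  using assms
proof (induction "\<Sum>i<Suc n. nat \<bar>h $ i\<bar>" arbitrary: h rule: less_induct)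
  case less
  have reduce: ?case if ij: "i < Suc n" "j < Suc n" "i \<noteq> j" "h $ j \<noteq> 0" "\<bar>h $ j\<bar> \<le> \<bar>h $ i\<bar>" for i j
  proof -
    \<comment> \<open>The sign for which adding the smaller entry to the larger one decreases the absolute value.\<close>
    define a where "a = - (sgn (h $ i) * sgn (h $ j))"
    let ?E = "addrow_mat (Suc n) a i j"
    have E: "?E \<in> GL (Suc n)"
      using addrow_mat_inv[OF ij(1-3), of a] addrow_mat_inv[OF ij(1-3), of "- a"]
      by (intro GL_I[of _ _ "addrow_mat (Suc n) (- a) i j"]) auto
    have Eh: "(?E *\<^sub>v h) $ l = (if l = i then h $ i + a * h $ j else h $ l)" if "l < Suc n" for l
      using that ij less.prems
      by (cases "l = i") (auto simp: row_addrow add_scalar_prod_distrib[of _ "Suc n"] smult_scalar_prod_distrib[of _ "Suc n"])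
    have lt: "nat \<bar>h $ i + a * h $ j\<bar> < nat \<bar>h $ i\<bar>"
      using ij(4,5) by (auto simp: a_def sgn_if abs_if split: if_splits)
    have "(\<Sum>l<Suc n. nat \<bar>(?E *\<^sub>v h) $ l\<bar>) < (\<Sum>l<Suc n. nat \<bar>h $ l\<bar>)"
    proof (rule sum_strict_mono_ex1)
      show "\<forall>x\<in>{..<Suc n}. nat \<bar>(?E *\<^sub>v h) $ x\<bar> \<le> nat \<bar>h $ x\<bar>"
      proof
        fix x assume "x \<in> {..<Suc n}"
        then show "nat \<bar>(?E *\<^sub>v h) $ x\<bar> \<le> nat \<bar>h $ x\<bar>"
          using Eh[of x] lt by (cases "x = i") (auto simp del: nat_le_eq_zle)
      qed
      show "\<exists>a\<in>{..<Suc n}. nat \<bar>(?E *\<^sub>v h) $ a\<bar> < nat \<bar>h $ a\<bar>"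
        using Eh[OF ij(1)] lt ij(1) by (intro bexI[of _ i]) auto
    qed simp
    moreover have Ehc: "?E *\<^sub>v h \<in> carrier_vec (Suc n)"
      using less.prems by (intro mult_mat_vec_carrier[of _ _ "Suc n"]) auto
    ultimately obtain Q c where Q: "Q \<in> GL (Suc n)" "Q *\<^sub>v (?E *\<^sub>v h) = vCons c (0\<^sub>v n)"
      using less.hyps by blast
    have "Q * ?E *\<^sub>v h = Q *\<^sub>v (?E *\<^sub>v h)"
      using GL_carrier[OF Q(1)] less.prems by (intro assoc_mult_mat_vec) auto
    then show ?thesis using Q GL_mult[OF Q(1) E] by metis
  qed
  show ?case
  proof (cases "\<exists>i j. i < Suc n \<and> j < Suc n \<and> i \<noteq> j \<and> h $ i \<noteq> 0 \<and> h $ j \<noteq> 0")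
    case True
    then obtain i j where "i < Suc n" "j < Suc n" "i \<noteq> j" "h $ i \<noteq> 0" "h $ j \<noteq> 0" by blast
    then show ?thesis using reduce[of i j] reduce[of j i] by linarith
  next
    case False
    obtain l where l: "l < Suc n" "\<And>i. i < Suc n \<Longrightarrow> i \<noteq> l \<Longrightarrow> h $ i = 0"
      using False by (metis zero_less_Suc)
    let ?W = "swaprows_mat (Suc n) 0 l"
    have W: "?W \<in> GL (Suc n)" using swaprows_mat_inv[of 0 "Suc n" l] l by (intro GL_I[of _ _ ?W]) auto
    have "?W *\<^sub>v h = vCons (h $ l) (0\<^sub>v n)"
    proof (rule eq_vecI)
      fix i assume "i < dim_vec (vCons (h $ l) (0\<^sub>v n))"
      then have i: "i < Suc n" by simp
      show "(?W *\<^sub>v h) $ i = vCons (h $ l) (0\<^sub>v n) $ i"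
        using i l less.prems
        by (cases "i = 0"; cases "i = l"; cases "l = 0") (auto simp: row_swaprows vec_index_vCons)
    qed simp
    then show ?thesis using W by blast
  qed
qed

lemma mem_column_lattice_power_diag:
  assumes "P \<in> GL n"
  shows "v \<in> column_lattice (P * power_diag p n \<alpha>) \<longleftrightarrow>
    (\<exists>z\<in>carrier_vec n. v = P *\<^sub>v (power_diag p n \<alpha> *\<^sub>v z))"
  using GL_carrier[OF assms]
  by (subst column_lattice_iff[of _ n n]) (auto simp: assoc_mult_mat_vec[of _ n n _ n])

text \<open>Prepending a smallest part to a shifted partition: both the new exponent \<open>k\<close> and the shift of
  the old exponents by \<open>k\<close> come from one common factor \<open>p ^ k\<close>.\<close>

lemma power_diag_Suc:
  assumes z: "z \<in> carrier_vec n" and k: "0 \<le> k" and \<alpha>: "\<And>i. i \<in> {1..n} \<Longrightarrow> 0 \<le> \<alpha> i"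
  shows "power_diag p (Suc n) (\<lambda>i. if i \<in> {1..Suc n} then k + (if i = 1 then 0 else \<alpha> (i - 1)) else 0) *\<^sub>v vCons t z
    = int p ^ nat k \<cdot>\<^sub>v vCons t (power_diag p n \<alpha> *\<^sub>v z)" (is "power_diag p _ ?a *\<^sub>v _ = _")
proof (rule eq_vecI)
  fix i assume "i < dim_vec (int p ^ nat k \<cdot>\<^sub>v vCons t (power_diag p n \<alpha> *\<^sub>v z))"
  then have i: "i < Suc n" by (simp add: power_diag_def mat_diag_def)
  have "(power_diag p (Suc n) ?a *\<^sub>v vCons t z) $ i = int p ^ nat (?a (Suc i)) * vCons t z $ i"
    using i z by (intro power_diag_mult_vec) auto
  also have "\<dots> = (int p ^ nat k \<cdot>\<^sub>v vCons t (power_diag p n \<alpha> *\<^sub>v z)) $ i"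
  proof (cases i)
    case (Suc l)
    then have "nat (k + \<alpha> i) = nat k + nat (\<alpha> i)" using \<alpha>[of i] i k by (intro nat_add_distrib) auto
    then show ?thesis using Suc i z power_diag_mult_vec[OF z, of l p \<alpha>]
      by (simp add: power_add vec_index_vCons power_diag_def mat_diag_def)
  qed (use z in simp)
  finally show "(power_diag p (Suc n) ?a *\<^sub>v vCons t z) $ i = (int p ^ nat k \<cdot>\<^sub>v vCons t (power_diag p n \<alpha> *\<^sub>v z)) $ i" .
qed (simp add: power_diag_def mat_diag_def)

text \<open>The Smith normal form of a subgroup \<open>H\<close> containing \<open>p ^ m\<close> times \<open>\<int>\<^sup>n\<close>. Divide \<open>H\<close> by the
  largest power \<open>p ^ k\<close> dividing all its vectors. Some vector is then nonzero modulo \<open>p\<close>, and a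
  unimodular matrix moves it to \<open>c\<close> times the first unit vector with \<open>c\<close> prime to \<open>p\<close>. As
  \<open>p ^ m\<close> times the first unit vector also lies in the subgroup, so does the first unit vector itself.
  It splits off as a direct summand, and induction applies to the remaining \<open>n - 1\<close> coordinates.
  Every part found later is at least \<open>k\<close>, because the factor \<open>p ^ k\<close> was taken out first.\<close>

lemma exists_typed_sublattice:
  assumes p: "prime p" and "int_subgroup n H"
    and "\<And>x. x \<in> carrier_vec n \<Longrightarrow> int p ^ m \<cdot>\<^sub>v x \<in> H"
  shows "\<exists>N. \<exists>\<alpha>\<in>partitions n N. H \<in> typed_sublattices p n \<alpha>"
  using assms(2,3)
proof (induction n arbitrary: H)
  case 0
  have c0: "x = 0\<^sub>v 0" if "x \<in> carrier_vec 0" for x :: "int vec"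
    using that by (intro eq_vecI) auto
  let ?A = "1\<^sub>m 0 * power_diag p 0 (\<lambda>i. 0)"
  have "int_subgroup 0 (column_lattice ?A)" by (rule int_subgroup_column_lattice[of _ _ 0]) (intro mult_carrier_mat[of _ _ 0], auto)
  then have "column_lattice ?A = {0\<^sub>v 0}" "H = {0\<^sub>v 0}"
    using 0(1) c0 unfolding int_subgroup_def by blast+
  moreover have "(\<lambda>i. 0) \<in> partitions 0 0" by (simp add: partitions_def tuples_def)
  ultimately show ?case unfolding typed_sublattices_def using GL_one[of 0] by force
next
  case (Suc n)
  have Hc: "H \<subseteq> carrier_vec (Suc n)" using Suc.prems(1) by (simp add: int_subgroup_def)
  define K where "K = {k. \<forall>h\<in>H. \<forall>i<Suc n. int p ^ k dvd h $ i}"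
  have Kle: "k \<le> m" if "k \<in> K" for k
  proof -
    have "int p ^ m \<cdot>\<^sub>v unit_vec (Suc n) 0 \<in> H" by (rule Suc.prems(2)) simp
    then have "int p ^ k dvd (int p ^ m \<cdot>\<^sub>v unit_vec (Suc n) 0) $ 0" using that unfolding K_def by blast
    then have "int p ^ k dvd int p ^ m" by simp
    then show ?thesis using int_power_dvd_iff[OF p] by simp
  qed
  have finK: "finite K" using Kle by (meson finite_nat_set_iff_bounded_le)
  have "0 \<in> K" by (simp add: K_def)
  \<comment> \<open>The largest power of \<open>p\<close> that divides all vectors of \<open>H\<close>.\<close>
  define k where "k = Max K"
  have kK: "k \<in> K" unfolding k_def using finK \<open>0 \<in> K\<close> by (intro Max_in) auto
  have "Suc k \<notin> K" using Max_ge[OF finK, of "Suc k"] unfolding k_def by auto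
  then obtain h i where h: "h \<in> H" and i: "i < Suc n" and hi: "\<not> int p ^ Suc k dvd h $ i"
    unfolding K_def by blast
  define H1 where "H1 = {x \<in> carrier_vec (Suc n). int p ^ k \<cdot>\<^sub>v x \<in> H}"
  have div: "\<exists>x\<in>H1. g = int p ^ k \<cdot>\<^sub>v x" if "g \<in> H" for g
  proof -
    define x where "x = vec (Suc n) (\<lambda>i. g $ i div int p ^ k)"
    have "g = int p ^ k \<cdot>\<^sub>v x" using that kK Hc unfolding K_def x_def by (intro eq_vecI) auto
    moreover have "x \<in> carrier_vec (Suc n)" by (simp add: x_def)
    ultimately show ?thesis using that unfolding H1_def by blast
  qed
  have H1sub: "int_subgroup (Suc n) H1"
    unfolding int_subgroup_def
  proof (intro conjI ballI)
    have "int p ^ k \<cdot>\<^sub>v 0\<^sub>v (Suc n) = (0\<^sub>v (Suc n) :: int vec)" by (intro eq_vecI) auto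
    then show "0\<^sub>v (Suc n) \<in> H1" using Suc.prems(1) unfolding H1_def int_subgroup_def by auto
    fix x y assume xy: "x \<in> H1" "y \<in> H1"
    then have "int p ^ k \<cdot>\<^sub>v (x - y) = int p ^ k \<cdot>\<^sub>v x - int p ^ k \<cdot>\<^sub>v y"
      unfolding H1_def by (intro eq_vecI) (auto simp: algebra_simps)
    moreover have "int p ^ k \<cdot>\<^sub>v x - int p ^ k \<cdot>\<^sub>v y \<in> H"
      using Suc.prems(1) xy unfolding H1_def int_subgroup_def by blast
    ultimately show "x - y \<in> H1" using xy unfolding H1_def by simp
  qed (auto simp: H1_def)
  have H1pow: "int p ^ m \<cdot>\<^sub>v x \<in> H1" if "x \<in> carrier_vec (Suc n)" for x
    using int_subgroup_smult[OF Suc.prems(1) Suc.prems(2)[OF that], of "int p ^ k"] that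
    by (auto simp: H1_def)
  obtain h' where h': "h' \<in> H1" "h = int p ^ k \<cdot>\<^sub>v h'" using div[OF h] by blast
  have h'c: "h' \<in> carrier_vec (Suc n)" using h' by (simp add: H1_def)
  have nd: "\<not> int p dvd h' $ i" using hi i h' h'c by auto
  obtain Q c where Q: "Q \<in> GL (Suc n)" and Qh: "Q *\<^sub>v h' = vCons c (0\<^sub>v n)"
    using GL_reduce_to_single_entry[OF h'c] by blast
  obtain R where R: "R \<in> GL (Suc n)" "Q * R = 1\<^sub>m (Suc n)" "R * Q = 1\<^sub>m (Suc n)"
    using GL_inverse[OF Q] .
  note cQ = GL_carrier[OF Q] and cR = GL_carrier[OF R(1)]
  have QR: "Q *\<^sub>v (R *\<^sub>v x) = x" if "x \<in> carrier_vec (Suc n)" for x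
    using mult_inverse_vec[OF cQ cR R(2) that] .
  have RQ: "R *\<^sub>v (Q *\<^sub>v x) = x" if "x \<in> carrier_vec (Suc n)" for x
    using mult_inverse_vec[OF cR cQ R(3) that] .
  have smult_vCons: "s \<cdot>\<^sub>v vCons a y = vCons (s * a) (s \<cdot>\<^sub>v y)" for s a and y :: "int vec"
    by (intro eq_vecI) (auto simp: vec_index_vCons)
  define J where "J = (*\<^sub>v) Q ` H1"
  have Jsub: "int_subgroup (Suc n) J" unfolding J_def by (rule int_subgroup_image[OF H1sub cQ])
  have Jpow: "int p ^ m \<cdot>\<^sub>v x \<in> J" if x: "x \<in> carrier_vec (Suc n)" for x
  proof -
    have "int p ^ m \<cdot>\<^sub>v (R *\<^sub>v x) \<in> H1" using cR x by (intro H1pow) auto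
    moreover have "Q *\<^sub>v (int p ^ m \<cdot>\<^sub>v (R *\<^sub>v x)) = int p ^ m \<cdot>\<^sub>v x"
      using mult_mat_vec_int[OF cQ, of "R *\<^sub>v x" "int p ^ m"] cR x QR[OF x] by simp
    ultimately show ?thesis unfolding J_def by (metis imageI)
  qed
  \<comment> \<open>\<open>J\<close> contains both \<open>c\<close> and a power of \<open>p\<close> times the first unit vector, and these are coprime.\<close>
  have "\<not> int p dvd c"
  proof
    assume "int p dvd c"
    then obtain c' where c': "c = int p * c'" by auto
    have zero: "int p \<cdot>\<^sub>v 0\<^sub>v n = (0\<^sub>v n :: int vec)" by (intro eq_vecI) auto
    have "h' = R *\<^sub>v (int p \<cdot>\<^sub>v vCons c' (0\<^sub>v n))"
      using RQ[OF h'c] Qh c' zero by (simp add: smult_vCons)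
    also have "\<dots> = int p \<cdot>\<^sub>v (R *\<^sub>v vCons c' (0\<^sub>v n))"
      by (rule mult_mat_vec_int[OF cR]) simp
    finally show False using nd i cR by auto
  qed
  then have "coprime (int p ^ m) c"
    using p by (auto simp: prime_imp_coprime)
  then obtain u v where uv: "u * int p ^ m + v * c = 1"
    using bezout_int[of "int p ^ m" c] by auto
  have "u \<cdot>\<^sub>v (int p ^ m \<cdot>\<^sub>v vCons 1 (0\<^sub>v n)) + v \<cdot>\<^sub>v vCons c (0\<^sub>v n) \<in> J"
  proof (rule int_subgroup_add[OF Jsub]; rule int_subgroup_smult[OF Jsub])
    show "int p ^ m \<cdot>\<^sub>v vCons 1 (0\<^sub>v n) \<in> J" by (rule Jpow) simp
    show "vCons c (0\<^sub>v n) \<in> J" unfolding J_def Qh[symmetric] using h'(1) by (rule imageI)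
  qed
  moreover have "u \<cdot>\<^sub>v (int p ^ m \<cdot>\<^sub>v vCons 1 (0\<^sub>v n)) + v \<cdot>\<^sub>v vCons c (0\<^sub>v n) = vCons 1 (0\<^sub>v n)"
    using uv by (intro eq_vecI) (auto simp: vec_index_vCons)
  ultimately have e1: "vCons 1 (0\<^sub>v n) \<in> J" by simp
  define H2 where "H2 = {y \<in> carrier_vec n. vCons 0 y \<in> J}"
  have J_iff: "vCons t y \<in> J \<longleftrightarrow> y \<in> H2" if y: "y \<in> carrier_vec n" for t y
  proof -
    have t: "s \<cdot>\<^sub>v vCons 1 (0\<^sub>v n) \<in> J" for s by (rule int_subgroup_smult[OF Jsub e1])
    have "vCons t y + (- t) \<cdot>\<^sub>v vCons 1 (0\<^sub>v n) = vCons 0 y" "vCons 0 y + t \<cdot>\<^sub>v vCons 1 (0\<^sub>v n) = vCons t y"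
      using y by (auto intro!: eq_vecI simp: vec_index_vCons)
    then have "vCons t y \<in> J \<longleftrightarrow> vCons 0 y \<in> J"
      using int_subgroup_add[OF Jsub _ t, of "vCons t y" "- t"] int_subgroup_add[OF Jsub _ t, of "vCons 0 y" t]
      by metis
    then show ?thesis using y by (simp add: H2_def)
  qed
  have vCons_minus: "vCons 0 (x - y) = vCons 0 x - vCons 0 y"
    if "x \<in> carrier_vec n" "y \<in> carrier_vec n" for x y :: "int vec"
    using that by (intro eq_vecI) (auto simp: vec_index_vCons)
  have "int_subgroup n H2"
    unfolding int_subgroup_def
  proof (intro conjI ballI)
    show "0\<^sub>v n \<in> H2" using Jsub unfolding H2_def int_subgroup_def by (simp add: zero_vec_Suc)
    fix x y assume xy: "x \<in> H2" "y \<in> H2"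
    then have "vCons 0 x - vCons 0 y \<in> J" using Jsub unfolding H2_def int_subgroup_def by blast
    then show "x - y \<in> H2" using xy by (auto simp: H2_def vCons_minus)
  qed (auto simp: H2_def)
  moreover have "int p ^ m \<cdot>\<^sub>v x \<in> H2" if x: "x \<in> carrier_vec n" for x
    using Jpow[of "vCons 0 x"] x by (simp add: H2_def smult_vCons)
  ultimately obtain N \<beta> P where \<beta>: "\<beta> \<in> partitions n N" and P: "P \<in> GL n"
    and H2: "H2 = column_lattice (P * power_diag p n \<beta>)"
    using Suc.IH[of H2] unfolding typed_sublattices_def by blast
  define \<alpha> where "\<alpha> i = (if i \<in> {1..Suc n} then int k + (if i = 1 then 0 else \<beta> (i - 1)) else 0)" for i
  have \<beta>0: "0 \<le> \<beta> i" if "i \<in> {1..n}" for i using \<beta> that by (auto simp: partitions_def)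
  have "\<alpha> \<in> partitions (Suc n) (\<Sum>i=1..Suc n. \<alpha> i)"
  proof -
    have "\<alpha> i \<le> \<alpha> (Suc i)" if "i \<in> {1..<Suc n}" for i
    proof (cases "i = 1")
      case True then show ?thesis using that \<beta>0[of 1] by (auto simp: \<alpha>_def)
    next
      case False
      then have "\<beta> (i - 1) \<le> \<beta> (Suc (i - 1))"
        using \<beta> that unfolding partitions_def by (auto simp del: Suc_pred simp: Suc_leI)
      then show ?thesis using that False by (auto simp: \<alpha>_def)
    qed
    moreover have "0 \<le> \<alpha> i" for i
    proof (cases "i - 1 \<in> {1..n}")
      case True then show ?thesis using \<beta>0[OF True] by (simp add: \<alpha>_def)
    next
      case False then show ?thesis by (auto simp: \<alpha>_def)
    qed
    moreover have "\<alpha> \<in> tuples (Suc n)" by (auto simp: tuples_def \<alpha>_def)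
    ultimately show ?thesis by (auto simp: partitions_def)
  qed
  moreover
  have cP: "P \<in> carrier_mat n n" by (rule GL_carrier[OF P])
  define S where "S = R * bordered P"
  have S: "S \<in> GL (Suc n)" unfolding S_def by (rule GL_mult[OF R(1) bordered_GL[OF P]])
  have act: "S *\<^sub>v (power_diag p (Suc n) \<alpha> *\<^sub>v vCons t z)
      = int p ^ k \<cdot>\<^sub>v (R *\<^sub>v vCons t (P *\<^sub>v (power_diag p n \<beta> *\<^sub>v z)))"
    if z: "z \<in> carrier_vec n" for t z
  proof -
    have Dz: "power_diag p n \<beta> *\<^sub>v z \<in> carrier_vec n"
      using z by (intro mult_mat_vec_carrier[of _ n n]) auto
    have "power_diag p (Suc n) \<alpha> *\<^sub>v vCons t z = int p ^ k \<cdot>\<^sub>v vCons t (power_diag p n \<beta> *\<^sub>v z)"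
      using power_diag_Suc[OF z, of "int k" \<beta> p t] \<beta>0 unfolding \<alpha>_def[abs_def] by simp
    then have "S *\<^sub>v (power_diag p (Suc n) \<alpha> *\<^sub>v vCons t z)
      = int p ^ k \<cdot>\<^sub>v (S *\<^sub>v vCons t (power_diag p n \<beta> *\<^sub>v z))"
      using mult_mat_vec_int[OF GL_carrier[OF S], of "vCons t (power_diag p n \<beta> *\<^sub>v z)"] Dz by simp
    also have "S *\<^sub>v vCons t (power_diag p n \<beta> *\<^sub>v z) = R *\<^sub>v (bordered P *\<^sub>v vCons t (power_diag p n \<beta> *\<^sub>v z))"
      unfolding S_def using cR bordered_carrier[OF cP] Dz by (intro assoc_mult_mat_vec) auto
    finally show ?thesis using bordered_mult_vCons[OF cP Dz] by simp
  qed
  have "H = column_lattice (S * power_diag p (Suc n) \<alpha>)"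
  proof (intro equalityI subsetI)
    fix g assume "g \<in> H"
    then obtain x where x: "x \<in> H1" "g = int p ^ k \<cdot>\<^sub>v x" using div by blast
    have xc: "x \<in> carrier_vec (Suc n)" using x by (simp add: H1_def)
    have "Q *\<^sub>v x \<in> carrier_vec (Suc n)" using cQ xc by auto
    then obtain t y where y: "y \<in> carrier_vec n" "Q *\<^sub>v x = vCons t y" by (rule carrier_vec_Suc_cases)
    have "vCons t y \<in> J" using x y unfolding J_def by (metis imageI)
    then have "y \<in> H2" using J_iff[OF y(1)] by simp
    then obtain z where z: "z \<in> carrier_vec n" "y = P *\<^sub>v (power_diag p n \<beta> *\<^sub>v z)"
      unfolding H2 mem_column_lattice_power_diag[OF P] by blast
    have "g = S *\<^sub>v (power_diag p (Suc n) \<alpha> *\<^sub>v vCons t z)"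
      using act[OF z(1), of t] x(2) RQ[OF xc] y z by simp
    then show "g \<in> column_lattice (S * power_diag p (Suc n) \<alpha>)"
      unfolding mem_column_lattice_power_diag[OF S] using z by auto
  next
    fix g assume "g \<in> column_lattice (S * power_diag p (Suc n) \<alpha>)"
    then obtain z' where z': "z' \<in> carrier_vec (Suc n)" "g = S *\<^sub>v (power_diag p (Suc n) \<alpha> *\<^sub>v z')"
      unfolding mem_column_lattice_power_diag[OF S] by blast
    obtain t z where z: "z \<in> carrier_vec n" "z' = vCons t z" using z'(1) by (rule carrier_vec_Suc_cases)
    let ?y = "P *\<^sub>v (power_diag p n \<beta> *\<^sub>v z)"
    have yc: "?y \<in> carrier_vec n" using cP z by (auto intro!: mult_mat_vec_carrier[of _ n n])
    have "?y \<in> H2" unfolding H2 mem_column_lattice_power_diag[OF P] using z by blast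
    then have "vCons t ?y \<in> J" using J_iff[OF yc] by blast
    then obtain x where x: "x \<in> H1" "vCons t ?y = Q *\<^sub>v x" unfolding J_def by blast
    then have "R *\<^sub>v vCons t ?y = x" using RQ[of x] by (simp add: H1_def)
    then have "g = int p ^ k \<cdot>\<^sub>v x" using act[OF z(1), of t] z' z by simp
    then show "g \<in> H" using x by (simp add: H1_def)
  qed
  ultimately show ?case unfolding typed_sublattices_def using S by blast
qed

section \<open>Minors as invariants of lattices\<close>

text \<open>The row and column selections need not be increasing or injective: a repeated index gives a
  vanishing determinant and a permutation only changes its sign. Arbitrary selections make the expansion
  of a product by multilinearity immediate.\<close>

definition minors_dvd :: "nat \<Rightarrow> int \<Rightarrow> int mat \<Rightarrow> bool" where
  "minors_dvd k m A \<longleftrightarrow> (\<forall>f g. (\<forall>i<k. f i < dim_row A \<and> g i < dim_col A) \<longrightarrow>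
     m dvd det (mat k k (\<lambda>(i,j). A $$ (f i, g j))))"

text \<open>Rows of \<open>X * A\<close> are combinations of rows of \<open>A\<close>, so by multilinearity a minor of the product
  is a combination of minors of \<open>A\<close>. This is the Cauchy-Binet formula without collecting equal minors.\<close>

lemma minors_dvd_mult_left:
  assumes X: "X \<in> carrier_mat l n" and A: "A \<in> carrier_mat n c" and m: "minors_dvd k m A"
  shows "minors_dvd k m (X * A)"
  unfolding minors_dvd_def
proof (intro allI impI)
  fix f g assume "\<forall>i<k. f i < dim_row (X * A) \<and> g i < dim_col (X * A)"
  then have f: "\<And>i. i < k \<Longrightarrow> f i < l" and g: "\<And>i. i < k \<Longrightarrow> g i < c" using X A by auto
  define X' where "X' = mat k n (\<lambda>(i,j). X $$ (f i, j))"
  define A' where "A' = mat n k (\<lambda>(i,j). A $$ (i, g j))"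
  have c: "X' \<in> carrier_mat k n" "A' \<in> carrier_mat n k" by (auto simp: X'_def A'_def)
  have "mat k k (\<lambda>(i,j). (X * A) $$ (f i, g j)) = X' * A'"
    using X A f g by (intro eq_matI) (auto simp: X'_def A'_def scalar_prod_def intro!: sum.cong)
  moreover have "m dvd det (X' * A')"
    unfolding mat_mul_finsum_alt[OF c]
  proof (subst det_linear_rows_sum, goal_cases)
    case 3
    show ?case
    proof (rule dvd_sum, goal_cases)
      case (1 \<phi>)
      then have \<phi>: "\<And>i. i < k \<Longrightarrow> \<phi> i < n" by auto
      have "mat\<^sub>r k k (\<lambda>i. row A' (\<phi> i)) = mat k k (\<lambda>(i,j). A $$ (\<phi> i, g j))"
        using \<phi> by (intro eq_matI) (auto simp: A'_def)
      then have "m dvd det (mat\<^sub>r k k (\<lambda>i. row A' (\<phi> i)))"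
        using m \<phi> g A unfolding minors_dvd_def by auto
      then show ?case
        using c \<phi> by (subst det_rows_mul) auto
    qed
  qed (use c in auto)
  ultimately show "m dvd det (mat k k (\<lambda>(i,j). (X * A) $$ (f i, g j)))" by simp
qed

lemma minors_dvd_transpose:
  assumes "minors_dvd k m A"
  shows "minors_dvd k m (transpose_mat A)"
  unfolding minors_dvd_def
proof (intro allI impI)
  fix f g assume fg: "\<forall>i<k. f i < dim_row (transpose_mat A) \<and> g i < dim_col (transpose_mat A)"
  have "mat k k (\<lambda>(i,j). transpose_mat A $$ (f i, g j)) = transpose_mat (mat k k (\<lambda>(i,j). A $$ (g i, f j)))"
    using fg by (intro eq_matI) auto
  moreover have "m dvd det (mat k k (\<lambda>(i,j). A $$ (g i, f j)))"
    using assms fg unfolding minors_dvd_def by auto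
  ultimately show "m dvd det (mat k k (\<lambda>(i,j). transpose_mat A $$ (f i, g j)))"
    by (simp add: det_transpose[of _ k])
qed

lemma minors_dvd_mult_right:
  assumes A: "A \<in> carrier_mat l n" and Y: "Y \<in> carrier_mat n c" and m: "minors_dvd k m A"
  shows "minors_dvd k m (A * Y)"
proof -
  have "minors_dvd k m (transpose_mat Y * transpose_mat A)"
    using A Y by (intro minors_dvd_mult_left[OF _ _ minors_dvd_transpose[OF m]]) auto
  from minors_dvd_transpose[OF this] show ?thesis
    using transpose_mult[OF A Y] by (metis transpose_transpose)
qed

text \<open>The common divisors of the \<open>k\<close>-minors depend on the lattice only up to unimodular changes of
  coordinates: each of the two matrices is obtained from the other one by multiplication on both sides.\<close>

lemma minors_dvd_column_lattice:
  assumes P: "P \<in> GL n" and Q: "Q \<in> GL n" and A: "A \<in> carrier_mat n n" and B: "B \<in> carrier_mat n n"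
    and eq: "column_lattice (P * A) = column_lattice (Q * B)"
  shows "minors_dvd k m A \<longleftrightarrow> minors_dvd k m B"
proof -
  have *: "minors_dvd k m B"
    if P: "P \<in> GL n" and Q: "Q \<in> GL n" and A: "A \<in> carrier_mat n n" and B: "B \<in> carrier_mat n n"
      and eq: "column_lattice (P * A) = column_lattice (Q * B)" and m: "minors_dvd k m A" for P Q A B
  proof -
    note c = GL_carrier[OF P] GL_carrier[OF Q]
    obtain Y where Y: "Y \<in> carrier_mat n n" "Q * B = P * A * Y"
      using column_lattice_factor[of "P * A" n n "Q * B" n] c A B eq by auto
    obtain R where R: "R \<in> GL n" "R * Q = 1\<^sub>m n" using GL_inverse[OF Q] by metis
    have cR: "R \<in> carrier_mat n n" by (rule GL_carrier[OF R(1)])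
    have "B = R * (Q * B)" using R(2) assoc_mult_mat[OF cR c(2) B] B by simp
    then have "B = R * (P * A * Y)" using Y(2) by simp
    moreover have "minors_dvd k m (R * (P * A * Y))"
      using c cR A Y(1) m
      by (intro minors_dvd_mult_left[of _ n n _ n] minors_dvd_mult_right[of _ n n _ n]) auto
    ultimately show ?thesis by simp
  qed
  show ?thesis using *[OF P Q A B eq] *[OF Q P B A eq[symmetric]] by blast
qed

text \<open>A lower triangular submatrix turns the divisibility of minors into the divisibility of an
  explicit product of entries.\<close>

lemma minors_dvd_triangular:
  assumes m: "minors_dvd k m A" and len: "length rs = k" "length cs = k"
    and rs: "set rs \<subseteq> {..<dim_row A}" and cs: "set cs \<subseteq> {..<dim_col A}"
    and tri: "\<And>i j. i < j \<Longrightarrow> j < k \<Longrightarrow> A $$ (rs ! i, cs ! j) = 0"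
  shows "m dvd (\<Prod>i<k. A $$ (rs ! i, cs ! i))"
proof -
  let ?M = "mat k k (\<lambda>(i,j). A $$ (rs ! i, cs ! j))"
  have "m dvd det ?M"
    using m len rs cs unfolding minors_dvd_def by (auto simp: subset_iff)
  also have "det ?M = prod_list (diag_mat ?M)"
    by (rule det_lower_triangular[of k]) (use tri in auto)
  also have "\<dots> = (\<Prod>i<k. A $$ (rs ! i, cs ! i))"
    by (auto simp: prod_list_diag_prod atLeast0LessThan)
  finally show ?thesis .
qed

section \<open>Minors of the extension matrix\<close>

text \<open>The block matrix with \<open>p ^ r\<close> and \<open>w\<close> in its first column and \<open>p\<close> to the powers
  \<open>\<beta>\<^sub>1, \<dots>, \<beta>\<^sub>n\<^sub>-\<^sub>1\<close> on the rest of the diagonal. Row \<open>i \<ge> 1\<close> belongs to \<open>\<beta>\<^sub>i\<close>, so the parts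
  keep their indices.\<close>

definition extension_matrix :: "nat \<Rightarrow> nat \<Rightarrow> int \<Rightarrow> (nat \<Rightarrow> int) \<Rightarrow> (nat \<Rightarrow> int) \<Rightarrow> int mat" where
  "extension_matrix p n r \<beta> w = mat n n (\<lambda>(i,j).
     if j = 0 then (if i = 0 then int p ^ nat r else w i)
     else if i = j then int p ^ nat (\<beta> j) else 0)"

lemma extension_matrix_carrier [simp]: "extension_matrix p n r \<beta> w \<in> carrier_mat n n"
  "dim_row (extension_matrix p n r \<beta> w) = n" "dim_col (extension_matrix p n r \<beta> w) = n"
  by (auto simp: extension_matrix_def)

lemma extension_matrix_index:
  assumes "i < n" "j < n"
  shows "extension_matrix p n r \<beta> w $$ (i, j) =
    (if j = 0 then (if i = 0 then int p ^ nat r else w i)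
     else if i = j then int p ^ nat (\<beta> j) else 0)"
  using assms by (simp add: extension_matrix_def)

text \<open>The numbers \<open>w i\<close> matter only modulo \<open>p ^ \<beta> i\<close>, so \<open>\<delta> i\<close> is the \<open>p\<close>-adic valuation of
  \<open>w i\<close> cut off at \<open>\<beta> i\<close>. At the cut-off value only divisibility is required; in particular \<open>w i = 0\<close>
  has \<open>\<delta> i = \<beta> i\<close>.\<close>

definition has_valuations :: "nat \<Rightarrow> nat \<Rightarrow> (nat \<Rightarrow> int) \<Rightarrow> (nat \<Rightarrow> int) \<Rightarrow> (nat \<Rightarrow> int) \<Rightarrow> bool" where
  "has_valuations p m \<beta> w \<delta> \<longleftrightarrow> (\<forall>i\<in>{1..m}. 0 \<le> \<delta> i \<and> \<delta> i \<le> \<beta> i \<and> int p ^ nat (\<delta> i) dvd w i \<and>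
     (\<delta> i < \<beta> i \<longrightarrow> \<not> int p ^ Suc (nat (\<delta> i)) dvd w i))"

text \<open>With \<open>\<eta>\<close> at index \<open>n\<close> understood as infinite, this is the minimum of \<open>\<eta>\<^sub>k\<close> and \<open>r\<close>: the part of the
  exponent of the \<open>k\<close>-minors contributed by the first column of the extension matrix.\<close>

definition capped_eta :: "nat \<Rightarrow> int \<Rightarrow> (nat \<Rightarrow> int) \<Rightarrow> (nat \<Rightarrow> int) \<Rightarrow> nat \<Rightarrow> int" where
  "capped_eta n r \<beta> \<delta> k = (if k < n then min (eta n \<beta> \<delta> k) r else r)"

lemma eta_set_finite:
  "finite ({\<beta> k - \<beta> i + \<delta> i | i. 1 \<le> i \<and> i < k} \<union> {\<delta> j | j. k \<le> j \<and> j \<le> (m::nat)} :: int set)"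
proof -
  have "{\<beta> k - \<beta> i + \<delta> i | i. 1 \<le> i \<and> i < k} = (\<lambda>i. \<beta> k - \<beta> i + \<delta> i) ` {1..<k}"
    "{\<delta> j | j. k \<le> j \<and> j \<le> m} = \<delta> ` {k..m}" by auto
  then show ?thesis by simp
qed

lemma eta_le_below: "1 \<le> i \<Longrightarrow> i < k \<Longrightarrow> eta n \<beta> \<delta> k \<le> \<beta> k - \<beta> i + \<delta> i"
  unfolding eta_def by (auto intro!: Min_le eta_set_finite)

lemma eta_le_above: "1 \<le> k \<Longrightarrow> k \<le> j \<Longrightarrow> j \<le> n - 1 \<Longrightarrow> eta n \<beta> \<delta> k \<le> \<delta> j"
  unfolding eta_def by (auto intro!: Min_le eta_set_finite)

lemma eta_ge:
  assumes "1 \<le> k" "k \<le> n - 1"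
    and "\<And>i. 1 \<le> i \<Longrightarrow> i < k \<Longrightarrow> c \<le> \<beta> k - \<beta> i + \<delta> i" and "\<And>j. k \<le> j \<Longrightarrow> j \<le> n - 1 \<Longrightarrow> c \<le> \<delta> j"
  shows "c \<le> eta n \<beta> \<delta> k"
proof -
  have "eta n \<beta> \<delta> k = Min ({\<beta> k - \<beta> i + \<delta> i | i. 1 \<le> i \<and> i < k} \<union> {\<delta> j | j. k \<le> j \<and> j \<le> n - 1})"
    using assms(1) by (simp add: eta_def)
  also have "\<dots> \<ge> c"
    using assms by (subst Min_ge_iff[OF eta_set_finite]) auto
  finally show ?thesis .
qed

text \<open>The first parts of a nondecreasing sequence are the smallest ones. Hence among the minors
  with a given number of diagonal entries those from the initial rows have the smallest exponent.\<close>

lemma sum_initial_le_sum_subset: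
  fixes \<beta> :: "nat \<Rightarrow> int"
  assumes "\<And>i j. 1 \<le> i \<Longrightarrow> i \<le> j \<Longrightarrow> j \<le> m \<Longrightarrow> \<beta> i \<le> \<beta> j" and "S \<subseteq> {1..m}"
  shows "(\<Sum>i=1..card S. \<beta> i) \<le> sum \<beta> S"
  using assms
proof (induction m arbitrary: S)
  case (Suc m)
  have fin: "finite S" using Suc.prems(2) finite_subset by blast
  show ?case
  proof (cases "Suc m \<in> S")
    case True
    let ?S = "S - {Suc m}"
    have S: "?S \<subseteq> {1..m}" using Suc.prems(2) by force
    have IH: "(\<Sum>i=1..card ?S. \<beta> i) \<le> sum \<beta> ?S" by (rule Suc.IH[OF _ S]) (use Suc.prems(1) in auto)
    have card: "card S = Suc (card ?S)" by (rule card.remove[OF fin True])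
    have "card ?S \<le> m" using card_mono[OF _ S] by simp
    then have "\<beta> (Suc (card ?S)) \<le> \<beta> (Suc m)" by (intro Suc.prems(1)) auto
    moreover have "sum \<beta> S = \<beta> (Suc m) + sum \<beta> ?S" by (rule sum.remove[OF fin True])
    ultimately show ?thesis using IH unfolding card by simp
  next
    case False
    then have "S \<subseteq> {1..m}" using Suc.prems(2) by (auto simp: le_Suc_eq)
    then show ?thesis by (rule Suc.IH[rotated]) (use Suc.prems(1) in auto)
  qed
qed simp

text \<open>Take row \<open>j\<close> with the first column, and the rows in \<open>S\<close> with the columns in \<open>S\<close>. Listing \<open>j\<close>
  first makes the submatrix lower triangular, since row \<open>j\<close> has no entry in the columns from \<open>S\<close>.\<close>

lemma extension_minor_with_first_column:
  assumes m: "minors_dvd (Suc (card S)) d (extension_matrix p n r \<beta> w)"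
    and S: "S \<subseteq> {1..<n}" and j: "j < n" "j \<notin> S"
  shows "d dvd (if j = 0 then int p ^ nat r else w j) * (\<Prod>i\<in>S. int p ^ nat (\<beta> i))"
proof -
  let ?E = "extension_matrix p n r \<beta> w"
  have fin: "finite S" using S finite_subset by blast
  define xs where "xs = sorted_list_of_set S"
  have xs: "set xs = S" "distinct xs" "length xs = card S" using fin by (auto simp: xs_def)
  have bij: "bij_betw ((!) xs) {..<card S} S" by (rule bij_betw_nth) (use xs in simp_all)
  have nth: "xs ! i \<in> S" if "i < card S" for i using that xs by (metis nth_mem)
  have n: "0 < n" using j by simp
  have "d dvd (\<Prod>i<Suc (card S). ?E $$ ((j # xs) ! i, (0 # xs) ! i))"
  proof (rule minors_dvd_triangular[OF m])
    fix i l assume il: "i < l" "l < Suc (card S)"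
    then obtain l' where l': "l = Suc l'" by (cases l) auto
    have ls: "xs ! l' \<in> S" using il l' nth by simp
    show "?E $$ ((j # xs) ! i, (0 # xs) ! l) = 0"
    proof (cases i)
      case 0
      then show ?thesis using l' ls S j by (auto simp: extension_matrix_def)
    next
      case (Suc i')
      then have "xs ! i' \<noteq> xs ! l'" "xs ! i' \<in> S" using il l' xs nth by (auto simp: nth_eq_iff_index_eq)
      moreover have "xs ! i' < n" "xs ! l' < n" "xs ! l' \<noteq> 0" using calculation ls S by auto
      ultimately show ?thesis using l' Suc by (simp add: extension_matrix_index)
    qed
  qed (use xs S j n in auto)
  also have "(\<Prod>i<Suc (card S). ?E $$ ((j # xs) ! i, (0 # xs) ! i))
      = ?E $$ (j, 0) * (\<Prod>i<card S. ?E $$ (xs ! i, xs ! i))"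
    by (simp only: prod.lessThan_Suc_shift nth_Cons_0 nth_Cons_Suc comp_def)
  also have "(\<Prod>i<card S. ?E $$ (xs ! i, xs ! i)) = (\<Prod>i<card S. int p ^ nat (\<beta> (xs ! i)))"
  proof (rule prod.cong)
    fix i assume "i \<in> {..<card S}"
    then have "xs ! i \<in> {1..<n}" using nth[of i] S by blast
    then show "?E $$ (xs ! i, xs ! i) = int p ^ nat (\<beta> (xs ! i))" by (simp add: extension_matrix_index)
  qed simp
  also have "\<dots> = (\<Prod>i\<in>S. int p ^ nat (\<beta> i))"
    by (rule prod.reindex_bij_betw[OF bij])
  finally show ?thesis using j n by (auto simp: extension_matrix_def)
qed

lemma extension_minor_without_first_column:
  assumes m: "minors_dvd (card S) d (extension_matrix p n r \<beta> w)" and S: "S \<subseteq> {1..<n}"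
  shows "d dvd (\<Prod>i\<in>S. int p ^ nat (\<beta> i))"
proof -
  let ?E = "extension_matrix p n r \<beta> w"
  have fin: "finite S" using S finite_subset by blast
  define xs where "xs = sorted_list_of_set S"
  have xs: "set xs = S" "distinct xs" "length xs = card S" using fin by (auto simp: xs_def)
  have bij: "bij_betw ((!) xs) {..<card S} S" by (rule bij_betw_nth) (use xs in simp_all)
  have nth: "xs ! i \<in> S" if "i < card S" for i using that xs by (metis nth_mem)
  have "d dvd (\<Prod>i<card S. ?E $$ (xs ! i, xs ! i))"
  proof (rule minors_dvd_triangular[OF m])
    fix i l assume il: "i < l" "l < card S"
    then have "xs ! i \<noteq> xs ! l" "xs ! i \<in> S" "xs ! l \<in> S" using xs nth by (auto simp: nth_eq_iff_index_eq)
    moreover have "xs ! i < n" "xs ! l < n" "xs ! l \<noteq> 0" using calculation S by auto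
    ultimately show "?E $$ (xs ! i, xs ! l) = 0" by (simp add: extension_matrix_index)
  qed (use xs S in auto)
  also have "(\<Prod>i<card S. ?E $$ (xs ! i, xs ! i)) = (\<Prod>i<card S. int p ^ nat (\<beta> (xs ! i)))"
  proof (rule prod.cong)
    fix i assume "i \<in> {..<card S}"
    then have "xs ! i \<in> {1..<n}" using nth[of i] S by blast
    then show "?E $$ (xs ! i, xs ! i) = int p ^ nat (\<beta> (xs ! i))" by (simp add: extension_matrix_index)
  qed simp
  also have "\<dots> = (\<Prod>i\<in>S. int p ^ nat (\<beta> i))"
    by (rule prod.reindex_bij_betw[OF bij])
  finally show ?thesis .
qed

lemma power_dvd_cofactor:
  assumes p: "prime p" and u: "\<not> int p dvd u" and d: "int p ^ s dvd int p ^ e * u"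
  shows "s \<le> e"
proof -
  have "coprime (int p) u" using p u by (simp add: prime_imp_coprime)
  then have "coprime (int p ^ s) u" by simp
  then have "int p ^ s dvd int p ^ e" using d coprime_dvd_mult_left_iff by blast
  then show ?thesis using int_power_dvd_iff[OF p] by simp
qed

lemma prod_powers:
  assumes "finite S" "\<And>i. i \<in> S \<Longrightarrow> 0 \<le> \<beta> i"
  shows "(\<Prod>i\<in>S. int p ^ nat (\<beta> i)) = int p ^ nat (sum \<beta> S)"
proof -
  have "int (\<Sum>i\<in>S. nat (\<beta> i)) = sum \<beta> S" using assms by simp
  then have "nat (sum \<beta> S) = (\<Sum>i\<in>S. nat (\<beta> i))" by linarith
  then show ?thesis by (simp add: power_sum)
qed

text \<open>Upper bound for the common exponent of the \<open>k\<close>-minors: every term in the minimum defining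
  \<open>\<eta>\<^sub>k\<close> is attained by a triangular minor. For \<open>j \<ge> k\<close> it uses the rows \<open>1, \<dots>, k - 1\<close> and \<open>j\<close>, for
  \<open>i < k\<close> the rows \<open>1, \<dots>, k\<close>, where row \<open>i\<close> is paired with the first column. Where \<open>\<delta> j = \<beta> j\<close> the
  entry \<open>w j\<close> may have a larger valuation or vanish, but then the minor from the first \<open>k\<close> diagonal entries
  is already small enough. Row 0 gives the bound by \<open>r\<close>.\<close>

lemma extension_minors_dvd_imp:
  assumes p: "prime p" and r: "0 \<le> r"
    and mono: "\<And>i j. 1 \<le> i \<Longrightarrow> i \<le> j \<Longrightarrow> j \<le> n - 1 \<Longrightarrow> \<beta> i \<le> \<beta> j"
    and v: "has_valuations p (n - 1) \<beta> w \<delta>" and k: "1 \<le> k" "k \<le> n"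
    and m: "minors_dvd k (int p ^ s) (extension_matrix p n r \<beta> w)"
  shows "int s \<le> (\<Sum>i=1..k-1. \<beta> i) + capped_eta n r \<beta> \<delta> k"
proof -
  have nn: "0 \<le> \<delta> i" "\<delta> i \<le> \<beta> i" if "i \<in> {1..n-1}" for i
    using v that unfolding has_valuations_def by auto
  have sum0: "0 \<le> sum \<beta> S" if "S \<subseteq> {1..n-1}" for S
  proof (rule sum_nonneg)
    show "0 \<le> \<beta> i" if "i \<in> S" for i
      using nn[of i] \<open>S \<subseteq> {1..n-1}\<close> that by auto
  qed
  have prodS: "(\<Prod>i\<in>S. int p ^ nat (\<beta> i)) = int p ^ nat (sum \<beta> S)" if "S \<subseteq> {1..n-1}" for S
  proof (rule prod_powers)
    show "finite S" by (rule finite_subset[OF that]) simp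
    show "0 \<le> \<beta> i" if "i \<in> S" for i
      using nn[of i] \<open>S \<subseteq> {1..n-1}\<close> that by auto
  qed
  have split: "(\<Sum>i=1..k. \<beta> i) = (\<Sum>i=1..k-1. \<beta> i) + \<beta> k"
    using k(1) by (cases k) auto
  have r_bound: "int s \<le> (\<Sum>i=1..k-1. \<beta> i) + r"
  proof -
    have S: "{1..k-1} \<subseteq> {1..n-1}" using k by auto
    have "int p ^ s dvd int p ^ nat r * (\<Prod>i=1..k-1. int p ^ nat (\<beta> i))"
      using extension_minor_with_first_column[of "{1..k-1}" "int p ^ s" p n r \<beta> w 0] m k by force
    then have "int p ^ s dvd int p ^ (nat r + nat (\<Sum>i=1..k-1. \<beta> i))"
      by (simp only: prodS[OF S] power_add)
    then have "s \<le> nat r + nat (\<Sum>i=1..k-1. \<beta> i)" using int_power_dvd_iff[OF p] by simp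
    then show ?thesis using sum0[OF S] r by linarith
  qed
  show ?thesis
  proof (cases "k < n")
    case False
    then show ?thesis using r_bound by (simp add: capped_eta_def)
  next
    case True
    \<comment> \<open>The minor from the first \<open>k\<close> diagonal entries; it covers all \<open>j\<close> with \<open>\<delta> j = \<beta> j\<close>.\<close>
    have diag: "int s \<le> (\<Sum>i=1..k. \<beta> i)"
    proof -
      have S: "{1..k} \<subseteq> {1..n-1}" using True by auto
      have "int p ^ s dvd (\<Prod>i=1..k. int p ^ nat (\<beta> i))"
        using extension_minor_without_first_column[of "{1..k}" "int p ^ s" p n r \<beta> w] m True by force
      then have "s \<le> nat (\<Sum>i=1..k. \<beta> i)" using int_power_dvd_iff[OF p] prodS[OF S] by simp
      then show ?thesis using sum0[OF S] by linarith
    qed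
    have col: "int s \<le> sum \<beta> S + \<delta> j"
      if S: "S \<subseteq> {1..n-1}" "card S = k - 1" and j: "j \<in> {1..n-1}" "j \<notin> S"
        and lt: "\<delta> j < \<beta> j" for S j
    proof -
      obtain u where u: "w j = int p ^ nat (\<delta> j) * u" using v j unfolding has_valuations_def by blast
      have "\<not> int p ^ Suc (nat (\<delta> j)) dvd w j" using v j lt unfolding has_valuations_def by blast
      then have pu: "\<not> int p dvd u" using u by (auto simp: mult.assoc)
      have "int p ^ s dvd w j * (\<Prod>i\<in>S. int p ^ nat (\<beta> i))"
        using extension_minor_with_first_column[of S "int p ^ s" p n r \<beta> w j] m k S j by force
      then have "int p ^ s dvd int p ^ (nat (\<delta> j) + nat (sum \<beta> S)) * u"
        by (simp add: prodS[OF S(1)] power_add u mult_ac)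
      from power_dvd_cofactor[OF p pu this] show ?thesis using sum0[OF S(1)] nn[OF j(1)] by linarith
    qed
    have "int s - (\<Sum>i=1..k-1. \<beta> i) \<le> eta n \<beta> \<delta> k"
    proof (rule eta_ge)
      fix i assume i: "1 \<le> i" "i < k"
      have rem: "(\<Sum>l=1..k. \<beta> l) = \<beta> i + sum \<beta> ({1..k} - {i})"
        using i by (intro sum.remove) auto
      show "int s - (\<Sum>i=1..k-1. \<beta> i) \<le> \<beta> k - \<beta> i + \<delta> i"
      proof (cases "\<delta> i < \<beta> i")
        case lt: True
        have "{1..k} - {i} \<subseteq> {1..n-1}" using True by auto
        from col[OF this _ _ _ lt] show ?thesis using i True rem split by fastforce
      next
        case False
        then show ?thesis using diag split nn[of i] i True by fastforce
      qed
    next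
      fix j assume j: "k \<le> j" "j \<le> n - 1"
      show "int s - (\<Sum>i=1..k-1. \<beta> i) \<le> \<delta> j"
      proof (cases "\<delta> j < \<beta> j")
        case lt: True
        have "{1..k-1} \<subseteq> {1..n-1}" using True by auto
        from col[OF this _ _ _ lt] show ?thesis using j k by fastforce
      next
        case False
        then show ?thesis using diag split mono[of k j] j k(1) by linarith
      qed
    qed (use k True in auto)
    then show ?thesis using r_bound True by (auto simp: capped_eta_def)
  qed
qed

text \<open>Lower bound for the common exponent: in the Leibniz expansion a nonzero product takes its
  factors from distinct diagonal entries, together with at most one entry of the first column, which lies
  in a further row \<open>j\<close>. The smallest exponent of such a product is bounded by comparing the diagonal
  part with an initial segment, separately for \<open>j = 0\<close>, \<open>j \<ge> k\<close> and \<open>1 \<le> j < k\<close>.\<close>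

lemma extension_minors_dvd:
  assumes r: "0 \<le> r"
    and mono: "\<And>i j. 1 \<le> i \<Longrightarrow> i \<le> j \<Longrightarrow> j \<le> n - 1 \<Longrightarrow> \<beta> i \<le> \<beta> j"
    and v: "has_valuations p (n - 1) \<beta> w \<delta>" and k: "1 \<le> k" "k \<le> n"
    and s: "int s \<le> (\<Sum>i=1..k-1. \<beta> i) + capped_eta n r \<beta> \<delta> k"
  shows "minors_dvd k (int p ^ s) (extension_matrix p n r \<beta> w)"
  unfolding minors_dvd_def
proof (intro allI impI)
  let ?E = "extension_matrix p n r \<beta> w"
  have nn: "0 \<le> \<delta> i" "\<delta> i \<le> \<beta> i" if "i \<in> {1..n-1}" for i
    using v that unfolding has_valuations_def by auto
  have sum0: "0 \<le> sum \<beta> S" if "S \<subseteq> {1..n-1}" for S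
  proof (rule sum_nonneg)
    show "0 \<le> \<beta> i" if "i \<in> S" for i
      using nn[of i] \<open>S \<subseteq> {1..n-1}\<close> that by auto
  qed
  have prodS: "(\<Prod>i\<in>S. int p ^ nat (\<beta> i)) = int p ^ nat (sum \<beta> S)" if "S \<subseteq> {1..n-1}" for S
  proof (rule prod_powers)
    show "finite S" by (rule finite_subset[OF that]) simp
    show "0 \<le> \<beta> i" if "i \<in> S" for i
      using nn[of i] \<open>S \<subseteq> {1..n-1}\<close> that by auto
  qed
  have split: "(\<Sum>i=1..k. \<beta> i) = (\<Sum>i=1..k-1. \<beta> i) + \<beta> k"
    using k(1) by (cases k) auto
  fix f g assume "\<forall>i<k. f i < dim_row ?E \<and> g i < dim_col ?E"
  then have fn: "\<And>i. i < k \<Longrightarrow> f i < n" and gn: "\<And>i. i < k \<Longrightarrow> g i < n" by auto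
  let ?M = "mat k k (\<lambda>(i,j). ?E $$ (f i, g j))"
  have M: "?M \<in> carrier_mat k k" by simp
  consider "\<not> inj_on f {0..<k}" | "\<not> inj_on g {0..<k}" | "inj_on f {0..<k}" "inj_on g {0..<k}" by blast
  then show "int p ^ s dvd det ?M"
  proof cases
    case 1
    then obtain i j where ij: "i < k" "j < k" "i \<noteq> j" "f i = f j" by (auto simp: inj_on_def)
    have "row ?M i = row ?M j" using ij by (intro eq_vecI) auto
    then have "det ?M = 0" using det_identical_rows[OF M ij(3,1,2)] by simp
    then show ?thesis by simp
  next
    case 2
    then obtain i j where ij: "i < k" "j < k" "i \<noteq> j" "g i = g j" by (auto simp: inj_on_def)
    have "col ?M i = col ?M j" using ij by (intro eq_vecI) auto
    then have "det ?M = 0" using det_identical_columns[OF M ij(3,1,2)] by simp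
    then show ?thesis by simp
  next
    case 3
    show ?thesis
      unfolding det_def'[OF M]
    proof (rule dvd_sum, rule dvd_mult)
      fix \<sigma> assume "\<sigma> \<in> {\<sigma>. \<sigma> permutes {0..<k}}"
      then have \<sigma>: "\<sigma> permutes {0..<k}" by simp
      define h where "h i = g (\<sigma> i)" for i
      have \<sigma>k: "\<sigma> i < k" if "i < k" for i using permutes_in_image[OF \<sigma>, of i] that by simp
      have hn: "h i < n" if "i < k" for i using gn \<sigma>k that by (simp add: h_def)
      have hinj: "inj_on h {0..<k}"
      proof (rule inj_onI)
        fix a b assume ab: "a \<in> {0..<k}" "b \<in> {0..<k}" "h a = h b"
        then have "\<sigma> a = \<sigma> b" using inj_onD[OF 3(2), of "\<sigma> a" "\<sigma> b"] \<sigma>k by (simp add: h_def)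
        then show "a = b" using permutes_inj[OF \<sigma>] by (simp add: inj_eq)
      qed
      have "(\<Prod>i=0..<k. ?M $$ (i, \<sigma> i)) = (\<Prod>i=0..<k. ?E $$ (f i, h i))"
        using \<sigma>k by (intro prod.cong) (auto simp: h_def)
      also have "int p ^ s dvd \<dots>"
      proof (cases "\<exists>i<k. ?E $$ (f i, h i) = 0")
        case True
        then have "(\<Prod>i=0..<k. ?E $$ (f i, h i)) = 0" by (intro prod_zero) auto
        then show ?thesis by (simp only: dvd_0_right)
      next
        case False
        have E: "?E $$ (f i, h i) = int p ^ nat (\<beta> (f i))" "f i \<in> {1..n-1}" if "i < k" "h i \<noteq> 0" for i
          using False that fn[of i] hn[of i] by (auto simp: extension_matrix_def split: if_splits)
        have prodI: "(\<Prod>i\<in>I. ?E $$ (f i, h i)) = int p ^ nat (sum \<beta> (f ` I))" "card (f ` I) = card I"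
          "f ` I \<subseteq> {1..n-1}"
          if I: "I \<subseteq> {0..<k}" "\<And>i. i \<in> I \<Longrightarrow> h i \<noteq> 0" for I
        proof -
          have inj: "inj_on f I" using 3(1) I(1) inj_on_subset by blast
          show sub: "f ` I \<subseteq> {1..n-1}" using E(2) I by fastforce
          have "(\<Prod>i\<in>I. ?E $$ (f i, h i)) = (\<Prod>i\<in>I. int p ^ nat (\<beta> (f i)))"
            using E(1) I by (intro prod.cong) fastforce+
          also have "\<dots> = (\<Prod>i\<in>f ` I. int p ^ nat (\<beta> i))" using inj by (simp add: prod.reindex)
          finally show "(\<Prod>i\<in>I. ?E $$ (f i, h i)) = int p ^ nat (sum \<beta> (f ` I))" using prodS[OF sub] by simp
          show "card (f ` I) = card I" using inj by (rule card_image)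
        qed
        show ?thesis
        proof (cases "\<exists>i0<k. h i0 = 0")
          case False
          then have h0: "h i \<noteq> 0" if "i \<in> {0..<k}" for i using that by auto
          note I = prodI[OF subset_refl h0]
          have lower: "(\<Sum>i=1..k. \<beta> i) \<le> sum \<beta> (f ` {0..<k})"
            using sum_initial_le_sum_subset[OF mono I(3)] I(2) by simp
          have "k < n" using card_mono[OF _ I(3)] I(2) k by simp
          moreover have "eta n \<beta> \<delta> k \<le> \<beta> k"
            using eta_le_above[of k k n \<beta> \<delta>] nn[of k] k calculation by force
          ultimately have "int s \<le> (\<Sum>i=1..k. \<beta> i)" using s split by (simp add: capped_eta_def)
          then have "s \<le> nat (sum \<beta> (f ` {0..<k}))" using lower by linarith
          then show ?thesis using I(1) by (simp add: le_imp_power_dvd)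
        next
          case True
          then obtain i0 where i0: "i0 < k" "h i0 = 0" by blast
          define I where "I = {0..<k} - {i0}"
          have h0: "h i \<noteq> 0" if "i \<in> I" for i
            using hinj that i0 unfolding I_def inj_on_def by fastforce
          have Isub: "I \<subseteq> {0..<k}" by (auto simp: I_def)
          note PI = prodI[OF Isub h0]
          have cardI: "card I = k - 1" using i0 by (simp add: I_def)
          define j where "j = f i0"
          have jn: "j < n" using fn i0 by (simp add: j_def)
          have jI: "j \<notin> f ` I" using 3(1) i0(1) unfolding j_def I_def inj_on_def by auto
          have lower: "(\<Sum>i=1..k-1. \<beta> i) \<le> sum \<beta> (f ` I)"
            using sum_initial_le_sum_subset[OF mono PI(3)] PI(2) cardI by simp
          \<comment> \<open>The guaranteed exponent of the entry of the first column in row \<open>j\<close>.\<close>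
          define e where "e = (if j = 0 then r else \<delta> j)"
          have e0: "0 \<le> e" using r nn[of j] jn by (auto simp: e_def)
          have "(\<Prod>i=0..<k. ?E $$ (f i, h i)) = ?E $$ (j, 0) * (\<Prod>i\<in>I. ?E $$ (f i, h i))"
            using i0 unfolding I_def j_def by (subst prod.remove[of _ i0]) auto
          moreover have "int p ^ nat e dvd ?E $$ (j, 0)"
            using v jn by (auto simp: extension_matrix_def e_def has_valuations_def)
          from mult_dvd_mono[OF this dvd_refl[of "\<Prod>i\<in>I. ?E $$ (f i, h i)"]]
          have "int p ^ nat e * int p ^ nat (sum \<beta> (f ` I)) dvd ?E $$ (j, 0) * (\<Prod>i\<in>I. ?E $$ (f i, h i))"
            by (simp only: PI(1))
          ultimately have d: "int p ^ (nat e + nat (sum \<beta> (f ` I))) dvd (\<Prod>i=0..<k. ?E $$ (f i, h i))"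
            by (simp only: power_add)
          have "(\<Sum>i=1..k-1. \<beta> i) + capped_eta n r \<beta> \<delta> k \<le> sum \<beta> (f ` I) + e"
          proof (cases "j = 0")
            case True
            then show ?thesis using lower min.cobounded2[of "eta n \<beta> \<delta> k" r]
              unfolding e_def capped_eta_def by (auto simp del: min.cobounded2)
          next
            case False
            have sub: "insert j (f ` I) \<subseteq> {1..n-1}" using PI(3) False jn by auto
            have card: "card (insert j (f ` I)) = k"
              using jI PI(2) cardI k by (subst card_insert_disjoint) (auto simp: I_def)
            have kn: "k < n" using card_mono[OF _ sub] card k by simp
            have lower': "(\<Sum>i=1..k. \<beta> i) \<le> \<beta> j + sum \<beta> (f ` I)"
              using sum_initial_le_sum_subset[OF mono sub] card jI by (simp add: I_def)
            show ?thesis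
            proof (cases "k \<le> j")
              case True
              then have "eta n \<beta> \<delta> k \<le> \<delta> j" using eta_le_above[of k j n \<beta> \<delta>] k jn by simp
              then show ?thesis using lower kn False by (simp add: e_def capped_eta_def min_def)
            next
              case kj: False
              then have "eta n \<beta> \<delta> k \<le> \<beta> k - \<beta> j + \<delta> j" using eta_le_below[of j k n \<beta> \<delta>] False by simp
              then show ?thesis using lower' split kn False by (simp add: e_def capped_eta_def min_def)
            qed
          qed
          then have "s \<le> nat e + nat (sum \<beta> (f ` I))" using s e0 sum0[OF PI(3)] by linarith
          then show ?thesis using d power_le_dvd by blast
        qed
      qed
      finally show "int p ^ s dvd (\<Prod>i=0..<k. ?M $$ (i, \<sigma> i))" .
    qed
  qed
qed

section \<open>Coordinates with respect to a lattice basis\<close>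

definition embed :: "'a::euclidean_space list \<Rightarrow> int vec \<Rightarrow> 'a" where
  "embed bs x = (\<Sum>i<length bs. real_of_int (x $ i) *\<^sub>R (bs ! i))"

lemma zspan_eq_embed: "length bs = n \<Longrightarrow> zspan bs = embed bs ` carrier_vec n"
proof (intro equalityI subsetI)
  fix x assume "length bs = n" "x \<in> zspan bs"
  then obtain c where "x = (\<Sum>i<n. real_of_int (c i) *\<^sub>R (bs ! i))" by (auto simp: zspan_def)
  then have "x = embed bs (vec n c)" using \<open>length bs = n\<close> by (simp add: embed_def)
  then show "x \<in> embed bs ` carrier_vec n" by (metis image_eqI vec_carrier)
qed (auto simp: zspan_def embed_def)

text \<open>Turns distinctness and set-based independence into a statement about coefficient sequences,
  which is the form that coordinates need.\<close>

lemma independent_list_iff: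
  fixes bs :: "'a::euclidean_space list"
  assumes len: "length bs = n"
  shows "distinct bs \<and> \<not> real_vector.dependent (set bs) \<longleftrightarrow>
    (\<forall>c. (\<Sum>i<n. c i *\<^sub>R (bs ! i)) = 0 \<longrightarrow> (\<forall>i<n. c i = (0::real)))" (is "?L \<longleftrightarrow> ?R")
proof
  assume L: ?L
  then have bij: "bij_betw ((!) bs) {..<n} (set bs)" using len by (intro bij_betw_nth) auto
  show ?R
  proof (intro allI impI)
    fix c :: "nat \<Rightarrow> real" and i assume c: "(\<Sum>i<n. c i *\<^sub>R (bs ! i)) = 0" and i: "i < n"
    define u where "u v = c (the_inv_into {..<n} ((!) bs) v)" for v
    have u: "u (bs ! j) = c j" if "j < n" for j
      using bij that unfolding u_def bij_betw_def by (simp add: the_inv_into_f_f)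
    have "(\<Sum>v\<in>set bs. u v *\<^sub>R v) = (\<Sum>j<n. u (bs ! j) *\<^sub>R (bs ! j))"
      by (rule sum.reindex_bij_betw[OF bij, symmetric])
    also have "\<dots> = 0" using u c by simp
    finally have "\<forall>v\<in>set bs. u v = 0"
      using L real_vector.dependent_finite[of "set bs"] by blast
    then show "c i = 0" using u[OF i] i len by simp
  qed
next
  assume R: ?R
  have dist: "distinct bs"
  proof (rule ccontr)
    assume "\<not> distinct bs"
    then obtain i j where ij: "i < n" "j < n" "i \<noteq> j" "bs ! i = bs ! j" using len by (auto simp: distinct_conv_nth)
    let ?c = "\<lambda>l. (if l = i then 1 else 0) - (if l = j then 1 else 0) :: real"
    have "(\<Sum>l<n. ?c l *\<^sub>R (bs ! l)) = (\<Sum>l<n. if l = i then bs ! l else 0) - (\<Sum>l<n. if l = j then bs ! l else 0)"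
      unfolding sum_subtractf[symmetric] by (rule sum.cong) (auto simp: scaleR_diff_left)
    also have "\<dots> = 0" using ij by simp
    finally have "(\<Sum>l<n. ?c l *\<^sub>R (bs ! l)) = 0" .
    from R[THEN spec, of ?c, THEN mp, OF this] have "?c i = 0" using ij(1) by blast
    then show False using ij by simp
  qed
  have bij: "bij_betw ((!) bs) {..<n} (set bs)" using len dist by (intro bij_betw_nth) auto
  have "\<not> real_vector.dependent (set bs)"
  proof
    assume "real_vector.dependent (set bs)"
    then obtain u v where uv: "v \<in> set bs" "u v \<noteq> 0" "(\<Sum>v\<in>set bs. u v *\<^sub>R v) = 0"
      using real_vector.dependent_finite[of "set bs"] by auto
    have "(\<Sum>j<n. u (bs ! j) *\<^sub>R (bs ! j)) = (\<Sum>v\<in>set bs. u v *\<^sub>R v)"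
      by (rule sum.reindex_bij_betw[OF bij])
    then have "\<forall>j<n. u (bs ! j) = 0" using R[THEN spec, of "\<lambda>j. u (bs ! j)"] uv(3) by simp
    then show False using uv len by (metis in_set_conv_nth)
  qed
  with dist show ?L by blast
qed

lemma lattice_basis_iff:
  "lattice_basis n L bs \<longleftrightarrow> length bs = n \<and> L = embed bs ` carrier_vec n \<and>
    (\<forall>c. (\<Sum>i<n. c i *\<^sub>R (bs ! i)) = 0 \<longrightarrow> (\<forall>i<n. c i = (0::real)))"
  unfolding lattice_basis_def using independent_list_iff[of bs n] zspan_eq_embed[of bs n] by blast

lemma embed_inj:
  assumes b: "lattice_basis n L bs"
  shows "inj_on (embed bs) (carrier_vec n)"
proof (rule inj_onI)
  fix x y :: "int vec" assume xy: "x \<in> carrier_vec n" "y \<in> carrier_vec n" "embed bs x = embed bs y"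
  have len: "length bs = n" using b by (simp add: lattice_basis_iff)
  have "(\<Sum>i<n. (real_of_int (x $ i) - real_of_int (y $ i)) *\<^sub>R (bs ! i)) = embed bs x - embed bs y"
    using len by (simp add: embed_def scaleR_diff_left sum_subtractf)
  then have "\<forall>i<n. real_of_int (x $ i) - real_of_int (y $ i) = 0"
    using b xy(3) unfolding lattice_basis_iff by auto
  then show "x = y" using xy by (intro eq_vecI) auto
qed

lemma embed_change_of_basis:
  assumes len: "length bs = n" "length cs = n" and A: "A \<in> carrier_mat n n"
    and cs: "\<And>j. j < n \<Longrightarrow> cs ! j = (\<Sum>i<n. real_of_int (A $$ (i, j)) *\<^sub>R (bs ! i))"
    and x: "x \<in> carrier_vec n"
  shows "embed cs x = embed bs (A *\<^sub>v x)"
proof -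
  have "embed cs x = (\<Sum>j<n. \<Sum>i<n. (real_of_int (x $ j) * real_of_int (A $$ (i, j))) *\<^sub>R (bs ! i))"
    using len cs by (simp add: embed_def scaleR_right.sum)
  also have "\<dots> = (\<Sum>i<n. \<Sum>j<n. (real_of_int (x $ j) * real_of_int (A $$ (i, j))) *\<^sub>R (bs ! i))"
    by (rule sum.swap)
  also have "\<dots> = (\<Sum>i<n. real_of_int ((A *\<^sub>v x) $ i) *\<^sub>R (bs ! i))"
  proof (rule sum.cong)
    fix i assume "i \<in> {..<n}"
    then have "(A *\<^sub>v x) $ i = (\<Sum>j<n. x $ j * A $$ (i, j))"
      using A x by (auto simp: scalar_prod_def atLeast0LessThan mult.commute intro!: sum.cong)
    then show "(\<Sum>j<n. (real_of_int (x $ j) * real_of_int (A $$ (i, j))) *\<^sub>R (bs ! i))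
        = real_of_int ((A *\<^sub>v x) $ i) *\<^sub>R (bs ! i)"
      by (simp add: scaleR_sum_left)
  qed simp
  finally show ?thesis using len by (simp add: embed_def)
qed

lemma exists_coordinate_matrix:
  assumes len: "length bs = n" and cs: "\<And>j. j < n \<Longrightarrow> cs ! j \<in> embed bs ` carrier_vec n"
  shows "\<exists>A\<in>carrier_mat n n. \<forall>j<n. cs ! j = (\<Sum>i<n. real_of_int (A $$ (i, j)) *\<^sub>R (bs ! i))"
proof -
  have "\<forall>j\<in>{..<n}. \<exists>v. v \<in> carrier_vec n \<and> cs ! j = embed bs v" using cs by blast
  from bchoice[OF this] obtain q
    where q: "\<And>j. j < n \<Longrightarrow> q j \<in> carrier_vec n \<and> cs ! j = embed bs (q j)" by blast
  define A where "A = mat n n (\<lambda>(i,j). q j $ i)"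
  have "cs ! j = (\<Sum>i<n. real_of_int (A $$ (i, j)) *\<^sub>R (bs ! i))" if j: "j < n" for j
  proof -
    have "cs ! j = (\<Sum>i<n. real_of_int (q j $ i) *\<^sub>R (bs ! i))"
      using q[OF j] len unfolding embed_def by blast
    also have "\<dots> = (\<Sum>i<n. real_of_int (A $$ (i, j)) *\<^sub>R (bs ! i))"
      using j by (intro sum.cong) (simp_all add: A_def)
    finally show ?thesis .
  qed
  moreover have "A \<in> carrier_mat n n" by (simp add: A_def)
  ultimately show ?thesis by blast
qed

lemma nth_in_embed_image:
  assumes "length bs = n" "j < n"
  shows "bs ! j \<in> embed bs ` carrier_vec n"
proof -
  have "embed bs (unit_vec n j) = (\<Sum>i<n. if i = j then bs ! j else 0)"
    unfolding embed_def using assms by (intro sum.cong) auto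
  also have "\<dots> = bs ! j" using assms by simp
  finally show ?thesis by (metis image_eqI unit_vec_carrier)
qed

text \<open>Each basis has integer coordinates in the other one, and the two coordinate matrices are
  inverse to each other because coordinates are unique.\<close>

lemma change_of_basis_GL:
  assumes b: "lattice_basis n L bs" and b': "lattice_basis n L bs'"
  shows "\<exists>Q\<in>GL n. \<forall>x\<in>carrier_vec n. embed bs' x = embed bs (Q *\<^sub>v x)"
proof -
  have matrix: "\<exists>Q\<in>carrier_mat n n. \<forall>x\<in>carrier_vec n. embed cs' x = embed cs (Q *\<^sub>v x)"
    if c: "lattice_basis n L cs" "lattice_basis n L cs'" for cs cs' :: "'a list"
  proof -
    have len: "length cs = n" "length cs' = n" using c by (auto simp: lattice_basis_iff)
    have "cs' ! j \<in> embed cs ` carrier_vec n" if "j < n" for j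
      using nth_in_embed_image[OF len(2) that] c by (simp add: lattice_basis_iff)
    then obtain A where "A \<in> carrier_mat n n"
        "\<And>j. j < n \<Longrightarrow> cs' ! j = (\<Sum>i<n. real_of_int (A $$ (i, j)) *\<^sub>R (cs ! i))"
      using exists_coordinate_matrix[OF len(1)] by blast
    then show ?thesis using embed_change_of_basis[OF len] by blast
  qed
  obtain Q where Q: "Q \<in> carrier_mat n n" "\<And>x. x \<in> carrier_vec n \<Longrightarrow> embed bs' x = embed bs (Q *\<^sub>v x)"
    using matrix[OF b b'] by blast
  obtain R where R: "R \<in> carrier_mat n n" "\<And>x. x \<in> carrier_vec n \<Longrightarrow> embed bs x = embed bs' (R *\<^sub>v x)"
    using matrix[OF b' b] by blast
  have "Q * R = 1\<^sub>m n"
  proof (rule eq_mat_by_action[of _ n n])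
    fix x :: "int vec" assume x: "x \<in> carrier_vec n"
    then have Rx: "R *\<^sub>v x \<in> carrier_vec n" using R by simp
    have "embed bs (Q *\<^sub>v (R *\<^sub>v x)) = embed bs x" using Q(2)[OF Rx] R(2)[OF x] by simp
    then have "Q *\<^sub>v (R *\<^sub>v x) = x"
      using inj_onD[OF embed_inj[OF b], of "Q *\<^sub>v (R *\<^sub>v x)" x] Q(1) Rx x by simp
    then show "Q * R *\<^sub>v x = 1\<^sub>m n *\<^sub>v x" using assoc_mult_mat_vec[OF Q(1) R(1) x] x by simp
  qed (use Q R in auto)
  moreover have "R * Q = 1\<^sub>m n"
  proof (rule eq_mat_by_action[of _ n n])
    fix x :: "int vec" assume x: "x \<in> carrier_vec n"
    then have Qx: "Q *\<^sub>v x \<in> carrier_vec n" using Q by simp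
    have "embed bs' (R *\<^sub>v (Q *\<^sub>v x)) = embed bs' x" using R(2)[OF Qx] Q(2)[OF x] by simp
    then have "R *\<^sub>v (Q *\<^sub>v x) = x"
      using inj_onD[OF embed_inj[OF b'], of "R *\<^sub>v (Q *\<^sub>v x)" x] R(1) Qx x by simp
    then show "R * Q *\<^sub>v x = 1\<^sub>m n *\<^sub>v x" using assoc_mult_mat_vec[OF R(1) Q(1) x] x by simp
  qed (use Q R in auto)
  ultimately have "Q \<in> GL n" using Q R by (intro GL_I) auto
  then show ?thesis using Q by blast
qed

lemma typed_sublattices_subset:
  assumes "H \<in> typed_sublattices p n \<alpha>"
  shows "H \<subseteq> carrier_vec n"
proof -
  obtain P where "P \<in> GL n" "H = column_lattice (P * power_diag p n \<alpha>)"
    using assms unfolding typed_sublattices_def by blast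
  then show ?thesis
    using int_subgroup_column_lattice[of "P * power_diag p n \<alpha>" n n] GL_carrier[of P n]
    unfolding int_subgroup_def by auto
qed

text \<open>Independence of the columns over the reals follows from independence of the chosen basis:
  multiplying a linear relation by the inverse of \<open>P\<close> leaves a relation for the diagonal matrix, whose
  entries are positive.\<close>

lemma sublattice_of_typed:
  assumes b: "lattice_basis n L bs" and p: "prime p" and \<alpha>: "\<alpha> \<in> partitions n N"
    and P: "P \<in> GL n" and H: "H = column_lattice (P * power_diag p n \<alpha>)"
  shows "is_sublattice n L (embed bs ` H)"
    and "invariant_factors n L (embed bs ` H) (\<lambda>i. int p ^ nat (\<alpha> i))"
proof -
  define D where "D = power_diag p n \<alpha>"
  define A where "A = P * D"
  have len: "length bs = n" and L: "L = embed bs ` carrier_vec n"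
    and indep: "\<And>c i. (\<Sum>i<n. c i *\<^sub>R (bs ! i)) = 0 \<Longrightarrow> i < n \<Longrightarrow> c i = (0::real)"
    using b unfolding lattice_basis_iff by auto
  have p0: "0 < int p" using prime_gt_0_nat[OF p] by simp
  obtain Q where Q: "Q \<in> GL n" "P * Q = 1\<^sub>m n" "Q * P = 1\<^sub>m n" using GL_inverse[OF P] .
  note cP = GL_carrier[OF P] and cQ = GL_carrier[OF Q(1)]
  have cD: "D \<in> carrier_mat n n" by (simp add: D_def)
  have A: "A \<in> carrier_mat n n" using cP cD by (simp add: A_def)
  have QA: "Q * A = D" unfolding A_def using assoc_mult_mat[OF cQ cP cD] Q(3) cD by simp
  have H: "H = column_lattice A" using H by (simp add: A_def D_def)
  have Hsub: "H \<subseteq> carrier_vec n" using A unfolding H by (auto simp: column_lattice_def)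
  define cs where "cs = map (\<lambda>j. \<Sum>i<n. real_of_int (A $$ (i, j)) *\<^sub>R (bs ! i)) [0..<n]"
  have csl: "length cs = n" by (simp add: cs_def)
  have cs: "cs ! j = (\<Sum>i<n. real_of_int (A $$ (i, j)) *\<^sub>R (bs ! i))" if "j < n" for j
    using that by (simp add: cs_def)
  have "embed cs ` carrier_vec n = embed bs ` H"
    unfolding H column_lattice_def using A embed_change_of_basis[OF len csl A cs]
    by (auto simp: image_iff)
  moreover have "c i = 0" if c: "(\<Sum>j<n. c j *\<^sub>R (cs ! j)) = 0" and i: "i < n" for c :: "nat \<Rightarrow> real" and i
  proof -
    have "(\<Sum>j<n. c j *\<^sub>R (cs ! j)) = (\<Sum>j<n. \<Sum>l<n. (c j * real_of_int (A $$ (l, j))) *\<^sub>R (bs ! l))"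
      by (simp add: cs scaleR_right.sum)
    also have "\<dots> = (\<Sum>l<n. \<Sum>j<n. (c j * real_of_int (A $$ (l, j))) *\<^sub>R (bs ! l))" by (rule sum.swap)
    also have "\<dots> = (\<Sum>l<n. (\<Sum>j<n. c j * real_of_int (A $$ (l, j))) *\<^sub>R (bs ! l))"
      by (simp add: scaleR_sum_left)
    finally have "(\<Sum>l<n. (\<Sum>j<n. c j * real_of_int (A $$ (l, j))) *\<^sub>R (bs ! l)) = 0" using c by simp
    then have rows: "(\<Sum>j<n. c j * real_of_int (A $$ (l, j))) = 0" if "l < n" for l
      using indep[of "\<lambda>l. \<Sum>j<n. c j * real_of_int (A $$ (l, j))", OF _ that] by blast
    have D_entry: "D $$ (i, j) = (\<Sum>l<n. Q $$ (i, l) * A $$ (l, j))" if "j < n" for j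
      unfolding QA[symmetric] using cQ A i that by (auto simp: scalar_prod_def atLeast0LessThan)
    have "(\<Sum>j<n. c j * real_of_int (D $$ (i, j)))
        = (\<Sum>j<n. \<Sum>l<n. real_of_int (Q $$ (i, l)) * (c j * real_of_int (A $$ (l, j))))"
      by (rule sum.cong) (simp_all add: D_entry sum_distrib_left mult_ac)
    also have "\<dots> = (\<Sum>l<n. real_of_int (Q $$ (i, l)) * (\<Sum>j<n. c j * real_of_int (A $$ (l, j))))"
      by (subst sum.swap) (simp add: sum_distrib_left)
    also have "\<dots> = 0" using rows by simp
    finally have "(\<Sum>j<n. c j * real_of_int (D $$ (i, j))) = 0" .
    moreover have "(\<Sum>j<n. c j * real_of_int (D $$ (i, j)))
        = (\<Sum>j<n. if j = i then c i * real_of_int (int p ^ nat (\<alpha> (Suc i))) else 0)"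
      by (rule sum.cong) (use i in \<open>auto simp: D_def power_diag_def mat_diag_def\<close>)
    ultimately show "c i = 0" using i p0 by simp
  qed
  ultimately have bcs: "lattice_basis n (embed bs ` H) cs"
    unfolding lattice_basis_iff using csl by blast
  show "is_sublattice n L (embed bs ` H)"
    unfolding is_sublattice_def is_lattice_def L using bcs Hsub by blast
  have "Q * A * 1\<^sub>m n = mat_diag n (\<lambda>i. int p ^ nat (\<alpha> (Suc i)))"
    unfolding QA right_mult_one_mat[OF cD] by (simp add: D_def power_diag_def)
  moreover have "invertible_mat Q" "invertible_mat (1\<^sub>m n :: int mat)"
    using Q(1) GL_one[of n] by (auto simp: GL_def)
  moreover have "int p ^ nat (\<alpha> k) dvd int p ^ nat (\<alpha> (Suc k))" if "k \<in> {1..<n}" for k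
    using \<alpha> that unfolding partitions_def by (intro le_imp_power_dvd nat_mono) auto
  ultimately have "smith_form n A (\<lambda>i. int p ^ nat (\<alpha> i))"
    unfolding smith_form_def using A cQ p0 by (meson one_carrier_mat zero_less_power)
  then show "invariant_factors n L (embed bs ` H) (\<lambda>i. int p ^ nat (\<alpha> i))"
    unfolding invariant_factors_def using b bcs A cs by blast
qed

text \<open>The factor \<open>U\<close> of the Smith form and the change to the chosen basis combine to one unimodular
  matrix on the left, while \<open>V\<close> is absorbed by the column lattice.\<close>

lemma typed_of_sublattice:
  assumes b: "lattice_basis n L bs" and inv: "invariant_factors n L M (\<lambda>i. int p ^ nat (\<alpha> i))"
  shows "M \<in> (`) (embed bs) ` typed_sublattices p n \<alpha>"
proof -
  define D where "D = power_diag p n \<alpha>"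
  have cD: "D \<in> carrier_mat n n" by (simp add: D_def)
  obtain bs' cs A where b': "lattice_basis n L bs'" and M: "lattice_basis n M cs"
    and A: "A \<in> carrier_mat n n"
    and cs: "\<And>j. j < n \<Longrightarrow> cs ! j = (\<Sum>i<n. real_of_int (A $$ (i, j)) *\<^sub>R (bs' ! i))"
    and smith: "smith_form n A (\<lambda>i. int p ^ nat (\<alpha> i))"
    using inv unfolding invariant_factors_def by blast
  have len: "length bs' = n" "length cs = n" using b' M by (auto simp: lattice_basis_iff)
  obtain U V where U: "U \<in> GL n" and V: "V \<in> GL n" and UAV: "U * A * V = D"
    using smith unfolding smith_form_def GL_def D_def power_diag_def by blast
  obtain U' where U': "U' \<in> GL n" "U' * U = 1\<^sub>m n" using GL_inverse[OF U] by metis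
  obtain Q where Q: "Q \<in> GL n" "\<And>x. x \<in> carrier_vec n \<Longrightarrow> embed bs' x = embed bs (Q *\<^sub>v x)"
    using change_of_basis_GL[OF b b'] by blast
  note c = GL_carrier[OF U] GL_carrier[OF V] GL_carrier[OF U'(1)] GL_carrier[OF Q(1)]
  have QA: "Q * A \<in> carrier_mat n n" using c A by simp
  have "embed cs x = embed bs (Q * A *\<^sub>v x)" if x: "x \<in> carrier_vec n" for x
  proof -
    have "A *\<^sub>v x \<in> carrier_vec n" using A x by simp
    then show ?thesis
      using embed_change_of_basis[OF len A cs x] Q(2) assoc_mult_mat_vec[OF c(4) A x] by simp
  qed
  moreover have "M = embed cs ` carrier_vec n" using M by (simp add: lattice_basis_iff)
  moreover have "column_lattice (Q * A) = (*\<^sub>v) (Q * A) ` carrier_vec n"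
    by (rule Set.set_eqI) (simp add: column_lattice_iff[OF QA] image_iff)
  ultimately have M: "M = embed bs ` column_lattice (Q * A)"
    by (simp add: image_image)
  have "U' * (U * A * V) = U' * (U * (A * V))" using c A by simp
  also have "\<dots> = U' * U * (A * V)" using assoc_mult_mat[OF c(3) c(1), of "A * V" n] A c by simp
  also have "\<dots> = A * V" using U'(2) A c by simp
  finally have "U' * D = A * V" using UAV by simp
  moreover have "Q * U' * D = Q * (U' * D)" using c cD by simp
  ultimately have "Q * U' * D = Q * (A * V)" by simp
  also have "\<dots> = Q * A * V" using c A by simp
  finally have "column_lattice (Q * A) = column_lattice (Q * U' * D)"
    using column_lattice_mult_right[OF QA V] by simp
  moreover have "Q * U' \<in> GL n" by (rule GL_mult[OF Q(1) U'(1)])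
  ultimately have "column_lattice (Q * A) \<in> typed_sublattices p n \<alpha>"
    unfolding typed_sublattices_def D_def by blast
  then show ?thesis unfolding M by (rule imageI)
qed

text \<open>Passing to coordinates removes the ambient space, so lattices in different Euclidean spaces
  can be compared.\<close>

lemma num_sublattices_eq_card_typed:
  fixes L :: "'a::euclidean_space set"
  assumes L: "is_lattice n L" and p: "prime p" and \<alpha>: "\<alpha> \<in> partitions n N"
  shows "num_sublattices n L \<alpha> p = card (typed_sublattices p n \<alpha>)"
proof -
  obtain bs where b: "lattice_basis n L bs" using L unfolding is_lattice_def by blast
  have "{M. is_sublattice n L M \<and> invariant_factors n L M (\<lambda>i. int p ^ nat (\<alpha> i))}
      = (`) (embed bs) ` typed_sublattices p n \<alpha>" (is "?S = ?T")
  proof (intro equalityI subsetI)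
    fix M assume "M \<in> ?S" then show "M \<in> ?T" using typed_of_sublattice[OF b] by blast
  next
    fix M assume "M \<in> ?T"
    then show "M \<in> ?S"
      using sublattice_of_typed[OF b p \<alpha>] unfolding typed_sublattices_def by blast
  qed
  moreover have "inj_on ((`) (embed bs)) (typed_sublattices p n \<alpha>)"
  proof (rule inj_onI)
    fix H H' assume "H \<in> typed_sublattices p n \<alpha>" "H' \<in> typed_sublattices p n \<alpha>"
      and eq: "embed bs ` H = embed bs ` H'"
    then have "H \<subseteq> carrier_vec n" "H' \<subseteq> carrier_vec n" using typed_sublattices_subset by blast+
    then show "H = H'" using inj_on_image_eq_iff[OF embed_inj[OF b]] eq by blast
  qed
  ultimately show ?thesis unfolding num_sublattices_def by (simp add: card_image)
qed

section \<open>The type as an invariant\<close>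

lemma partitions_mono:
  assumes \<beta>: "\<beta> \<in> partitions m M" and "1 \<le> i" "i \<le> j" "j \<le> m"
  shows "\<beta> i \<le> \<beta> j"
  using assms(3,4)
proof (induction j rule: dec_induct)
  case (step l)
  then have "\<beta> l \<le> \<beta> (Suc l)" using \<beta> assms(2) by (auto simp: partitions_def)
  then show ?case using step by simp
qed simp

lemma partitions_nonneg: "\<beta> \<in> partitions m M \<Longrightarrow> 0 \<le> \<beta> i"
  by (cases "i \<in> {1..m}") (auto simp: partitions_def tuples_def)

lemma partitions_le: "\<beta> \<in> partitions m M \<Longrightarrow> \<beta> i \<le> M"
proof (cases "i \<in> {1..m}")
  case True
  assume \<beta>: "\<beta> \<in> partitions m M"
  have "\<beta> i \<le> sum \<beta> {1..m}"
    using True partitions_nonneg[OF \<beta>] by (intro member_le_sum) auto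
  then show ?thesis using \<beta> by (simp add: partitions_def)
next
  case False
  assume \<beta>: "\<beta> \<in> partitions m M"
  have "0 \<le> sum \<beta> {1..m}" using partitions_nonneg[OF \<beta>] by (intro sum_nonneg) auto
  moreover have "\<beta> i = 0" "sum \<beta> {1..m} = M" using \<beta> False unfolding partitions_def tuples_def by blast+
  ultimately show ?thesis by simp
qed

lemma partition_sum_nonneg: "\<beta> \<in> partitions m M \<Longrightarrow> 0 \<le> (\<Sum>i=a..b. \<beta> i)"
  using partitions_nonneg by (intro sum_nonneg) auto

lemma tuples_eqI:
  assumes "\<alpha> \<in> tuples n" "\<alpha>' \<in> tuples n" "\<And>i. i \<in> {1..n} \<Longrightarrow> \<alpha> i = \<alpha>' i"
  shows "\<alpha> = \<alpha>'"
proof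
  fix i show "\<alpha> i = \<alpha>' i" using assms by (cases "i \<in> {1..n}") (auto simp: tuples_def)
qed

text \<open>A diagonal matrix is the extension matrix with \<open>r = \<alpha>\<^sub>1\<close>, \<open>w = 0\<close> and \<open>\<beta>\<close> the remaining parts.
  All \<open>\<eta>\<^sub>k\<close> are then at least \<open>\<alpha>\<^sub>1\<close>, so the minimum with \<open>r\<close> is always \<open>\<alpha>\<^sub>1\<close>.\<close>

lemma minors_dvd_power_diag:
  assumes p: "prime p" and \<alpha>: "\<alpha> \<in> partitions n N" and k: "1 \<le> k" "k \<le> n"
  shows "minors_dvd k (int p ^ s) (power_diag p n \<alpha>) \<longleftrightarrow> int s \<le> (\<Sum>i=1..k. \<alpha> i)"
proof -
  define \<beta> where "\<beta> i = \<alpha> (Suc i)" for i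
  have D: "power_diag p n \<alpha> = extension_matrix p n (\<alpha> 1) \<beta> (\<lambda>_. 0)"
    by (rule eq_matI) (auto simp: power_diag_def mat_diag_def extension_matrix_def \<beta>_def)
  have mono: "\<beta> i \<le> \<beta> j" if "1 \<le> i" "i \<le> j" "j \<le> n - 1" for i j
    using partitions_mono[OF \<alpha>, of "Suc i" "Suc j"] that k by (simp add: \<beta>_def)
  have v: "has_valuations p (n - 1) \<beta> (\<lambda>_. 0) \<beta>"
    using partitions_nonneg[OF \<alpha>] by (auto simp: has_valuations_def \<beta>_def)
  have r: "0 \<le> \<alpha> 1" by (rule partitions_nonneg[OF \<alpha>])
  have le: "\<alpha> 1 \<le> \<beta> i" if "i \<le> n - 1" for i
    using partitions_mono[OF \<alpha>, of 1 "Suc i"] that k by (simp add: \<beta>_def)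
  have "\<alpha> 1 \<le> eta n \<beta> \<beta> k" if "k < n"
    by (rule eta_ge) (use that k le in auto)
  then have "capped_eta n (\<alpha> 1) \<beta> \<beta> k = \<alpha> 1" by (simp add: capped_eta_def)
  moreover have "(\<Sum>i=1..k. \<alpha> i) = (\<Sum>i=1..k-1. \<beta> i) + \<alpha> 1"
  proof -
    obtain l where l: "k = Suc l" using k by (cases k) auto
    have "(\<Sum>i=1..Suc l. \<alpha> i) = \<alpha> 1 + (\<Sum>i=1..l. \<alpha> (Suc i))"
      by (induction l) auto
    then show ?thesis by (simp add: l \<beta>_def)
  qed
  ultimately show ?thesis
    unfolding D using extension_minors_dvd_imp[OF p r mono v k] extension_minors_dvd[OF r mono v k]
    by (metis (no_types, lifting))
qed

text \<open>Exponents are compared through the natural numbers below them, because divisibility by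
  \<open>p ^ s\<close> makes sense only for \<open>s \<ge> 0\<close>.\<close>

lemma int_eq_if_same_lower_nats:
  fixes a b :: int
  assumes "0 \<le> a" "0 \<le> b" "\<And>s. int s \<le> a \<longleftrightarrow> int s \<le> b"
  shows "a = b"
  using assms(3)[of "nat a"] assms(3)[of "nat b"] assms(1,2) by simp

lemma partition_eqI:
  assumes \<alpha>: "\<alpha> \<in> partitions n N" and \<alpha>': "\<alpha>' \<in> partitions n N'"
    and eq: "\<And>k. 1 \<le> k \<Longrightarrow> k \<le> n \<Longrightarrow> (\<Sum>i=1..k. \<alpha> i) = (\<Sum>i=1..k. \<alpha>' i)"
  shows "\<alpha> = \<alpha>'"
proof (rule tuples_eqI)
  fix i assume i: "i \<in> {1..n}"
  then obtain l where l: "i = Suc l" by (cases i) auto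
  have "(\<Sum>i=1..l. \<alpha> i) = (\<Sum>i=1..l. \<alpha>' i)" using eq[of l] i l by (cases "l = 0") auto
  moreover have "(\<Sum>i=1..Suc l. \<alpha> i) = (\<Sum>i=1..Suc l. \<alpha>' i)" using eq[of i] i l by simp
  ultimately show "\<alpha> i = \<alpha>' i" by (simp add: l)
qed (use \<alpha> \<alpha>' in \<open>auto simp: partitions_def\<close>)

text \<open>The type is an invariant: the exponents of the minors recover all partial sums of \<open>\<alpha>\<close>.\<close>

lemma typed_sublattices_disjoint:
  assumes p: "prime p" and \<alpha>: "\<alpha> \<in> partitions n N" and \<alpha>': "\<alpha>' \<in> partitions n N'"
    and H: "H \<in> typed_sublattices p n \<alpha>" "H \<in> typed_sublattices p n \<alpha>'"
  shows "\<alpha> = \<alpha>'"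
proof (rule partition_eqI[OF \<alpha> \<alpha>'])
  fix k assume k: "1 \<le> k" "k \<le> n"
  obtain P Q where PQ: "P \<in> GL n" "Q \<in> GL n" "H = column_lattice (P * power_diag p n \<alpha>)"
    "H = column_lattice (Q * power_diag p n \<alpha>')"
    using H unfolding typed_sublattices_def by blast
  have "minors_dvd k d (power_diag p n \<alpha>) \<longleftrightarrow> minors_dvd k d (power_diag p n \<alpha>')" for d
    by (rule minors_dvd_column_lattice[OF PQ(1,2)]) (use PQ(3,4) in auto)
  then have "int s \<le> (\<Sum>i=1..k. \<alpha> i) \<longleftrightarrow> int s \<le> (\<Sum>i=1..k. \<alpha>' i)" for s
    using minors_dvd_power_diag[OF p \<alpha> k] minors_dvd_power_diag[OF p \<alpha>' k] by blast
  then show "(\<Sum>i=1..k. \<alpha> i) = (\<Sum>i=1..k. \<alpha>' i)"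
    using partition_sum_nonneg[OF \<alpha>] partition_sum_nonneg[OF \<alpha>']
    by (intro int_eq_if_same_lower_nats) auto
qed

section \<open>The set T in terms of exponents of minors\<close>

lemma eta_mono:
  assumes mono: "\<And>i j. 1 \<le> i \<Longrightarrow> i \<le> j \<Longrightarrow> j \<le> n - 1 \<Longrightarrow> \<beta> i \<le> \<beta> j"
    and \<delta>: "\<And>i. i \<in> {1..n-1} \<Longrightarrow> \<delta> i \<le> \<beta> i"
    and k: "1 \<le> k" "k \<le> l" "l \<le> n - 1"
  shows "eta n \<beta> \<delta> k \<le> eta n \<beta> \<delta> l"
proof (rule eta_ge)
  fix i assume i: "1 \<le> i" "i < l"
  show "eta n \<beta> \<delta> k \<le> \<beta> l - \<beta> i + \<delta> i"
  proof (cases "i < k")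
    case True
    then show ?thesis using eta_le_below[OF i(1) True, of n \<beta> \<delta>] mono[of k l] k by linarith
  next
    case False
    then show ?thesis using eta_le_above[of k i n \<beta> \<delta>] mono[of i l] i k by linarith
  qed
next
  fix j assume "l \<le> j" "j \<le> n - 1"
  then show "eta n \<beta> \<delta> k \<le> \<delta> j" using eta_le_above[of k j n \<beta> \<delta>] k by linarith
qed (use k in auto)

lemma k0_cases:
  assumes n: "1 \<le> n"
  shows "1 \<le> k0 n r \<beta> \<delta>" "k0 n r \<beta> \<delta> \<le> n"
    and "\<And>k. 1 \<le> k \<Longrightarrow> k < k0 n r \<beta> \<delta> \<Longrightarrow> eta n \<beta> \<delta> k \<le> r"
    and "k0 n r \<beta> \<delta> < n \<Longrightarrow> r < eta n \<beta> \<delta> (k0 n r \<beta> \<delta>)"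
proof -
  have "1 \<le> k0 n r \<beta> \<delta> \<and> k0 n r \<beta> \<delta> \<le> n \<and> (\<forall>k. 1 \<le> k \<longrightarrow> k < k0 n r \<beta> \<delta> \<longrightarrow> eta n \<beta> \<delta> k \<le> r) \<and>
    (k0 n r \<beta> \<delta> < n \<longrightarrow> r < eta n \<beta> \<delta> (k0 n r \<beta> \<delta>))"
  proof (cases "\<exists>k \<in> {1..n-1}. r < eta n \<beta> \<delta> k")
    case True
    let ?P = "\<lambda>k. k \<in> {1..n-1} \<and> r < eta n \<beta> \<delta> k"
    have k0: "k0 n r \<beta> \<delta> = (LEAST k. ?P k)" using True by (simp add: k0_def)
    have ex: "\<exists>k. ?P k" using True by blast
    have P: "?P (LEAST k. ?P k)" by (rule LeastI_ex[OF ex])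
    have "eta n \<beta> \<delta> k \<le> r" if "1 \<le> k" "k < (LEAST k. ?P k)" for k
    proof -
      have "k \<in> {1..n-1}" using P that by simp
      then show ?thesis using not_less_Least[OF that(2)] by simp
    qed
    then show ?thesis unfolding k0 using P by auto
  next
    case False
    then have "k0 n r \<beta> \<delta> = n" unfolding k0_def by (rule if_not_P)
    then show ?thesis using False n by force
  qed
  then show "1 \<le> k0 n r \<beta> \<delta>" "k0 n r \<beta> \<delta> \<le> n"
    and "\<And>k. 1 \<le> k \<Longrightarrow> k < k0 n r \<beta> \<delta> \<Longrightarrow> eta n \<beta> \<delta> k \<le> r"
    and "k0 n r \<beta> \<delta> < n \<Longrightarrow> r < eta n \<beta> \<delta> (k0 n r \<beta> \<delta>)" by blast+
qed

text \<open>Since \<open>\<eta>\<close> is nondecreasing, \<open>k\<^sub>0\<close> is the place where the minimum of \<open>\<eta>\<^sub>k\<close> and \<open>r\<close> changes from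
  \<open>\<eta>\<^sub>k\<close> to \<open>r\<close>. The three cases are therefore one difference of consecutive minima.\<close>

lemma T_formula_capped_eta:
  assumes r: "0 \<le> r"
    and mono: "\<And>i j. 1 \<le> i \<Longrightarrow> i \<le> j \<Longrightarrow> j \<le> n - 1 \<Longrightarrow> \<beta> i \<le> \<beta> j"
    and \<delta>: "\<And>i. i \<in> {1..n-1} \<Longrightarrow> \<delta> i \<le> \<beta> i" and k: "1 \<le> k" "k \<le> n"
  shows "(if k < k0 n r \<beta> \<delta> then \<beta> (k - 1) + eta n \<beta> \<delta> k - eta n \<beta> \<delta> (k - 1)
         else if k = k0 n r \<beta> \<delta> then \<beta> (k - 1) + r - eta n \<beta> \<delta> (k - 1)
         else \<beta> (k - 1)) = \<beta> (k - 1) + capped_eta n r \<beta> \<delta> k - capped_eta n r \<beta> \<delta> (k - 1)"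
proof -
  have n: "1 \<le> n" using k by simp
  note K = k0_cases[OF n, where r = r and \<beta> = \<beta> and \<delta> = \<delta>]
  have below: "capped_eta n r \<beta> \<delta> l = eta n \<beta> \<delta> l" if "l < k0 n r \<beta> \<delta>" for l
  proof (cases "l = 0")
    case True
    then show ?thesis using r n by (simp add: capped_eta_def eta_def)
  next
    case False
    then show ?thesis using K(2) K(3)[of l] that by (simp add: capped_eta_def)
  qed
  have above: "capped_eta n r \<beta> \<delta> l = r" if "k0 n r \<beta> \<delta> \<le> l" for l
  proof (cases "l < n")
    case True
    then have "eta n \<beta> \<delta> (k0 n r \<beta> \<delta>) \<le> eta n \<beta> \<delta> l"
      using K(1) that by (intro eta_mono[OF mono \<delta>]) auto
    then show ?thesis using K(4) True that by (simp add: capped_eta_def)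
  qed (simp add: capped_eta_def)
  consider "k < k0 n r \<beta> \<delta>" | "k = k0 n r \<beta> \<delta>" | "k > k0 n r \<beta> \<delta>" by linarith
  then show ?thesis
  proof cases
    case 1 then show ?thesis using below[of k] below[of "k - 1"] by simp
  next
    case 2 then show ?thesis using above[of k] below[of "k - 1"] k by simp
  next
    case 3 then show ?thesis using above[of k] above[of "k - 1"] by simp
  qed
qed

text \<open>Summing the defining equations of \<open>T\<close> telescopes. The sums on the right-hand side are the
  exponents of the minors of the extension matrix.\<close>

lemma T_iff_partial_sums:
  assumes n: "1 \<le> n" and r: "0 \<le> r" and \<beta>: "\<beta> \<in> partitions (n - 1) M"
    and \<delta>: "\<delta> \<in> tuples (n - 1)" "\<And>i. i \<in> {1..n-1} \<Longrightarrow> 0 \<le> \<delta> i \<and> \<delta> i \<le> \<beta> i"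
  shows "\<delta> \<in> T n r \<alpha> \<beta> \<longleftrightarrow>
    (\<forall>k\<in>{1..n}. (\<Sum>i=1..k. \<alpha> i) = (\<Sum>i=1..k-1. \<beta> i) + capped_eta n r \<beta> \<delta> k)"
proof -
  let ?c = "capped_eta n r \<beta> \<delta>"
  let ?S = "\<lambda>k. (\<Sum>i=1..k. \<alpha> i) = (\<Sum>i=1..k-1. \<beta> i) + ?c k"
  have \<beta>0: "\<beta> 0 = 0" using \<beta> by (auto simp: partitions_def tuples_def)
  have c0: "?c 0 = 0" using n r by (simp add: capped_eta_def eta_def)
  let ?F = "\<lambda>k. if k < k0 n r \<beta> \<delta> then \<beta> (k - 1) + eta n \<beta> \<delta> k - eta n \<beta> \<delta> (k - 1)
         else if k = k0 n r \<beta> \<delta> then \<beta> (k - 1) + r - eta n \<beta> \<delta> (k - 1)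
         else \<beta> (k - 1)"
  have F: "?F k = \<beta> (k - 1) + ?c k - ?c (k - 1)" if "k \<in> {1..n}" for k
  proof (rule T_formula_capped_eta[OF r])
    show "\<beta> i \<le> \<beta> j" if "1 \<le> i" "i \<le> j" "j \<le> n - 1" for i j
      using partitions_mono[OF \<beta> that] .
  qed (use that \<delta> in auto)
  have "\<delta> \<in> T n r \<alpha> \<beta> \<longleftrightarrow> (\<forall>k\<in>{1..n}. \<alpha> k = ?F k)"
    unfolding T_def mem_Collect_eq using \<delta> by blast
  also have "\<dots> \<longleftrightarrow> (\<forall>k\<in>{1..n}. \<alpha> k = \<beta> (k - 1) + ?c k - ?c (k - 1))"
    by (rule ball_cong[OF refl]) (simp only: F)
  also have "\<dots> \<longleftrightarrow> (\<forall>k\<in>{1..n}. ?S k)"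
  proof
    assume L: "\<forall>k\<in>{1..n}. \<alpha> k = \<beta> (k - 1) + ?c k - ?c (k - 1)"
    have "k \<le> n \<Longrightarrow> ?S k" for k
    proof (induction k)
      case 0 then show ?case using c0 by simp
    next
      case (Suc k)
      then have "\<alpha> (Suc k) = \<beta> k + ?c (Suc k) - ?c k" using L by auto
      moreover have "(\<Sum>i=1..k. \<beta> i) = (\<Sum>i=1..k-1. \<beta> i) + \<beta> k" using \<beta>0 by (cases k) auto
      ultimately show ?case using Suc by simp
    qed
    then show "\<forall>k\<in>{1..n}. ?S k" by simp
  next
    assume R: "\<forall>k\<in>{1..n}. ?S k"
    have S: "?S k" if "k \<le> n" for k
      using R that c0 by (cases "k = 0") auto
    show "\<forall>k\<in>{1..n}. \<alpha> k = \<beta> (k - 1) + ?c k - ?c (k - 1)"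
    proof
      fix k assume k: "k \<in> {1..n}"
      then obtain l where l: "k = Suc l" by (cases k) auto
      have "(\<Sum>i=1..l. \<beta> i) = (\<Sum>i=1..l-1. \<beta> i) + \<beta> l" using \<beta>0 by (cases l) auto
      then show "\<alpha> k = \<beta> (k - 1) + ?c k - ?c (k - 1)"
        using S[of k] S[of l] k l by simp
    qed
  qed
  finally show ?thesis .
qed

section \<open>Extensions of a lattice in a hyperplane\<close>

text \<open>A multiple of \<open>p ^ K\<close> is a multiple of every smaller power on the diagonal.\<close>

lemma power_diag_solve:
  assumes \<alpha>: "\<And>i. i \<in> {1..n} \<Longrightarrow> \<alpha> i \<le> int K" and u: "u \<in> carrier_vec n"
  shows "\<exists>z\<in>carrier_vec n. power_diag p n \<alpha> *\<^sub>v z = int p ^ K \<cdot>\<^sub>v u"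
proof
  define z where "z = vec n (\<lambda>i. int p ^ (K - nat (\<alpha> (Suc i))) * u $ i)"
  show z: "z \<in> carrier_vec n" by (simp add: z_def)
  show "power_diag p n \<alpha> *\<^sub>v z = int p ^ K \<cdot>\<^sub>v u"
  proof (rule eq_vecI)
    fix i assume "i < dim_vec (int p ^ K \<cdot>\<^sub>v u)"
    then have i: "i < n" using u by simp
    then have "nat (\<alpha> (Suc i)) \<le> K" using \<alpha>[of "Suc i"] by simp
    then have "int p ^ nat (\<alpha> (Suc i)) * int p ^ (K - nat (\<alpha> (Suc i))) = int p ^ K"
      by (simp add: power_add[symmetric])
    moreover have "(power_diag p n \<alpha> *\<^sub>v z) $ i
        = int p ^ nat (\<alpha> (Suc i)) * int p ^ (K - nat (\<alpha> (Suc i))) * u $ i"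
      using power_diag_mult_vec[OF z i] i by (simp add: z_def)
    ultimately show "(power_diag p n \<alpha> *\<^sub>v z) $ i = (int p ^ K \<cdot>\<^sub>v u) $ i" using u i by simp
  qed (use u in \<open>simp add: power_diag_def mat_diag_def\<close>)
qed

lemma typed_sublattice_contains_powers:
  assumes \<alpha>: "\<alpha> \<in> partitions n N" and H: "H \<in> typed_sublattices p n \<alpha>" and x: "x \<in> carrier_vec n"
  shows "int p ^ nat N \<cdot>\<^sub>v x \<in> H"
proof -
  obtain P where P: "P \<in> GL n" "H = column_lattice (P * power_diag p n \<alpha>)"
    using H unfolding typed_sublattices_def by blast
  obtain Q where Q: "Q \<in> GL n" "P * Q = 1\<^sub>m n" using GL_inverse[OF P(1)] by metis
  note c = GL_carrier[OF P(1)] GL_carrier[OF Q(1)]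
  have Qx: "Q *\<^sub>v x \<in> carrier_vec n" using c x by simp
  have "\<alpha> i \<le> int (nat N)" for i using partitions_le[OF \<alpha>, of i] partitions_nonneg[OF \<alpha>, of i] by linarith
  then obtain z where z: "z \<in> carrier_vec n" "power_diag p n \<alpha> *\<^sub>v z = int p ^ nat N \<cdot>\<^sub>v (Q *\<^sub>v x)"
    using power_diag_solve[OF _ Qx] by blast
  have "P *\<^sub>v (power_diag p n \<alpha> *\<^sub>v z) = int p ^ nat N \<cdot>\<^sub>v (P *\<^sub>v (Q *\<^sub>v x))"
    unfolding z(2) by (rule mult_mat_vec_int[OF c(1) Qx])
  also have "\<dots> = int p ^ nat N \<cdot>\<^sub>v x" using mult_inverse_vec[OF c Q(2) x] by simp
  finally show ?thesis unfolding P(2) mem_column_lattice_power_diag[OF P(1)] using z(1) by metis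
qed

lemma extension_matrix_mult_vCons:
  assumes z: "z \<in> carrier_vec m"
  shows "extension_matrix p (Suc m) r \<beta> w *\<^sub>v vCons t z =
    vCons (t * int p ^ nat r) (t \<cdot>\<^sub>v vec m (\<lambda>i. w (Suc i)) + power_diag p m \<beta> *\<^sub>v z)" (is "?E *\<^sub>v _ = ?r")
proof (rule eq_vecI)
  fix i assume "i < dim_vec ?r"
  then have i: "i < Suc m" by (simp add: power_diag_def mat_diag_def)
  show "(?E *\<^sub>v vCons t z) $ i = ?r $ i"
  proof (cases i)
    case 0
    have "row ?E 0 = vCons (int p ^ nat r) (0\<^sub>v m)"
      by (rule eq_vecI) (auto simp: extension_matrix_index vec_index_vCons)
    then show ?thesis using 0 z by (simp add: mult.commute)
  next
    case (Suc l)
    have "row ?E i = vCons (w i) (row (power_diag p m \<beta>) l)"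
      using i Suc by (intro eq_vecI) (auto simp: extension_matrix_index vec_index_vCons power_diag_def mat_diag_def)
    then have "(?E *\<^sub>v vCons t z) $ i = w i * t + row (power_diag p m \<beta>) l \<bullet> z"
      using i by simp
    moreover have "row (power_diag p m \<beta>) l \<bullet> z = (power_diag p m \<beta> *\<^sub>v z) $ l"
      using i Suc by (simp add: power_diag_def mat_diag_def)
    moreover have "l < dim_vec (power_diag p m \<beta> *\<^sub>v z)"
      using i Suc by (simp add: power_diag_def mat_diag_def)
    then have "?r $ i = t * w i + (power_diag p m \<beta> *\<^sub>v z) $ l"
      using i Suc by (simp add: vec_index_vCons del: index_mult_mat_vec)
    ultimately show ?thesis by (simp only: mult.commute)
  qed
qed (simp add: power_diag_def mat_diag_def)

text \<open>The subgroup of \<open>\<int>\<^sup>m\<^sup>+\<^sup>1\<close> generated by the lattice with presentation \<open>P\<close> and type \<open>\<beta>\<close> in the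
  hyperplane and by one more vector, with first coordinate \<open>p ^ r\<close> and remaining part \<open>P w\<close>.\<close>

definition extension_lattice ::
    "nat \<Rightarrow> nat \<Rightarrow> int mat \<Rightarrow> int \<Rightarrow> (nat \<Rightarrow> int) \<Rightarrow> (nat \<Rightarrow> int) \<Rightarrow> int vec set" where
  "extension_lattice p m P r \<beta> w = column_lattice (bordered P * extension_matrix p (Suc m) r \<beta> w)"

lemma extension_lattice_iff:
  assumes P: "P \<in> GL m"
  shows "v \<in> extension_lattice p m P r \<beta> w \<longleftrightarrow> (\<exists>t. \<exists>z\<in>carrier_vec m.
    v = vCons (t * int p ^ nat r) (P *\<^sub>v (t \<cdot>\<^sub>v vec m (\<lambda>i. w (Suc i)) + power_diag p m \<beta> *\<^sub>v z)))"
proof -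
  let ?E = "extension_matrix p (Suc m) r \<beta> w"
  have c: "bordered P \<in> carrier_mat (Suc m) (Suc m)" by (rule bordered_carrier[OF GL_carrier[OF P]])
  have BE: "bordered P * ?E \<in> carrier_mat (Suc m) (Suc m)" using c by simp
  have eq: "bordered P * ?E *\<^sub>v vCons t z =
      vCons (t * int p ^ nat r) (P *\<^sub>v (t \<cdot>\<^sub>v vec m (\<lambda>i. w (Suc i)) + power_diag p m \<beta> *\<^sub>v z))"
    if z: "z \<in> carrier_vec m" for t z
  proof -
    have "bordered P * ?E *\<^sub>v vCons t z = bordered P *\<^sub>v (?E *\<^sub>v vCons t z)"
      by (rule assoc_mult_mat_vec[OF c extension_matrix_carrier(1)]) (use z in simp)
    also have "t \<cdot>\<^sub>v vec m (\<lambda>i. w (Suc i)) + power_diag p m \<beta> *\<^sub>v z \<in> carrier_vec m"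
      using z by (intro add_carrier_vec mult_mat_vec_carrier[of _ m m]) auto
    from bordered_mult_vCons[OF GL_carrier[OF P] this]
    have "bordered P *\<^sub>v (?E *\<^sub>v vCons t z) =
      vCons (t * int p ^ nat r) (P *\<^sub>v (t \<cdot>\<^sub>v vec m (\<lambda>i. w (Suc i)) + power_diag p m \<beta> *\<^sub>v z))"
      unfolding extension_matrix_mult_vCons[OF z] .
    finally show ?thesis .
  qed
  show ?thesis
    unfolding extension_lattice_def column_lattice_iff[OF BE]
  proof
    assume "\<exists>x\<in>carrier_vec (Suc m). v = bordered P * ?E *\<^sub>v x"
    then obtain x where x: "x \<in> carrier_vec (Suc m)" "v = bordered P * ?E *\<^sub>v x" by blast
    obtain t z where z: "z \<in> carrier_vec m" "x = vCons t z" using x(1) by (rule carrier_vec_Suc_cases)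
    show "\<exists>t. \<exists>z\<in>carrier_vec m.
      v = vCons (t * int p ^ nat r) (P *\<^sub>v (t \<cdot>\<^sub>v vec m (\<lambda>i. w (Suc i)) + power_diag p m \<beta> *\<^sub>v z))"
      using x(2) eq[OF z(1), of t] z by blast
  next
    assume "\<exists>t. \<exists>z\<in>carrier_vec m.
      v = vCons (t * int p ^ nat r) (P *\<^sub>v (t \<cdot>\<^sub>v vec m (\<lambda>i. w (Suc i)) + power_diag p m \<beta> *\<^sub>v z))"
    then obtain t z where z: "z \<in> carrier_vec m"
      and v: "v = vCons (t * int p ^ nat r) (P *\<^sub>v (t \<cdot>\<^sub>v vec m (\<lambda>i. w (Suc i)) + power_diag p m \<beta> *\<^sub>v z))"
      by blast
    then have "v = bordered P * ?E *\<^sub>v vCons t z" using eq[OF z] by simp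
    then show "\<exists>x\<in>carrier_vec (Suc m). v = bordered P * ?E *\<^sub>v x" using z by (intro bexI[of _ "vCons t z"]) auto
  qed
qed

lemma int_subgroup_extension_lattice:
  assumes "P \<in> GL m"
  shows "int_subgroup (Suc m) (extension_lattice p m P r \<beta> w)"
  unfolding extension_lattice_def
  using bordered_carrier[OF GL_carrier[OF assms]] by (intro int_subgroup_column_lattice[of _ _ "Suc m"]) auto

text \<open>Finite \<open>p\<close>-power index, as needed for the existence of a type: with \<open>t = a * p ^ M\<close> the first
  coordinate is right, and the remaining error is divisible by \<open>p ^ M\<close>, hence lies in the lattice of the
  hyperplane.\<close>

lemma extension_lattice_contains_powers:
  assumes P: "P \<in> GL m" and \<beta>: "\<beta> \<in> partitions m M" and x: "x \<in> carrier_vec (Suc m)"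
  shows "int p ^ (nat r + nat M) \<cdot>\<^sub>v x \<in> extension_lattice p m P r \<beta> w"
proof -
  obtain a y where y: "y \<in> carrier_vec m" "x = vCons a y" using x by (rule carrier_vec_Suc_cases)
  obtain Q where Q: "Q \<in> GL m" "P * Q = 1\<^sub>m m" using GL_inverse[OF P] by metis
  note c = GL_carrier[OF P] GL_carrier[OF Q(1)]
  define W where "W = vec m (\<lambda>i. w (Suc i))"
  \<comment> \<open>The coefficient of the additional generator, forced by the first coordinate.\<close>
  define t where "t = a * int p ^ nat M"
  define q where "q = Q *\<^sub>v y"
  define u where "u = int p ^ nat r \<cdot>\<^sub>v q - a \<cdot>\<^sub>v W"
  have Qy: "q \<in> carrier_vec m" and W: "W \<in> carrier_vec m" using c y by (auto simp: W_def q_def)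
  then have u: "u \<in> carrier_vec m"
    unfolding u_def by (intro minus_carrier_vec smult_carrier_vec[THEN iffD2])
  have "\<beta> i \<le> int (nat M)" for i using partitions_le[OF \<beta>, of i] partitions_nonneg[OF \<beta>, of i] by linarith
  then obtain z where z: "z \<in> carrier_vec m" "power_diag p m \<beta> *\<^sub>v z = int p ^ nat M \<cdot>\<^sub>v u"
    using power_diag_solve[OF _ u] by blast
  have "t \<cdot>\<^sub>v W + power_diag p m \<beta> *\<^sub>v z = int p ^ (nat r + nat M) \<cdot>\<^sub>v q"
    unfolding z(2) using Qy W by (intro eq_vecI) (auto simp: t_def u_def algebra_simps power_add)
  then have "P *\<^sub>v (t \<cdot>\<^sub>v W + power_diag p m \<beta> *\<^sub>v z) = int p ^ (nat r + nat M) \<cdot>\<^sub>v y"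
    using mult_mat_vec_int[OF c(1) Qy] mult_inverse_vec[OF c Q(2) y(1)] by (simp add: q_def)
  moreover have "int p ^ (nat r + nat M) \<cdot>\<^sub>v x
      = vCons (t * int p ^ nat r) (int p ^ (nat r + nat M) \<cdot>\<^sub>v y)"
    using y by (intro eq_vecI) (auto simp: vec_index_vCons t_def power_add)
  ultimately show ?thesis
    unfolding extension_lattice_iff[OF P] W_def using z(1) by metis
qed

text \<open>Both sides are the exponent of the largest power of \<open>p\<close> dividing all \<open>k\<close>-minors, computed from
  two matrices that present the same lattice up to unimodular factors.\<close>

lemma extension_lattice_partial_sums:
  assumes p: "prime p" and P: "P \<in> GL m" and \<beta>: "\<beta> \<in> partitions m M" and r: "0 \<le> r"
    and v: "has_valuations p m \<beta> w \<delta>" and \<alpha>: "\<alpha> \<in> partitions (Suc m) N"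
    and H: "extension_lattice p m P r \<beta> w \<in> typed_sublattices p (Suc m) \<alpha>"
    and k: "1 \<le> k" "k \<le> Suc m"
  shows "(\<Sum>i=1..k. \<alpha> i) = (\<Sum>i=1..k-1. \<beta> i) + capped_eta (Suc m) r \<beta> \<delta> k"
proof (rule int_eq_if_same_lower_nats)
  show "0 \<le> (\<Sum>i=1..k. \<alpha> i)" by (rule partition_sum_nonneg[OF \<alpha>])
  have \<delta>: "0 \<le> \<delta> i" "\<delta> i \<le> \<beta> i" if "i \<in> {1..m}" for i using v that by (auto simp: has_valuations_def)
  have mono: "\<beta> i \<le> \<beta> j" if "1 \<le> i" "i \<le> j" "j \<le> Suc m - 1" for i j
    using partitions_mono[OF \<beta>] that by simp
  have v': "has_valuations p (Suc m - 1) \<beta> w \<delta>" using v by simp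
  have "0 \<le> capped_eta (Suc m) r \<beta> \<delta> k"
  proof (cases "k < Suc m")
    case True
    have "0 \<le> eta (Suc m) \<beta> \<delta> k"
    proof (rule eta_ge)
      fix i assume "1 \<le> i" "i < k"
      then show "0 \<le> \<beta> k - \<beta> i + \<delta> i" using \<delta>(1)[of i] mono[of i k] True by simp
    qed (use True k \<delta> in auto)
    then show ?thesis using r by (simp add: capped_eta_def)
  qed (use r in \<open>simp add: capped_eta_def\<close>)
  then show "0 \<le> (\<Sum>i=1..k-1. \<beta> i) + capped_eta (Suc m) r \<beta> \<delta> k"
    using partition_sum_nonneg[OF \<beta>] by simp
  fix s
  obtain Q where Q: "Q \<in> GL (Suc m)"
    "extension_lattice p m P r \<beta> w = column_lattice (Q * power_diag p (Suc m) \<alpha>)"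
    using H unfolding typed_sublattices_def by blast
  have "minors_dvd k (int p ^ s) (power_diag p (Suc m) \<alpha>)
      \<longleftrightarrow> minors_dvd k (int p ^ s) (extension_matrix p (Suc m) r \<beta> w)"
    by (rule minors_dvd_column_lattice[OF Q(1) bordered_GL[OF P]])
       (use Q(2) in \<open>auto simp: extension_lattice_def\<close>)
  moreover have "minors_dvd k (int p ^ s) (extension_matrix p (Suc m) r \<beta> w)
      \<longleftrightarrow> int s \<le> (\<Sum>i=1..k-1. \<beta> i) + capped_eta (Suc m) r \<beta> \<delta> k"
    using extension_minors_dvd_imp[OF p r mono v' k] extension_minors_dvd[OF r mono v' k] by blast
  ultimately show "int s \<le> (\<Sum>i=1..k. \<alpha> i) \<longleftrightarrow> int s \<le> (\<Sum>i=1..k-1. \<beta> i) + capped_eta (Suc m) r \<beta> \<delta> k"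
    using minors_dvd_power_diag[OF p \<alpha> k] by blast
qed

text \<open>If the lattice has type \<open>\<alpha>\<close>, its minors give the partial sums of \<open>\<alpha>\<close>, which put \<open>\<delta>\<close> into \<open>T\<close>.
  Conversely, the lattice has some type \<open>\<alpha>'\<close>; if \<open>\<delta>\<close> is in \<open>T\<close>, then \<open>\<alpha>\<close> and \<open>\<alpha>'\<close> have the same
  partial sums, so that \<open>\<alpha>' = \<alpha>\<close>.\<close>

lemma extension_lattice_typed_iff_T:
  assumes p: "prime p" and P: "P \<in> GL m" and \<beta>: "\<beta> \<in> partitions m M" and r: "0 \<le> r"
    and v: "has_valuations p m \<beta> w \<delta>" and \<delta>: "\<delta> \<in> tuples m" and \<alpha>: "\<alpha> \<in> partitions (Suc m) N"
  shows "extension_lattice p m P r \<beta> w \<in> typed_sublattices p (Suc m) \<alpha> \<longleftrightarrow> \<delta> \<in> T (Suc m) r \<alpha> \<beta>"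
proof -
  have "\<delta> \<in> T (Suc m) r \<alpha> \<beta> \<longleftrightarrow>
      (\<forall>k\<in>{1..Suc m}. (\<Sum>i=1..k. \<alpha> i) = (\<Sum>i=1..k-1. \<beta> i) + capped_eta (Suc m) r \<beta> \<delta> k)"
    by (rule T_iff_partial_sums[OF _ r]) (use \<beta> \<delta> v in \<open>auto simp: has_valuations_def\<close>)
  moreover have "extension_lattice p m P r \<beta> w \<in> typed_sublattices p (Suc m) \<alpha>"
    if eq: "\<And>k. k \<in> {1..Suc m} \<Longrightarrow> (\<Sum>i=1..k. \<alpha> i) = (\<Sum>i=1..k-1. \<beta> i) + capped_eta (Suc m) r \<beta> \<delta> k"
  proof -
    obtain N' \<alpha>' where \<alpha>': "\<alpha>' \<in> partitions (Suc m) N'"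
        "extension_lattice p m P r \<beta> w \<in> typed_sublattices p (Suc m) \<alpha>'"
      using exists_typed_sublattice[OF p int_subgroup_extension_lattice[OF P] extension_lattice_contains_powers[OF P \<beta>]]
      by blast
    have "\<alpha> = \<alpha>'"
      by (rule partition_eqI[OF \<alpha> \<alpha>'(1)])
         (use eq extension_lattice_partial_sums[OF p P \<beta> r v \<alpha>'] in simp)
    then show ?thesis using \<alpha>' by simp
  qed
  ultimately show ?thesis
    using extension_lattice_partial_sums[OF p P \<beta> r v \<alpha>] by (metis atLeastAtMost_iff)
qed

section \<open>Counting extensions of given type\<close>

lemma exists_valuation:
  fixes x :: int
  shows "\<exists>d\<le>b. int p ^ d dvd x \<and> (d < b \<longrightarrow> \<not> int p ^ Suc d dvd x)"
proof (induction b)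
  case (Suc b)
  then obtain d where d: "d \<le> b" "int p ^ d dvd x" "d < b \<longrightarrow> \<not> int p ^ Suc d dvd x" by blast
  show ?case
  proof (cases "int p ^ Suc b dvd x")
    case True then show ?thesis by blast
  next
    case False
    then show ?thesis using d by (intro exI[of _ d]) (auto simp: less_Suc_eq le_eq_less_or_eq)
  qed
qed simp

lemma exists_valuations:
  assumes \<beta>: "\<And>i. 0 \<le> \<beta> i"
  shows "\<exists>\<delta>\<in>tuples m. has_valuations p m \<beta> w \<delta>"
proof -
  have "\<forall>i. \<exists>d\<le>nat (\<beta> i). int p ^ d dvd w i \<and> (d < nat (\<beta> i) \<longrightarrow> \<not> int p ^ Suc d dvd w i)"
    using exists_valuation by blast
  then obtain d where d: "\<And>i. d i \<le> nat (\<beta> i) \<and> int p ^ d i dvd w i \<and>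
      (d i < nat (\<beta> i) \<longrightarrow> \<not> int p ^ Suc (d i) dvd w i)"
    by metis
  define \<delta> where "\<delta> i = (if i \<in> {1..m} then int (d i) else 0)" for i
  have "has_valuations p m \<beta> w \<delta>"
    unfolding has_valuations_def
  proof
    fix i assume "i \<in> {1..m}"
    then have "\<delta> i = int (d i)" by (simp add: \<delta>_def)
    moreover have "int (d i) \<le> \<beta> i" using d[of i] \<beta>[of i] by linarith
    moreover have "d i < nat (\<beta> i)" if "int (d i) < \<beta> i" using that by linarith
    ultimately show "0 \<le> \<delta> i \<and> \<delta> i \<le> \<beta> i \<and> int p ^ nat (\<delta> i) dvd w i \<and>
        (\<delta> i < \<beta> i \<longrightarrow> \<not> int p ^ Suc (nat (\<delta> i)) dvd w i)"
      using d[of i] by simp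
  qed
  moreover have "\<delta> \<in> tuples m" by (simp add: tuples_def \<delta>_def)
  ultimately show ?thesis by blast
qed

lemma has_valuations_unique:
  assumes v: "has_valuations p m \<beta> w \<delta>" "has_valuations p m \<beta> w \<delta>'"
    and \<delta>: "\<delta> \<in> tuples m" "\<delta>' \<in> tuples m"
  shows "\<delta> = \<delta>'"
proof (rule tuples_eqI[OF \<delta>])
  have le: "a i \<le> b i" if "has_valuations p m \<beta> w a" "has_valuations p m \<beta> w b" "i \<in> {1..m}" for a b i
  proof (rule ccontr)
    assume "\<not> a i \<le> b i"
    moreover have a: "0 \<le> a i" "a i \<le> \<beta> i" "int p ^ nat (a i) dvd w i"
      and b: "0 \<le> b i" "b i < \<beta> i \<Longrightarrow> \<not> int p ^ Suc (nat (b i)) dvd w i"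
      using that unfolding has_valuations_def by blast+
    ultimately have "Suc (nat (b i)) \<le> nat (a i)" "b i < \<beta> i" by linarith+
    then show False using a(3) b(2) power_le_dvd by blast
  qed
  fix i assume "i \<in> {1..m}"
  then show "\<delta> i = \<delta>' i" using le[OF v] le[OF v(2) v(1)] by (intro antisym) auto
qed

text \<open>Representatives of \<open>\<int>\<^sup>m\<close> modulo the diagonal lattice of type \<open>\<beta>\<close>.\<close>

definition residue_box :: "nat \<Rightarrow> nat \<Rightarrow> (nat \<Rightarrow> int) \<Rightarrow> (nat \<Rightarrow> int) set" where
  "residue_box p m \<beta> = (\<Pi>\<^sub>E i\<in>{1..m}. {0..<int p ^ nat (\<beta> i)})"

lemma finite_residue_box: "finite (residue_box p m \<beta>)"
  unfolding residue_box_def by (intro finite_PiE) auto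

lemma card_multiples_below_power:
  assumes p: "0 < p" and d: "d \<le> b"
  shows "card {x \<in> {0..<int p ^ b}. int p ^ d dvd x} = p ^ (b - d)"
proof -
  have pd: "0 < int p ^ d" using p by simp
  have split: "int p ^ b = int p ^ d * int p ^ (b - d)" using d by (simp add: power_add[symmetric])
  have "{x \<in> {0..<int p ^ b}. int p ^ d dvd x} = (\<lambda>x. int p ^ d * x) ` {0..<int p ^ (b - d)}"
  proof (intro equalityI subsetI)
    fix x assume "x \<in> {x \<in> {0..<int p ^ b}. int p ^ d dvd x}"
    then obtain y where y: "x = int p ^ d * y" and x: "0 \<le> x" "x < int p ^ b" by auto
    have "0 \<le> y" "y < int p ^ (b - d)"
      using x pd unfolding y split by (simp_all add: zero_le_mult_iff)
    then show "x \<in> (\<lambda>x. int p ^ d * x) ` {0..<int p ^ (b - d)}" using y by (intro image_eqI[of _ _ y]) simp_all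
  qed (use pd split in auto)
  moreover have "inj_on (\<lambda>x. int p ^ d * x) {0..<int p ^ (b - d)}" using p by (intro inj_onI) auto
  ultimately have "card {x \<in> {0..<int p ^ b}. int p ^ d dvd x} = card {0..<int p ^ (b - d)}"
    by (simp add: card_image)
  also have "\<dots> = nat (int (p ^ (b - d)))" by simp
  finally show ?thesis by (simp only: nat_int)
qed

text \<open>For \<open>d < b\<close> these are the multiples of \<open>p ^ d\<close> that are not multiples of \<open>p ^ (d + 1)\<close>; for
  \<open>d = b\<close> only 0 remains, which explains why \<open>\<tau>\<close> has no factor for \<open>\<delta>\<^sub>i = \<beta>\<^sub>i\<close>.\<close>

lemma card_residues_with_valuation:
  assumes p: "0 < p" and d: "d \<le> b"
  shows "int (card {x \<in> {0..<int p ^ b}. int p ^ d dvd x \<and> (d < b \<longrightarrow> \<not> int p ^ Suc d dvd x)})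
    = (if d < b then int p ^ (b - d) - int p ^ (b - d - 1) else 1)"
proof (cases "d < b")
  case True
  let ?A = "{x \<in> {0..<int p ^ b}. int p ^ d dvd x}"
  let ?B = "{x \<in> {0..<int p ^ b}. int p ^ Suc d dvd x}"
  have "int p ^ d dvd x" if "int p ^ Suc d dvd x" for x
    by (rule power_le_dvd[OF that]) simp
  then have sub: "?B \<subseteq> ?A" by blast
  have finA: "finite ?A" by (rule finite_subset[of _ "{0..<int p ^ b}"]) auto
  have A: "card ?A = p ^ (b - d)" by (rule card_multiples_below_power[OF p d])
  have B: "card ?B = p ^ (b - Suc d)" by (rule card_multiples_below_power[OF p]) (use True in simp)
  have "{x \<in> {0..<int p ^ b}. int p ^ d dvd x \<and> (d < b \<longrightarrow> \<not> int p ^ Suc d dvd x)} = ?A - ?B"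
    using True by blast
  then have "card {x \<in> {0..<int p ^ b}. int p ^ d dvd x \<and> (d < b \<longrightarrow> \<not> int p ^ Suc d dvd x)}
      = p ^ (b - d) - p ^ (b - Suc d)"
    unfolding A[symmetric] B[symmetric] by (simp only: card_Diff_subset[OF finite_subset[OF sub finA] sub])
  moreover have "p ^ (b - Suc d) \<le> p ^ (b - d)" using p by (intro power_increasing) auto
  ultimately show ?thesis using True by (simp only: of_nat_diff of_nat_power if_True diff_diff_left Suc_eq_plus1)
next
  case False
  then show ?thesis using card_multiples_below_power[OF p d] d by simp
qed

lemma card_residues_with_valuations:
  assumes p: "prime p" and \<delta>: "\<And>i. i \<in> {1..m} \<Longrightarrow> 0 \<le> \<delta> i \<and> \<delta> i \<le> \<beta> i"
  shows "int (card {w \<in> residue_box p m \<beta>. has_valuations p m \<beta> w \<delta>}) = tau (Suc m) p \<beta> \<delta>"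
proof -
  have p0: "0 < p" by (rule prime_gt_0_nat[OF p])
  define C where "C i x \<longleftrightarrow> int p ^ nat (\<delta> i) dvd x \<and>
    (nat (\<delta> i) < nat (\<beta> i) \<longrightarrow> \<not> int p ^ Suc (nat (\<delta> i)) dvd x)" for i x
  let ?R = "\<lambda>i. {x \<in> {0..<int p ^ nat (\<beta> i)}. C i x}"
  have lt: "nat (\<delta> i) < nat (\<beta> i) \<longleftrightarrow> \<delta> i < \<beta> i" if "i \<in> {1..m}" for i
    using \<delta>[OF that] by linarith
  have "has_valuations p m \<beta> w \<delta> \<longleftrightarrow> (\<forall>i\<in>{1..m}. C i (w i))" for w
    unfolding has_valuations_def C_def by (rule ball_cong[OF refl]) (simp only: \<delta> lt simp_thms)
  then have "{w \<in> residue_box p m \<beta>. has_valuations p m \<beta> w \<delta>} = (\<Pi>\<^sub>E i\<in>{1..m}. ?R i)"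
    unfolding residue_box_def by (intro Set.set_eqI) (simp add: PiE_iff ball_conj_distrib conj_ac)
  then have "int (card {w \<in> residue_box p m \<beta>. has_valuations p m \<beta> w \<delta>}) = (\<Prod>i\<in>{1..m}. int (card (?R i)))"
    by (simp add: card_PiE)
  also have "\<dots> = (\<Prod>i\<in>{1..m}. if \<delta> i < \<beta> i then int p ^ nat (\<beta> i - \<delta> i) - int p ^ nat (\<beta> i - \<delta> i - 1) else 1)"
  proof (rule prod.cong[OF refl])
    fix i assume i: "i \<in> {1..m}"
    have "nat (\<delta> i) \<le> nat (\<beta> i)" using \<delta>[OF i] by linarith
    moreover have "nat (\<beta> i) - nat (\<delta> i) = nat (\<beta> i - \<delta> i)" using \<delta>[OF i] by linarith
    moreover have "nat (\<beta> i - \<delta> i) - 1 = nat (\<beta> i - \<delta> i - 1)" by linarith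
    ultimately show "int (card (?R i))
        = (if \<delta> i < \<beta> i then int p ^ nat (\<beta> i - \<delta> i) - int p ^ nat (\<beta> i - \<delta> i - 1) else 1)"
      using card_residues_with_valuation[OF p0, of "nat (\<delta> i)" "nat (\<beta> i)"] lt[OF i] unfolding C_def by simp
  qed
  also have "\<dots> = tau (Suc m) p \<beta> \<delta>"
    unfolding tau_def by (subst prod.inter_filter) simp_all
  finally show ?thesis .
qed

lemma finite_T: "finite (T n r \<alpha> \<beta>)"
proof -
  let ?B = "\<Union>i\<in>{1..n-1}. {0..\<beta> i}"
  have "T n r \<alpha> \<beta> \<subseteq> {\<delta>. \<forall>i. (i \<in> {1..n-1} \<longrightarrow> \<delta> i \<in> ?B) \<and> (i \<notin> {1..n-1} \<longrightarrow> \<delta> i = 0)}"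
    unfolding T_def tuples_def by fastforce
  then show ?thesis by (rule finite_subset) (intro finite_set_of_finite_funs; simp)
qed

lemma finite_partitions: "finite (partitions n N)"
proof -
  have "partitions n N \<subseteq> {\<delta>. \<forall>i. (i \<in> {1..n} \<longrightarrow> \<delta> i \<in> {0..N}) \<and> (i \<notin> {1..n} \<longrightarrow> \<delta> i = 0)}"
  proof
    fix \<alpha> assume \<alpha>: "\<alpha> \<in> partitions n N"
    then show "\<alpha> \<in> {\<delta>. \<forall>i. (i \<in> {1..n} \<longrightarrow> \<delta> i \<in> {0..N}) \<and> (i \<notin> {1..n} \<longrightarrow> \<delta> i = 0)}"
      using partitions_nonneg[OF \<alpha>] partitions_le[OF \<alpha>] by (simp add: partitions_def tuples_def)
  qed
  then show ?thesis by (rule finite_subset) (intro finite_set_of_finite_funs; simp)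
qed

text \<open>The type of an extension depends only on the valuations of \<open>w\<close>, so the residue vectors are
  sorted by their valuations \<open>\<delta>\<close>, and \<open>\<tau>\<close> counts each class.\<close>

lemma card_extensions_of_type:
  assumes p: "prime p" and P: "P \<in> GL m" and \<beta>: "\<beta> \<in> partitions m M" and r: "0 \<le> r"
    and \<alpha>: "\<alpha> \<in> partitions (Suc m) N"
  shows "int (card {w \<in> residue_box p m \<beta>. extension_lattice p m P r \<beta> w \<in> typed_sublattices p (Suc m) \<alpha>})
    = (\<Sum>\<delta>\<in>T (Suc m) r \<alpha> \<beta>. tau (Suc m) p \<beta> \<delta>)"
proof -
  let ?W = "\<lambda>\<delta>. {w \<in> residue_box p m \<beta>. has_valuations p m \<beta> w \<delta>}"
  let ?T = "T (Suc m) r \<alpha> \<beta>"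
  have T: "\<delta> \<in> tuples m" "\<And>i. i \<in> {1..m} \<Longrightarrow> 0 \<le> \<delta> i \<and> \<delta> i \<le> \<beta> i" if "\<delta> \<in> ?T" for \<delta>
    using that unfolding T_def by auto
  note iff = extension_lattice_typed_iff_T[OF p P \<beta> r _ _ \<alpha>]
  have "{w \<in> residue_box p m \<beta>. extension_lattice p m P r \<beta> w \<in> typed_sublattices p (Suc m) \<alpha>} = (\<Union>\<delta>\<in>?T. ?W \<delta>)"
  proof (intro equalityI subsetI)
    fix w assume w: "w \<in> {w \<in> residue_box p m \<beta>. extension_lattice p m P r \<beta> w \<in> typed_sublattices p (Suc m) \<alpha>}"
    obtain \<delta> where "\<delta> \<in> tuples m" "has_valuations p m \<beta> w \<delta>"
      using exists_valuations[of \<beta>, OF partitions_nonneg[OF \<beta>]] by blast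
    then show "w \<in> (\<Union>\<delta>\<in>?T. ?W \<delta>)" using w iff by blast
  next
    fix w assume "w \<in> (\<Union>\<delta>\<in>?T. ?W \<delta>)"
    then show "w \<in> {w \<in> residue_box p m \<beta>. extension_lattice p m P r \<beta> w \<in> typed_sublattices p (Suc m) \<alpha>}"
      using iff T by blast
  qed
  moreover have "card (\<Union>\<delta>\<in>?T. ?W \<delta>) = (\<Sum>\<delta>\<in>?T. card (?W \<delta>))"
  proof (rule card_UN_disjoint[OF finite_T])
    show "\<forall>\<delta>\<in>?T. finite (?W \<delta>)" using finite_residue_box[of p m \<beta>] by simp
    show "\<forall>\<delta>\<in>?T. \<forall>\<delta>'\<in>?T. \<delta> \<noteq> \<delta>' \<longrightarrow> ?W \<delta> \<inter> ?W \<delta>' = {}"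
      using has_valuations_unique T(1) by blast
  qed
  moreover have "int (card (?W \<delta>)) = tau (Suc m) p \<beta> \<delta>" if "\<delta> \<in> ?T" for \<delta>
    using card_residues_with_valuations[OF p T(2)[OF that]] .
  ultimately show ?thesis by simp
qed

section \<open>The parametrisation of sublattices by extensions\<close>

lemma extension_lattice_generator:
  assumes P: "P \<in> GL m"
  shows "vCons (int p ^ nat r) (P *\<^sub>v vec m (\<lambda>i. w (Suc i))) \<in> extension_lattice p m P r \<beta> w"
  unfolding extension_lattice_iff[OF P]
proof (intro exI[of _ 1] bexI[of _ "0\<^sub>v m"])
  have "power_diag p m \<beta> *\<^sub>v 0\<^sub>v m = 0\<^sub>v m" by (intro eq_vecI) (auto simp: power_diag_def mat_diag_def)
  moreover have "1 \<cdot>\<^sub>v vec m (\<lambda>i. w (Suc i)) + 0\<^sub>v m = vec m (\<lambda>i. w (Suc i))" by (intro eq_vecI) auto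
  ultimately show "vCons (int p ^ nat r) (P *\<^sub>v vec m (\<lambda>i. w (Suc i))) = vCons (1 * int p ^ nat r)
     (P *\<^sub>v (1 \<cdot>\<^sub>v vec m (\<lambda>i. w (Suc i)) + power_diag p m \<beta> *\<^sub>v 0\<^sub>v m))" by simp
qed simp

text \<open>A vector with first coordinate 0 uses the additional generator with coefficient 0. So the
  extension recovers the lattice in the hyperplane from which it was built.\<close>

lemma extension_lattice_hyperplane:
  assumes p: "prime p" and P: "P \<in> GL m"
  shows "{y. vCons 0 y \<in> extension_lattice p m P r \<beta> w} = column_lattice (P * power_diag p m \<beta>)"
proof -
  have zero: "0 \<cdot>\<^sub>v vec m (\<lambda>i. w (Suc i)) + power_diag p m \<beta> *\<^sub>v z = power_diag p m \<beta> *\<^sub>v z"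
    if "z \<in> carrier_vec m" for z
    using that by (intro eq_vecI) (auto simp: power_diag_def mat_diag_def)
  show ?thesis
  proof (intro equalityI subsetI)
    fix y assume "y \<in> {y. vCons 0 y \<in> extension_lattice p m P r \<beta> w}"
    then obtain t z where z: "z \<in> carrier_vec m" and eq: "vCons 0 y = vCons (t * int p ^ nat r)
        (P *\<^sub>v (t \<cdot>\<^sub>v vec m (\<lambda>i. w (Suc i)) + power_diag p m \<beta> *\<^sub>v z))"
      unfolding mem_Collect_eq extension_lattice_iff[OF P] by blast
    have "t = 0" using eq prime_gt_0_nat[OF p] by auto
    then have "y = P *\<^sub>v (power_diag p m \<beta> *\<^sub>v z)" using eq zero[OF z] by simp
    then show "y \<in> column_lattice (P * power_diag p m \<beta>)"
      unfolding mem_column_lattice_power_diag[OF P] using z by blast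
  next
    fix y assume "y \<in> column_lattice (P * power_diag p m \<beta>)"
    then obtain z where z: "z \<in> carrier_vec m" "y = P *\<^sub>v (power_diag p m \<beta> *\<^sub>v z)"
      unfolding mem_column_lattice_power_diag[OF P] by blast
    then have "vCons 0 y = vCons (0 * int p ^ nat r)
        (P *\<^sub>v (0 \<cdot>\<^sub>v vec m (\<lambda>i. w (Suc i)) + power_diag p m \<beta> *\<^sub>v z))"
      using zero[OF z(1)] by simp
    then show "y \<in> {y. vCons 0 y \<in> extension_lattice p m P r \<beta> w}"
      unfolding mem_Collect_eq extension_lattice_iff[OF P] using z(1) by blast
  qed
qed

lemma extension_lattice_exponent_le:
  assumes p: "prime p" and P: "P \<in> GL m" and P': "P' \<in> GL m" and r: "0 \<le> r" "0 \<le> r'"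
    and eq: "extension_lattice p m P r \<beta> w = extension_lattice p m P' r' \<beta>' w'"
  shows "r' \<le> r"
proof -
  have "vCons (int p ^ nat r) (P *\<^sub>v vec m (\<lambda>i. w (Suc i))) \<in> extension_lattice p m P' r' \<beta>' w'"
    using extension_lattice_generator[OF P] eq by blast
  then obtain t where "int p ^ nat r = t * int p ^ nat r'"
    unfolding extension_lattice_iff[OF P'] by auto
  then have "int p ^ nat r' dvd int p ^ nat r" by simp
  then show ?thesis using int_power_dvd_iff[OF p] r by simp
qed

text \<open>Two vectors over the same first coordinate \<open>p ^ r\<close> differ by an element of the lattice in the
  hyperplane, so their residues agree.\<close>

lemma extension_lattice_residues_unique:
  assumes p: "prime p" and P: "P \<in> GL m" and w: "w \<in> residue_box p m \<beta>" "w' \<in> residue_box p m \<beta>"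
    and eq: "extension_lattice p m P r \<beta> w = extension_lattice p m P r \<beta> w'"
  shows "w = w'"
proof -
  define W where "W = vec m (\<lambda>i. w (Suc i))"
  define W' where "W' = vec m (\<lambda>i. w' (Suc i))"
  have "vCons (int p ^ nat r) (P *\<^sub>v W) \<in> extension_lattice p m P r \<beta> w'"
    using extension_lattice_generator[OF P] eq unfolding W_def by blast
  then obtain t z where z: "z \<in> carrier_vec m" and e: "vCons (int p ^ nat r) (P *\<^sub>v W) = vCons (t * int p ^ nat r)
      (P *\<^sub>v (t \<cdot>\<^sub>v W' + power_diag p m \<beta> *\<^sub>v z))"
    unfolding extension_lattice_iff[OF P] W'_def by blast
  have "t = 1" using e prime_gt_0_nat[OF p] by auto
  moreover have "1 \<cdot>\<^sub>v W' = W'" by (intro eq_vecI) auto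
  ultimately have PW: "P *\<^sub>v W = P *\<^sub>v (W' + power_diag p m \<beta> *\<^sub>v z)" using e by simp
  obtain Q where Q: "Q \<in> GL m" "Q * P = 1\<^sub>m m" using GL_inverse[OF P] by metis
  note c = GL_carrier[OF Q(1)] GL_carrier[OF P]
  have Wc: "W \<in> carrier_vec m" "W' + power_diag p m \<beta> *\<^sub>v z \<in> carrier_vec m"
    using z unfolding W_def W'_def by (auto intro!: add_carrier_vec mult_mat_vec_carrier[of _ m m])
  have WW: "W = W' + power_diag p m \<beta> *\<^sub>v z"
    using mult_inverse_vec[OF c Q(2) Wc(1)] mult_inverse_vec[OF c Q(2) Wc(2)] unfolding PW by (rule trans[OF sym])
  show ?thesis
  proof (rule PiE_ext[OF w[unfolded residue_box_def]])
    fix i assume i: "i \<in> {1..m}"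
    then obtain l where l: "i = Suc l" "l < m" by (cases i) auto
    have "W $ l = W' $ l + (power_diag p m \<beta> *\<^sub>v z) $ l"
      unfolding WW by (rule index_add_vec) (use l(2) in \<open>simp add: power_diag_def mat_diag_def\<close>)
    then have "w i = w' i + int p ^ nat (\<beta> i) * z $ l"
      using l power_diag_mult_vec[OF z l(2)] by (simp add: W_def W'_def)
    moreover have "w i \<in> {0..<int p ^ nat (\<beta> i)}" "w' i \<in> {0..<int p ^ nat (\<beta> i)}"
      using w i unfolding residue_box_def by (auto simp: PiE_iff)
    ultimately show "w i = w' i"
      by (metis atLeastLessThan_iff mod_mult_self2 mod_pos_pos_trivial)
  qed
qed

lemma int_subgroup_hyperplane:
  assumes H: "int_subgroup (Suc m) H"
  shows "int_subgroup m {y \<in> carrier_vec m. vCons 0 y \<in> H}"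
  unfolding int_subgroup_def
proof (intro conjI ballI)
  show "0\<^sub>v m \<in> {y \<in> carrier_vec m. vCons 0 y \<in> H}"
    using H unfolding int_subgroup_def by (simp add: zero_vec_Suc)
  fix x y assume xy: "x \<in> {y \<in> carrier_vec m. vCons 0 y \<in> H}" "y \<in> {y \<in> carrier_vec m. vCons 0 y \<in> H}"
  then have "vCons 0 x - vCons 0 y \<in> H" using H unfolding int_subgroup_def by blast
  moreover have "vCons 0 (x - y) = vCons 0 x - vCons 0 y"
    using xy by (intro eq_vecI) (auto simp: vec_index_vCons)
  ultimately show "x - y \<in> {y \<in> carrier_vec m. vCons 0 y \<in> H}" using xy by simp
qed auto

text \<open>The first coordinates form an ideal of \<open>\<int>\<close>, generated by its least positive element, which
  divides a power of \<open>p\<close> that lies in the ideal.\<close>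

lemma first_coordinates_prime_power:
  assumes p: "prime p" and H: "int_subgroup (Suc m) H"
    and pow: "\<And>x. x \<in> carrier_vec (Suc m) \<Longrightarrow> int p ^ K \<cdot>\<^sub>v x \<in> H"
  shows "\<exists>r. (\<exists>v\<in>carrier_vec m. vCons (int p ^ r) v \<in> H) \<and> (\<forall>a y. vCons a y \<in> H \<longrightarrow> int p ^ r dvd a)"
proof -
  let ?P = "\<lambda>g. 0 < g \<and> (\<exists>v\<in>carrier_vec m. vCons (int g) v \<in> H)"
  have Hc: "H \<subseteq> carrier_vec (Suc m)" using H by (simp add: int_subgroup_def)
  have "int p ^ K \<cdot>\<^sub>v vCons 1 (0\<^sub>v m) \<in> H" by (rule pow) simp
  moreover have "int p ^ K \<cdot>\<^sub>v vCons 1 (0\<^sub>v m) = vCons (int (p ^ K)) (0\<^sub>v m)"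
    by (intro eq_vecI) (auto simp: vec_index_vCons)
  ultimately have K: "vCons (int (p ^ K)) (0\<^sub>v m) \<in> H" by simp
  then have "?P (p ^ K)" using prime_gt_0_nat[OF p] by auto
  then have Pg: "?P (LEAST g. ?P g)" by (rule LeastI)
  define g where "g = (LEAST g. ?P g)"
  obtain v where g: "0 < g" "v \<in> carrier_vec m" "vCons (int g) v \<in> H" using Pg unfolding g_def by blast
  have div: "int g dvd a" if a: "vCons a y \<in> H" for a y
  proof (rule ccontr)
    assume "\<not> int g dvd a"
    then have "a mod int g \<noteq> 0" by (simp only: dvd_eq_mod_eq_0 not_False_eq_True)
    moreover have "0 \<le> a mod int g" "a mod int g < int g" using g(1) by simp_all
    ultimately have mod: "0 < a mod int g" "a mod int g < int g" by linarith+
    have y: "y \<in> carrier_vec m" using a Hc by auto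
    have "vCons a y + (- (a div int g)) \<cdot>\<^sub>v vCons (int g) v \<in> H"
      by (rule int_subgroup_add[OF H a int_subgroup_smult[OF H g(3)]])
    moreover have "vCons a y + (- (a div int g)) \<cdot>\<^sub>v vCons (int g) v
        = vCons (a mod int g) (y + (- (a div int g)) \<cdot>\<^sub>v v)"
      using y g(2) by (intro eq_vecI) (auto simp: vec_index_vCons minus_div_mult_eq_mod[symmetric])
    ultimately have "?P (nat (a mod int g))"
      using mod y g(2) by (auto intro!: bexI[of _ "y + (- (a div int g)) \<cdot>\<^sub>v v"])
    then have "g \<le> nat (a mod int g)" unfolding g_def by (rule Least_le)
    then show False using mod by linarith
  qed
  have "int g dvd int (p ^ K)" by (rule div[OF K])
  then have "g dvd p ^ K" by (simp only: of_nat_dvd_iff)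
  then obtain r where "g = p ^ r" using divides_primepow_nat[OF p] by blast
  then show ?thesis using g div by (intro exI[of _ r]) auto
qed

text \<open>Surjectivity of the parametrisation. The vector over \<open>p ^ r\<close> is found from the ideal of first
  coordinates and is then reduced modulo the hyperplane lattice \<open>K\<close>. The result holds for every
  presentation \<open>P\<close> of \<open>K\<close>, so that one presentation can be chosen for each \<open>K\<close> beforehand. The sum of the
  parts is preserved: this is the comparison of the full determinants, the case \<open>k = m + 1\<close> of the partial sums.\<close>

lemma sublattice_is_extension:
  assumes p: "prime p" and \<alpha>: "\<alpha> \<in> partitions (Suc m) N" and H: "H \<in> typed_sublattices p (Suc m) \<alpha>"
  shows "\<exists>r\<in>{0..N}. \<exists>\<beta>\<in>partitions m (N - r). \<exists>K\<in>typed_sublattices p m \<beta>. \<forall>P\<in>GL m.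
    K = column_lattice (P * power_diag p m \<beta>) \<longrightarrow> (\<exists>w\<in>residue_box p m \<beta>. H = extension_lattice p m P r \<beta> w)"
proof -
  have sub: "int_subgroup (Suc m) H"
  proof -
    obtain P where P: "P \<in> GL (Suc m)" "H = column_lattice (P * power_diag p (Suc m) \<alpha>)"
      using H unfolding typed_sublattices_def by blast
    show ?thesis unfolding P(2) using GL_carrier[OF P(1)] by (intro int_subgroup_column_lattice[of _ _ "Suc m"]) auto
  qed
  have Hc: "H \<subseteq> carrier_vec (Suc m)" using sub by (simp add: int_subgroup_def)
  have pow: "int p ^ nat N \<cdot>\<^sub>v x \<in> H" if "x \<in> carrier_vec (Suc m)" for x
    by (rule typed_sublattice_contains_powers[OF \<alpha> H that])
  obtain r v where v: "v \<in> carrier_vec m" "vCons (int p ^ r) v \<in> H"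
    and div: "\<And>a y. vCons a y \<in> H \<Longrightarrow> int p ^ r dvd a"
    using first_coordinates_prime_power[OF p sub pow] by blast
  define K where "K = {y \<in> carrier_vec m. vCons 0 y \<in> H}"
  have "int p ^ nat N \<cdot>\<^sub>v y \<in> K" if y: "y \<in> carrier_vec m" for y
  proof -
    have "int p ^ nat N \<cdot>\<^sub>v vCons 0 y = vCons 0 (int p ^ nat N \<cdot>\<^sub>v y)"
      by (intro eq_vecI) (auto simp: vec_index_vCons)
    then show ?thesis using pow[of "vCons 0 y"] y by (simp add: K_def)
  qed
  then obtain M \<beta> where \<beta>: "\<beta> \<in> partitions m M" and K: "K \<in> typed_sublattices p m \<beta>"
    using exists_typed_sublattice[OF p int_subgroup_hyperplane[OF sub], folded K_def] by blast
  have ext: "\<exists>w\<in>residue_box p m \<beta>. H = extension_lattice p m P (int r) \<beta> w"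
    if P: "P \<in> GL m" and KP: "K = column_lattice (P * power_diag p m \<beta>)" for P
  proof -
    obtain Q where Q: "Q \<in> GL m" "P * Q = 1\<^sub>m m" using GL_inverse[OF P] by metis
    note cP = GL_carrier[OF P] and cQ = GL_carrier[OF Q(1)]
    define q where "q = Q *\<^sub>v v"
    have qc: "q \<in> carrier_vec m" using cQ v by (simp add: q_def)
    have Pq: "P *\<^sub>v q = v" unfolding q_def by (rule mult_inverse_vec[OF cP cQ Q(2) v(1)])
    define w where "w = (\<lambda>i\<in>{1..m}. q $ (i - 1) mod int p ^ nat (\<beta> i))"
    have wbox: "w \<in> residue_box p m \<beta>"
      using prime_gt_0_nat[OF p] by (auto simp: residue_box_def w_def)
    define W where "W = vec m (\<lambda>i. w (Suc i))"
    have Wc: "W \<in> carrier_vec m" by (simp add: W_def)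
    \<comment> \<open>Quotients and residues of the same divisions: \<open>q = W + D z0\<close>.\<close>
    define z0 where "z0 = vec m (\<lambda>i. q $ i div int p ^ nat (\<beta> (Suc i)))"
    have z0: "z0 \<in> carrier_vec m" by (simp add: z0_def)
    define D where "D = power_diag p m \<beta>"
    have Dc: "D \<in> carrier_mat m m" by (simp add: D_def)
    have Dz: "D *\<^sub>v z \<in> carrier_vec m" if "z \<in> carrier_vec m" for z using Dc that by simp
    have "q = W + D *\<^sub>v z0"
    proof (rule eq_vecI)
      fix i assume "i < dim_vec (W + D *\<^sub>v z0)"
      then have i: "i < m" using Dc by simp
      have "(D *\<^sub>v z0) $ i = int p ^ nat (\<beta> (Suc i)) * (q $ i div int p ^ nat (\<beta> (Suc i)))"
        using power_diag_mult_vec[OF z0 i] i unfolding D_def z0_def by simp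
      moreover have "W $ i = q $ i mod int p ^ nat (\<beta> (Suc i))" using i by (simp add: W_def w_def)
      moreover have "(W + D *\<^sub>v z0) $ i = W $ i + (D *\<^sub>v z0) $ i"
        using i Dc by (intro index_add_vec) auto
      ultimately show "q $ i = (W + D *\<^sub>v z0) $ i" by simp
    qed (use qc Dc in auto)
    then have v_eq: "v = P *\<^sub>v W + P *\<^sub>v (D *\<^sub>v z0)"
      using Pq mult_add_distrib_mat_vec[OF cP Wc Dz[OF z0]] by simp
    have PD: "P *\<^sub>v (D *\<^sub>v z) \<in> K" if "z \<in> carrier_vec m" for z
      unfolding KP mem_column_lattice_power_diag[OF P] D_def using that by blast
    have PWc: "P *\<^sub>v W \<in> carrier_vec m" using cP Wc by simp
    have vs: "vCons (a - b) (x - y) = vCons a x - vCons b y"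
      if "x \<in> carrier_vec m" "y \<in> carrier_vec m" for a b and x y :: "int vec"
      using that by (intro eq_vecI) (auto simp: vec_index_vCons)
    have gen: "vCons (int p ^ r) (P *\<^sub>v W) \<in> H"
    proof -
      have k: "P *\<^sub>v (D *\<^sub>v z0) \<in> carrier_vec m" "vCons 0 (P *\<^sub>v (D *\<^sub>v z0)) \<in> H"
        using PD[OF z0] by (auto simp: K_def)
      have "vCons (int p ^ r) v - vCons 0 (P *\<^sub>v (D *\<^sub>v z0)) \<in> H"
        using sub v k unfolding int_subgroup_def by blast
      moreover have "P *\<^sub>v W = v - P *\<^sub>v (D *\<^sub>v z0)"
        unfolding v_eq using PWc k(1) by (intro eq_vecI) auto
      ultimately show ?thesis using vs[OF v(1) k(1), of "int p ^ r" 0] by simp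
    qed
    have tW: "P *\<^sub>v (t \<cdot>\<^sub>v W + D *\<^sub>v z) = t \<cdot>\<^sub>v (P *\<^sub>v W) + P *\<^sub>v (D *\<^sub>v z)"
      if z: "z \<in> carrier_vec m" for t z
      using mult_add_distrib_mat_vec[OF cP _ Dz[OF z], of "t \<cdot>\<^sub>v W"] mult_mat_vec_int[OF cP Wc] Wc by simp
    have "H = extension_lattice p m P (int r) \<beta> w"
    proof (intro equalityI subsetI)
      fix h assume h: "h \<in> H"
      have "h \<in> carrier_vec (Suc m)" using h Hc by blast
      then obtain a y where y: "y \<in> carrier_vec m" "h = vCons a y" by (rule carrier_vec_Suc_cases)
      have "int p ^ r dvd a" using div[of a y] h y by simp
      then obtain t where "a = int p ^ r * t" by (rule dvdE)
      then have t: "a = t * int p ^ r" by simp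
      have tP: "t \<cdot>\<^sub>v (P *\<^sub>v W) \<in> carrier_vec m" using PWc by simp
      have tg: "t \<cdot>\<^sub>v vCons (int p ^ r) (P *\<^sub>v W) = vCons a (t \<cdot>\<^sub>v (P *\<^sub>v W))"
        by (intro eq_vecI) (auto simp: vec_index_vCons t)
      have "vCons a y - vCons a (t \<cdot>\<^sub>v (P *\<^sub>v W)) \<in> H"
        using int_subgroup_smult[OF sub gen, of t] h sub unfolding y tg int_subgroup_def by blast
      then have "y - t \<cdot>\<^sub>v (P *\<^sub>v W) \<in> K"
        using vs[OF y(1) tP, of a a] y(1) tP by (simp add: K_def)
      then obtain z where z: "z \<in> carrier_vec m" "y - t \<cdot>\<^sub>v (P *\<^sub>v W) = P *\<^sub>v (D *\<^sub>v z)"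
        unfolding KP mem_column_lattice_power_diag[OF P] D_def by blast
      have "b + (y - b) = y" if "b \<in> carrier_vec m" for b
        using y(1) that by (intro eq_vecI) auto
      from this[OF tP] have "y = P *\<^sub>v (t \<cdot>\<^sub>v W + D *\<^sub>v z)" using tW[OF z(1)] z(2) by simp
      then show "h \<in> extension_lattice p m P (int r) \<beta> w"
        unfolding extension_lattice_iff[OF P] y(2) t nat_int W_def D_def using z(1) by blast
    next
      fix h assume "h \<in> extension_lattice p m P (int r) \<beta> w"
      then obtain t z where z: "z \<in> carrier_vec m"
        and h: "h = vCons (t * int p ^ r) (P *\<^sub>v (t \<cdot>\<^sub>v W + D *\<^sub>v z))"
        unfolding extension_lattice_iff[OF P] nat_int W_def D_def by blast
      have k: "P *\<^sub>v (D *\<^sub>v z) \<in> carrier_vec m" "vCons 0 (P *\<^sub>v (D *\<^sub>v z)) \<in> H"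
        using PD[OF z] by (auto simp: K_def)
      have "t \<cdot>\<^sub>v vCons (int p ^ r) (P *\<^sub>v W) + vCons 0 (P *\<^sub>v (D *\<^sub>v z)) \<in> H"
        by (rule int_subgroup_add[OF sub int_subgroup_smult[OF sub gen] k(2)])
      moreover have "t \<cdot>\<^sub>v vCons (int p ^ r) (P *\<^sub>v W) + vCons 0 (P *\<^sub>v (D *\<^sub>v z)) = h"
        unfolding h tW[OF z] using PWc k(1) by (intro eq_vecI) (auto simp: vec_index_vCons)
      ultimately show "h \<in> H" by simp
    qed
    then show ?thesis using wbox by blast
  qed
  have "N = M + int r"
  proof -
    obtain P where P: "P \<in> GL m" "K = column_lattice (P * power_diag p m \<beta>)"
      using K unfolding typed_sublattices_def by blast
    obtain w where w: "H = extension_lattice p m P (int r) \<beta> w" using ext[OF P] by blast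
    obtain \<delta> where \<delta>: "has_valuations p m \<beta> w \<delta>"
      using exists_valuations[of \<beta>, OF partitions_nonneg[OF \<beta>]] by blast
    have "(\<Sum>i=1..Suc m. \<alpha> i) = (\<Sum>i=1..Suc m-1. \<beta> i) + capped_eta (Suc m) (int r) \<beta> \<delta> (Suc m)"
      by (rule extension_lattice_partial_sums[OF p P(1) \<beta> _ \<delta> \<alpha>]) (use H w in auto)
    then show ?thesis using \<alpha> \<beta> by (simp add: capped_eta_def partitions_def)
  qed
  moreover have "0 \<le> M" using partitions_le[OF \<beta>, of 0] partitions_nonneg[OF \<beta>, of 0] by linarith
  ultimately show ?thesis using \<beta> K ext by (intro bexI[of _ "int r"] bexI[of _ \<beta>] bexI[of _ K]) auto
qed

text \<open>One fixed unimodular matrix for each \<open>K\<close>, as residue vectors are meaningful only relative to it.\<close>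

definition presentation :: "nat \<Rightarrow> nat \<Rightarrow> (nat \<Rightarrow> int) \<Rightarrow> int vec set \<Rightarrow> int mat" where
  "presentation p m \<beta> K = (SOME P. P \<in> GL m \<and> K = column_lattice (P * power_diag p m \<beta>))"

lemma presentation:
  assumes "K \<in> typed_sublattices p m \<beta>"
  shows "presentation p m \<beta> K \<in> GL m" "K = column_lattice (presentation p m \<beta> K * power_diag p m \<beta>)"
proof -
  have "\<exists>P. P \<in> GL m \<and> K = column_lattice (P * power_diag p m \<beta>)"
    using assms unfolding typed_sublattices_def by blast
  from someI_ex[OF this] show "presentation p m \<beta> K \<in> GL m"
    "K = column_lattice (presentation p m \<beta> K * power_diag p m \<beta>)"
    unfolding presentation_def by blast+
qed

text \<open>The parametrisation by extensions bounds the number of sublattices inductively. Finiteness is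
  what turns the cardinality of the dependent sums below into iterated sums.\<close>

lemma finite_typed_sublattices:
  assumes p: "prime p"
  shows "\<alpha> \<in> partitions n N \<Longrightarrow> finite (typed_sublattices p n \<alpha>)"
proof (induction n arbitrary: \<alpha> N)
  case 0
  have "typed_sublattices p 0 \<alpha> \<subseteq> Pow {0\<^sub>v 0}"
  proof
    fix H assume "H \<in> typed_sublattices p 0 \<alpha>"
    then have "H \<subseteq> carrier_vec 0" by (rule typed_sublattices_subset)
    moreover have "x = 0\<^sub>v 0" if "x \<in> carrier_vec 0" for x :: "int vec"
      using that by (intro eq_vecI) auto
    ultimately show "H \<in> Pow {0\<^sub>v 0}" by blast
  qed
  then show ?case by (rule finite_subset) simp
next
  case (Suc m)
  let ?S = "\<Union>r\<in>{0..N}. \<Union>\<beta>\<in>partitions m (N - r). \<Union>K\<in>typed_sublattices p m \<beta>.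
    extension_lattice p m (presentation p m \<beta> K) r \<beta> ` residue_box p m \<beta>"
  have "typed_sublattices p (Suc m) \<alpha> \<subseteq> ?S"
  proof
    fix H assume "H \<in> typed_sublattices p (Suc m) \<alpha>"
    from sublattice_is_extension[OF p Suc.prems this] obtain r \<beta> K
      where 1: "r \<in> {0..N}" "\<beta> \<in> partitions m (N - r)" "K \<in> typed_sublattices p m \<beta>"
        and 2: "\<And>P. P \<in> GL m \<Longrightarrow> K = column_lattice (P * power_diag p m \<beta>) \<Longrightarrow>
          \<exists>w\<in>residue_box p m \<beta>. H = extension_lattice p m P r \<beta> w" by blast
    show "H \<in> ?S" using 1 2[OF presentation[OF 1(3)]] by blast
  qed
  moreover have "finite ?S"
    using Suc.IH finite_partitions finite_residue_box by (intro finite_UN_I finite_imageI) auto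
  ultimately show ?case by (rule finite_subset)
qed

text \<open>The recursion in coordinates: sending \<open>(r, \<beta>, K, w)\<close> to the extension lattice is a bijection onto
  the sublattices of type \<open>\<alpha>\<close>. It is injective because \<open>r\<close>, \<open>K\<close>, the type \<open>\<beta>\<close> of \<open>K\<close> and finally \<open>w\<close>
  can be read off from the lattice, and the number of admissible \<open>w\<close> is the same for all \<open>K\<close> of type \<open>\<beta>\<close>.\<close>

lemma card_typed_sublattices_Suc:
  assumes p: "prime p" and \<alpha>: "\<alpha> \<in> partitions (Suc m) N"
  shows "int (card (typed_sublattices p (Suc m) \<alpha>)) =
    (\<Sum>r\<in>{0..N}. \<Sum>\<beta>\<in>partitions m (N - r).
       int (card (typed_sublattices p m \<beta>)) * (\<Sum>\<delta>\<in>T (Suc m) r \<alpha> \<beta>. tau (Suc m) p \<beta> \<delta>))"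
proof -
  define E where "E r \<beta> K = extension_lattice p m (presentation p m \<beta> K) r \<beta>" for r \<beta> K
  define W where "W r \<beta> K = {w \<in> residue_box p m \<beta>. E r \<beta> K w \<in> typed_sublattices p (Suc m) \<alpha>}" for r \<beta> K
  define S where "S = (SIGMA r:{0..N}. SIGMA \<beta>:partitions m (N - r). SIGMA K:typed_sublattices p m \<beta>. W r \<beta> K)"
  define \<Psi> where "\<Psi> = (\<lambda>(r, \<beta>, K, w). E r \<beta> K w)"
  have finW: "finite (W r \<beta> K)" for r \<beta> K unfolding W_def using finite_residue_box by simp
  have "\<Psi> ` S = typed_sublattices p (Suc m) \<alpha>"
  proof (intro equalityI subsetI)
    fix H assume "H \<in> \<Psi> ` S"
    then show "H \<in> typed_sublattices p (Suc m) \<alpha>" by (auto simp: \<Psi>_def S_def W_def)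
  next
    fix H assume H: "H \<in> typed_sublattices p (Suc m) \<alpha>"
    from sublattice_is_extension[OF p \<alpha> this] obtain r \<beta> K
      where 1: "r \<in> {0..N}" "\<beta> \<in> partitions m (N - r)" "K \<in> typed_sublattices p m \<beta>"
        and 2: "\<And>P. P \<in> GL m \<Longrightarrow> K = column_lattice (P * power_diag p m \<beta>) \<Longrightarrow>
          \<exists>w\<in>residue_box p m \<beta>. H = extension_lattice p m P r \<beta> w" by blast
    obtain w where w: "w \<in> residue_box p m \<beta>" "H = E r \<beta> K w"
      using 2[OF presentation[OF 1(3)]] unfolding E_def by blast
    have "(r, \<beta>, K, w) \<in> S" using 1 w H by (simp add: S_def W_def)
    moreover have "H = \<Psi> (r, \<beta>, K, w)" using w by (simp add: \<Psi>_def)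
    ultimately show "H \<in> \<Psi> ` S" by (rule rev_image_eqI)
  qed
  moreover have "inj_on \<Psi> S"
  proof (rule inj_onI)
    fix x x' assume x: "x \<in> S" "x' \<in> S" "\<Psi> x = \<Psi> x'"
    obtain r \<beta> K w r' \<beta>' K' w' where xx: "x = (r, \<beta>, K, w)" "x' = (r', \<beta>', K', w')"
      by (cases x, cases x') auto
    have 1: "0 \<le> r" "\<beta> \<in> partitions m (N - r)" "K \<in> typed_sublattices p m \<beta>" "w \<in> residue_box p m \<beta>"
      and 2: "0 \<le> r'" "\<beta>' \<in> partitions m (N - r')" "K' \<in> typed_sublattices p m \<beta>'" "w' \<in> residue_box p m \<beta>'"
      and eq: "E r \<beta> K w = E r' \<beta>' K' w'"
      using x unfolding xx S_def W_def \<Psi>_def by auto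
    note P = presentation[OF 1(3)] and P' = presentation[OF 2(3)]
    have r: "r = r'"
      using extension_lattice_exponent_le[OF p P(1) P'(1) 1(1) 2(1) eq[unfolded E_def]]
        extension_lattice_exponent_le[OF p P'(1) P(1) 2(1) 1(1) eq[unfolded E_def, symmetric]] by simp
    have "K = {y. vCons 0 y \<in> E r \<beta> K w}" "K' = {y. vCons 0 y \<in> E r' \<beta>' K' w'}"
      using extension_lattice_hyperplane[OF p P(1)] extension_lattice_hyperplane[OF p P'(1)] P(2) P'(2)
      unfolding E_def by blast+
    then have K: "K = K'" using eq by simp
    have \<beta>: "\<beta> = \<beta>'" by (rule typed_sublattices_disjoint[OF p 1(2) 2(2) 1(3)]) (use 2(3) K in simp)
    have "w = w'"
      by (rule extension_lattice_residues_unique[OF p P(1) 1(4)]) (use 2(4) eq r K \<beta> in \<open>auto simp: E_def\<close>)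
    then show "x = x'" using xx r K \<beta> by simp
  qed
  ultimately have "card (typed_sublattices p (Suc m) \<alpha>) = card S" by (metis card_image)
  also have "card S = (\<Sum>r\<in>{0..N}. \<Sum>\<beta>\<in>partitions m (N - r). \<Sum>K\<in>typed_sublattices p m \<beta>. card (W r \<beta> K))"
    unfolding S_def using finW finite_partitions finite_typed_sublattices[OF p]
    by (simp add: card_SigmaI finite_SigmaI)
  also have "int \<dots> = (\<Sum>r\<in>{0..N}. \<Sum>\<beta>\<in>partitions m (N - r). \<Sum>K\<in>typed_sublattices p m \<beta>. int (card (W r \<beta> K)))"
    by simp
  also have "\<dots> = (\<Sum>r\<in>{0..N}. \<Sum>\<beta>\<in>partitions m (N - r).
       int (card (typed_sublattices p m \<beta>)) * (\<Sum>\<delta>\<in>T (Suc m) r \<alpha> \<beta>. tau (Suc m) p \<beta> \<delta>))"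
  proof (intro sum.cong refl)
    fix r \<beta> assume r: "r \<in> {0..N}" and \<beta>: "\<beta> \<in> partitions m (N - r)"
    have "int (card (W r \<beta> K)) = (\<Sum>\<delta>\<in>T (Suc m) r \<alpha> \<beta>. tau (Suc m) p \<beta> \<delta>)"
      if "K \<in> typed_sublattices p m \<beta>" for K
      unfolding W_def E_def
      by (rule card_extensions_of_type[OF p presentation(1)[OF that] \<beta> _ \<alpha>]) (use r in simp)
    then show "(\<Sum>K\<in>typed_sublattices p m \<beta>. int (card (W r \<beta> K)))
      = int (card (typed_sublattices p m \<beta>)) * (\<Sum>\<delta>\<in>T (Suc m) r \<alpha> \<beta>. tau (Suc m) p \<beta> \<delta>)" by simp
  qed
  finally show ?thesis .
qed

theorem theorem4p2:
  fixes n p :: nat and N :: int and \<alpha> :: "nat \<Rightarrow> int"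
    and L :: "'a::euclidean_space set" and L' :: "'b::euclidean_space set"
  assumes "n \<ge> 2" and "prime p" and "N \<ge> 0" and "\<alpha> \<in> partitions n N"
    and "is_lattice n L" and "is_lattice (n - 1) L'"
  shows "int (num_sublattices n L \<alpha> p) =
    (\<Sum>r1 \<in> {0..N}. \<Sum>\<beta> \<in> partitions (n - 1) (N - r1).
       int (num_sublattices (n - 1) L' \<beta> p) * (\<Sum>\<delta> \<in> T n r1 \<alpha> \<beta>. tau n p \<beta> \<delta>))"
proof -
  obtain m where n: "n = Suc m" using assms(1) by (cases n) auto
  have L': "is_lattice m L'" using assms(6) n by simp
  have \<alpha>: "\<alpha> \<in> partitions (Suc m) N" using assms(4) n by simp
  have "int (num_sublattices n L \<alpha> p) = int (card (typed_sublattices p (Suc m) \<alpha>))"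
    using num_sublattices_eq_card_typed[OF assms(5,2,4)] n by simp
  also have "\<dots> = (\<Sum>r\<in>{0..N}. \<Sum>\<beta>\<in>partitions m (N - r).
       int (card (typed_sublattices p m \<beta>)) * (\<Sum>\<delta>\<in>T (Suc m) r \<alpha> \<beta>. tau (Suc m) p \<beta> \<delta>))"
    by (rule card_typed_sublattices_Suc[OF assms(2) \<alpha>])
  also have "\<dots> = (\<Sum>r\<in>{0..N}. \<Sum>\<beta>\<in>partitions m (N - r).
       int (num_sublattices m L' \<beta> p) * (\<Sum>\<delta>\<in>T (Suc m) r \<alpha> \<beta>. tau (Suc m) p \<beta> \<delta>))"
    by (intro sum.cong refl) (simp add: num_sublattices_eq_card_typed[OF L' assms(2)])
  finally show ?thesis unfolding n by simp
qed

end
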